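(* For every $\beta=\sigma+i\tau\in\mathbb{C}$, the following limit exists in probability and in $L^q$ for all $q\ge 1$: $$p(\beta):=\lim_{n\to\infty}\frac1n\log|\mathcal{Z}_n(\beta)|=\sum_{k=1}^d p_k(\beta),$$ where, for $1\le k\le d$, $$p_k(\beta)=\begin{cases}|\sigma|\sqrt{2a_k\log\alpha_k}, & \beta\in\overline{G_k},\\ \frac12\log\alpha_k+a_k\sigma^2, & \beta\in\overline{F_k},\\ \log\alpha_k+\frac12a_k(\sigma^2-\tau^2), & \beta\in\overline{E_k}.\end{cases}$$
   Context: GREM. Fix $d\in\mathbb{N}$, variances $a_1,\dots,a_d>0$, branching exponents $\alpha_1,\dots,\alpha_d>1$, and sequences of natural numbers $N_{n,1},\dots,N_{n,d}$ with $\lim_{n\to\infty}N_{n,j}/\alpha_j^n=1$ for each $j$. Let $\mathbb{S}_n=\{\varepsilon=(\varepsilon_1,\dots,\varepsilon_d)\in\mathbb{N}^d:1\le\varepsilon_j\le N_{n,j},\ 1\le j\le d\}$. Let $\{\xi_{\varepsilon_1\dots\varepsilon_j}:1\le j\le d,\ 1\le\varepsilon_i\le N_{n,i}\}$ be independent real standard normal random variables, $X_\varepsilon=\sum_{j=1}^d\sqrt{a_j}\,\xi_{\varepsilon_1\dots\varepsilon_j}$, and let the partition function be $\mathcal{Z}_n(\beta)=\sum_{\varepsilon\in\mathbb{S}_n}e^{\beta\sqrt n X_\varepsilon}$, $\beta\in\mathbb{C}$. Write $\beta=\sigma+i\tau$ with $\sigma,\tau\in\mathbb{R}$. Put $\sigma_j=\sqrt{2\log\alpha_j/a_j}$;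 it is assumed throughout that $\sigma_1<\dots<\sigma_d$. Phases. For $1\le k\le d$: $G_k=\{\beta\in\mathbb{C}:2|\sigma|>\sigma_k,\ |\sigma|+|\tau|>\sigma_k\}$, $F_k=\{\beta\in\mathbb{C}:2|\sigma|<\sigma_k,\ 2(\sigma^2+\tau^2)>\sigma_k^2\}$, $E_k=\mathbb{C}\setminus\overline{G_k\cup F_k}$, where bars denote closures. The formulas for $p_k$ agree on the overlaps of the closures. *)

theory Defs
  imports "HOL-Probability.Probability"
begin

section \<open>The generalized random energy model with complex temperature\<close>

text \<open>
  A multi-index \<open>(e1, ..., ej)\<close> is the list \<open>[e1, ..., ej]\<close>, so that the vertices of all levels
  of the tree live in one type and the ancestor of a leaf \<open>e\<close> at level \<open>j\<close> is \<open>take j e\<close>.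
  Levels are numbered \<open>1, ..., d\<close>, whereas list positions start at \<open>0\<close>.
\<close>

definition grem_vertices :: "nat \<Rightarrow> (nat \<Rightarrow> nat) \<Rightarrow> nat list set" where
  "grem_vertices d N =
     {w. 1 \<le> length w \<and> length w \<le> d \<and> (\<forall>i<length w. w ! i \<in> {1..N (Suc i)})}"

definition grem_leaves :: "nat \<Rightarrow> (nat \<Rightarrow> nat) \<Rightarrow> nat list set" where
  "grem_leaves d N = {e. length e = d \<and> (\<forall>i<d. e ! i \<in> {1..N (Suc i)})}"

definition grem_energy ::
  "nat \<Rightarrow> (nat \<Rightarrow> real) \<Rightarrow> (nat list \<Rightarrow> 'w \<Rightarrow> real) \<Rightarrow> nat list \<Rightarrow> 'w \<Rightarrow> real" where
  "grem_energy d a \<xi> e \<omega> = (\<Sum>j=1..d. sqrt (a j) * \<xi> (take j e) \<omega>)"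

text \<open>
  The disorder \<open>\<xi> n\<close> may depend on the system size \<open>n\<close>, with no joint law across different \<open>n\<close>
  prescribed; a single family \<open>\<xi>\<close> used for all \<open>n\<close> is the special case \<open>\<lambda>_. \<xi>\<close>.
\<close>

definition grem_partition ::
  "nat \<Rightarrow> (nat \<Rightarrow> real) \<Rightarrow> (nat \<Rightarrow> nat \<Rightarrow> nat) \<Rightarrow> (nat \<Rightarrow> nat list \<Rightarrow> 'w \<Rightarrow> real) \<Rightarrow>
     nat \<Rightarrow> complex \<Rightarrow> 'w \<Rightarrow> complex" where
  "grem_partition d a N \<xi> n \<beta> \<omega> =
     (\<Sum>e\<in>grem_leaves d (N n).
        exp (\<beta> * complex_of_real (sqrt (real n) * grem_energy d a (\<xi> n) e \<omega>)))"

text \<open>\<open>ln 0 = 0\<close> here; this only matters on the event that the partition function vanishes.\<close>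

definition grem_log_partition ::
  "nat \<Rightarrow> (nat \<Rightarrow> real) \<Rightarrow> (nat \<Rightarrow> nat \<Rightarrow> nat) \<Rightarrow> (nat \<Rightarrow> nat list \<Rightarrow> 'w \<Rightarrow> real) \<Rightarrow>
     complex \<Rightarrow> nat \<Rightarrow> 'w \<Rightarrow> real" where
  "grem_log_partition d a N \<xi> \<beta> n \<omega> = 1 / real n * ln (cmod (grem_partition d a N \<xi> n \<beta> \<omega>))"


section \<open>Phases and the limiting log-partition function\<close>

definition grem_sigma :: "real \<Rightarrow> real \<Rightarrow> real" where
  "grem_sigma a \<alpha> = sqrt (2 * ln \<alpha> / a)"

definition phase_G :: "real \<Rightarrow> complex set" where
  "phase_G s = {\<beta>. 2 * \<bar>Re \<beta>\<bar> > s \<and> \<bar>Re \<beta>\<bar> + \<bar>Im \<beta>\<bar> > s}"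

definition phase_F :: "real \<Rightarrow> complex set" where
  "phase_F s = {\<beta>. 2 * \<bar>Re \<beta>\<bar> < s \<and> 2 * ((Re \<beta>)\<^sup>2 + (Im \<beta>)\<^sup>2) > s\<^sup>2}"

definition phase_E :: "real \<Rightarrow> complex set" where
  "phase_E s = - closure (phase_G s \<union> phase_F s)"

text \<open>
  The order of the tests is immaterial: \<open>grem_p_G\<close>, \<open>grem_p_F\<close> and \<open>grem_p_E\<close> below show that
  the three formulas hold on the whole of the respective closures, including their overlaps.
\<close>

definition grem_p :: "real \<Rightarrow> real \<Rightarrow> complex \<Rightarrow> real" where
  "grem_p a \<alpha> \<beta> =
     (let s = grem_sigma a \<alpha> in
      if \<beta> \<in> closure (phase_G s) then \<bar>Re \<beta>\<bar> * sqrt (2 * a * ln \<alpha>)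
      else if \<beta> \<in> closure (phase_F s) then 1 / 2 * ln \<alpha> + a * (Re \<beta>)\<^sup>2
      else ln \<alpha> + 1 / 2 * a * ((Re \<beta>)\<^sup>2 - (Im \<beta>)\<^sup>2))"

lemma phases_cover: "closure (phase_G s) \<union> closure (phase_F s) \<union> closure (phase_E s) = UNIV"
  using closure_subset[of "phase_E s"] by (auto simp: phase_E_def closure_Un)

lemma closure_phase_G_subset:
  "closure (phase_G s) \<subseteq> {\<beta>. 2 * \<bar>Re \<beta>\<bar> \<ge> s \<and> \<bar>Re \<beta>\<bar> + \<bar>Im \<beta>\<bar> \<ge> s}"
proof (rule closure_minimal)
  show "closed {\<beta>. 2 * \<bar>Re \<beta>\<bar> \<ge> s \<and> \<bar>Re \<beta>\<bar> + \<bar>Im \<beta>\<bar> \<ge> s}"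
    by (intro closed_Collect_conj closed_Collect_le continuous_intros)
qed (auto simp: phase_G_def)

lemma closure_phase_F_subset:
  "closure (phase_F s) \<subseteq> {\<beta>. 2 * \<bar>Re \<beta>\<bar> \<le> s \<and> 2 * ((Re \<beta>)\<^sup>2 + (Im \<beta>)\<^sup>2) \<ge> s\<^sup>2}"
proof (rule closure_minimal)
  show "closed {\<beta>. 2 * \<bar>Re \<beta>\<bar> \<le> s \<and> 2 * ((Re \<beta>)\<^sup>2 + (Im \<beta>)\<^sup>2) \<ge> s\<^sup>2}"
    by (intro closed_Collect_conj closed_Collect_le continuous_intros)
qed (auto simp: phase_F_def)

lemma closure_phase_E_disjoint:
  assumes s: "s > 0" and \<beta>: "\<beta> \<in> closure (phase_E s)"
  shows "\<beta> \<notin> phase_G s" "\<beta> \<notin> phase_F s" "\<not> (2 * \<bar>Re \<beta>\<bar> = s \<and> \<bar>Re \<beta>\<bar> + \<bar>Im \<beta>\<bar> > s)"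
proof -
  have disj: "\<beta> \<notin> U" if "open U" "U \<subseteq> closure (phase_G s \<union> phase_F s)" for U
  proof -
    have "U \<inter> phase_E s = {}" using that(2) by (auto simp: phase_E_def)
    thus ?thesis using open_Int_closure_eq_empty[OF that(1)] \<beta> by blast
  qed
  have "open (phase_G s)"
    unfolding phase_G_def by (intro open_Collect_conj open_Collect_less continuous_intros)
  thus "\<beta> \<notin> phase_G s" by (rule disj) (simp add: closure_Un closure_subset le_supI1)
  have "open (phase_F s)"
    unfolding phase_F_def by (intro open_Collect_conj open_Collect_less continuous_intros)
  thus "\<beta> \<notin> phase_F s" by (rule disj) (simp add: closure_Un closure_subset le_supI2)
  define U where "U = {\<beta>. \<bar>Re \<beta>\<bar> + \<bar>Im \<beta>\<bar> > s}"
  have "open U"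
    unfolding U_def by (intro open_Collect_less continuous_intros)
  moreover have "U \<subseteq> closure (phase_G s \<union> phase_F s)"
  proof
    fix z assume z: "z \<in> U"
    consider "2 * \<bar>Re z\<bar> > s" | "2 * \<bar>Re z\<bar> < s" | "2 * \<bar>Re z\<bar> = s" by linarith
    thus "z \<in> closure (phase_G s \<union> phase_F s)"
    proof cases
      case 1
      hence "z \<in> phase_G s" using z by (auto simp: phase_G_def U_def)
      thus ?thesis using closure_subset by blast
    next
      case 2
      have "s\<^sup>2 < (\<bar>Re z\<bar> + \<bar>Im z\<bar>)\<^sup>2"
        using z s by (intro power_strict_mono) (auto simp: U_def)
      also have "\<dots> \<le> (\<bar>Re z\<bar> + \<bar>Im z\<bar>)\<^sup>2 + (\<bar>Re z\<bar> - \<bar>Im z\<bar>)\<^sup>2" by simp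
      also have "\<dots> = 2 * (\<bar>Re z\<bar>\<^sup>2 + \<bar>Im z\<bar>\<^sup>2)" by (simp only: power2_eq_square) algebra
      finally have "z \<in> phase_F s" using 2 by (simp add: phase_F_def)
      thus ?thesis using closure_subset by blast
    next
      case 3
      define w where "w n = z + complex_of_real (sgn (Re z) / real (Suc n))" for n
      have abs: "\<bar>Re (w n)\<bar> = \<bar>Re z\<bar> + 1 / real (Suc n)" for n
      proof -
        have pos: "1 / real (Suc n) > 0" by simp
        have Re: "Re (w n) = Re z + sgn (Re z) / real (Suc n)" by (simp add: w_def)
        consider "Re z > 0" | "Re z < 0" using 3 s by fastforce
        thus ?thesis
        proof cases
          case 1
          hence "Re (w n) = Re z + 1 / real (Suc n)" using Re by simp
          thus ?thesis using 1 pos by linarith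
        next
          case 2
          hence "Re (w n) = Re z - 1 / real (Suc n)" using Re by simp
          thus ?thesis using 2 pos by linarith
        qed
      qed
      have "w n \<in> phase_G s" for n
      proof -
        have "Im (w n) = Im z" by (simp add: w_def)
        moreover have "1 / real (Suc n) > 0" by simp
        ultimately show ?thesis using z 3 abs[of n] unfolding phase_G_def U_def mem_Collect_eq
          by linarith
      qed
      moreover have "w \<longlonglongrightarrow> z + complex_of_real 0"
        unfolding w_def by (intro tendsto_intros LIMSEQ_Suc[OF lim_const_over_n])
      ultimately have "z \<in> closure (phase_G s)"
        unfolding closure_sequential by (intro exI[of _ w]) auto
      thus ?thesis by (simp add: closure_Un)
    qed
  qed
  ultimately show "\<not> (2 * \<bar>Re \<beta>\<bar> = s \<and> \<bar>Re \<beta>\<bar> + \<bar>Im \<beta>\<bar> > s)"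
    using disj[of U] by (auto simp: U_def)
qed

lemma grem_sigma_facts:
  assumes "a > 0" "\<alpha> > 1"
  shows "grem_sigma a \<alpha> > 0" "2 * ln \<alpha> = a * (grem_sigma a \<alpha>)\<^sup>2"
    "sqrt (2 * a * ln \<alpha>) = a * grem_sigma a \<alpha>"
proof -
  show 0: "grem_sigma a \<alpha> > 0" using assms by (simp add: grem_sigma_def)
  show 1: "2 * ln \<alpha> = a * (grem_sigma a \<alpha>)\<^sup>2" using assms by (simp add: grem_sigma_def)
  have "2 * a * ln \<alpha> = (a * grem_sigma a \<alpha>)\<^sup>2"
    using 1 by (simp add: power2_eq_square)
  thus "sqrt (2 * a * ln \<alpha>) = a * grem_sigma a \<alpha>"
    using 0 assms by (simp only: real_sqrt_abs) simp
qed

lemma grem_p_G: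
  "\<beta> \<in> closure (phase_G (grem_sigma a \<alpha>)) \<Longrightarrow> grem_p a \<alpha> \<beta> = \<bar>Re \<beta>\<bar> * sqrt (2 * a * ln \<alpha>)"
  by (simp add: grem_p_def)

lemma grem_p_F:
  assumes "a > 0" "\<alpha> > 1" and F: "\<beta> \<in> closure (phase_F (grem_sigma a \<alpha>))"
  shows "grem_p a \<alpha> \<beta> = 1 / 2 * ln \<alpha> + a * (Re \<beta>)\<^sup>2"
proof (cases "\<beta> \<in> closure (phase_G (grem_sigma a \<alpha>))")
  case True
  note s = grem_sigma_facts[OF assms(1,2)]
  have eq: "grem_sigma a \<alpha> = 2 * \<bar>Re \<beta>\<bar>"
    using True F closure_phase_G_subset closure_phase_F_subset by fastforce
  have "(Re \<beta>)\<^sup>2 = \<bar>Re \<beta>\<bar> * \<bar>Re \<beta>\<bar>" by (simp add: power2_eq_square)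
  thus ?thesis using s(2,3) unfolding grem_p_G[OF True] eq
    by (simp add: power2_eq_square algebra_simps)
next
  case False
  thus ?thesis using F by (simp add: grem_p_def)
qed

lemma grem_p_E:
  assumes "a > 0" "\<alpha> > 1" and E: "\<beta> \<in> closure (phase_E (grem_sigma a \<alpha>))"
  shows "grem_p a \<alpha> \<beta> = ln \<alpha> + 1 / 2 * a * ((Re \<beta>)\<^sup>2 - (Im \<beta>)\<^sup>2)"
proof -
  define s where "s = grem_sigma a \<alpha>"
  note sf = grem_sigma_facts[OF assms(1,2), folded s_def]
  note d = closure_phase_E_disjoint[OF sf(1) E[folded s_def]]
  consider (G) "\<beta> \<in> closure (phase_G s)" | (F) "\<beta> \<in> closure (phase_F s)"
    | (none) "\<beta> \<notin> closure (phase_G s)" "\<beta> \<notin> closure (phase_F s)" by blast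
  thus ?thesis
  proof cases
    case G
    hence "2 * \<bar>Re \<beta>\<bar> \<ge> s" "\<bar>Re \<beta>\<bar> + \<bar>Im \<beta>\<bar> \<ge> s" using closure_phase_G_subset[of s] by auto
    hence "\<bar>Im \<beta>\<bar> = s - \<bar>Re \<beta>\<bar>" using d(1,3) unfolding phase_G_def by auto
    hence "(Im \<beta>)\<^sup>2 = (s - \<bar>Re \<beta>\<bar>)\<^sup>2" by (metis power2_abs)
    also have "\<dots> = s\<^sup>2 - 2 * s * \<bar>Re \<beta>\<bar> + (Re \<beta>)\<^sup>2" by (simp add: power2_diff)
    finally have diff: "(Re \<beta>)\<^sup>2 - (Im \<beta>)\<^sup>2 = 2 * s * \<bar>Re \<beta>\<bar> - s\<^sup>2" by simp
    have "ln \<alpha> + 1 / 2 * a * ((Re \<beta>)\<^sup>2 - (Im \<beta>)\<^sup>2) = ln \<alpha> - a * s\<^sup>2 / 2 + a * s * \<bar>Re \<beta>\<bar>"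
      unfolding diff by (simp add: algebra_simps)
    also have "\<dots> = \<bar>Re \<beta>\<bar> * sqrt (2 * a * ln \<alpha>)" using sf(2) unfolding sf(3) by simp
    finally show ?thesis using grem_p_G[OF G[unfolded s_def]] by simp
  next
    case F
    hence F': "2 * \<bar>Re \<beta>\<bar> \<le> s" "2 * ((Re \<beta>)\<^sup>2 + (Im \<beta>)\<^sup>2) \<ge> s\<^sup>2"
      using closure_phase_F_subset[of s] by auto
    have eq: "2 * ((Re \<beta>)\<^sup>2 + (Im \<beta>)\<^sup>2) = s\<^sup>2"
    proof (cases "2 * \<bar>Re \<beta>\<bar> = s")
      case True
      hence "\<bar>Im \<beta>\<bar> \<le> \<bar>Re \<beta>\<bar>" using d(3) by auto
      hence "(Im \<beta>)\<^sup>2 \<le> (Re \<beta>)\<^sup>2" by (simp add: abs_le_square_iff)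
      moreover have "s\<^sup>2 = 4 * (Re \<beta>)\<^sup>2" unfolding True[symmetric] by (simp add: power_mult_distrib)
      ultimately show ?thesis using F'(2) by (intro antisym) simp_all
    next
      case False
      thus ?thesis using d(2) F' by (auto simp: phase_F_def)
    qed
    have diff: "(Re \<beta>)\<^sup>2 - (Im \<beta>)\<^sup>2 = 2 * (Re \<beta>)\<^sup>2 - s\<^sup>2 / 2"
      unfolding eq[symmetric] by (simp add: algebra_simps)
    have "ln \<alpha> + 1 / 2 * a * ((Re \<beta>)\<^sup>2 - (Im \<beta>)\<^sup>2) = ln \<alpha> + a * (Re \<beta>)\<^sup>2 - a * s\<^sup>2 / 4"
      unfolding diff by (simp add: algebra_simps)
    also have "\<dots> = 1 / 2 * ln \<alpha> + a * (Re \<beta>)\<^sup>2" using sf(2) by simp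
    finally show ?thesis using grem_p_F[OF assms(1,2) F[unfolded s_def]] by simp
  next
    case none
    thus ?thesis by (simp add: grem_p_def s_def)
  qed
qed


section \<open>Modes of convergence\<close>

definition tendsto_in_probability ::
  "'w measure \<Rightarrow> (nat \<Rightarrow> 'w \<Rightarrow> real) \<Rightarrow> ('w \<Rightarrow> real) \<Rightarrow> bool" where
  "tendsto_in_probability M X Y \<longleftrightarrow>
     (\<forall>n. X n \<in> borel_measurable M) \<and> Y \<in> borel_measurable M \<and>
     (\<forall>\<epsilon>>0. (\<lambda>n. measure M {\<omega> \<in> space M. \<bar>X n \<omega> - Y \<omega>\<bar> > \<epsilon>}) \<longlonglongrightarrow> 0)"

text \<open>
  The extended nonnegative integral makes the limit carry the integrability of
  \<open>\<bar>X n - Y\<bar> powr q\<close> for all large \<open>n\<close>; with the Bochner integral, non-integrable terms would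
  silently count as \<open>0\<close>.
\<close>

definition tendsto_in_Lq ::
  "'w measure \<Rightarrow> real \<Rightarrow> (nat \<Rightarrow> 'w \<Rightarrow> real) \<Rightarrow> ('w \<Rightarrow> real) \<Rightarrow> bool" where
  "tendsto_in_Lq M q X Y \<longleftrightarrow>
     (\<forall>n. X n \<in> borel_measurable M) \<and> Y \<in> borel_measurable M \<and>
     (\<lambda>n. \<integral>\<^sup>+ \<omega>. ennreal (\<bar>X n \<omega> - Y \<omega>\<bar> powr q) \<partial>M) \<longlonglongrightarrow> 0"

end

theory Submission
  imports Defs "HOL-Real_Asymp.Real_Asymp"
begin

text \<open>
  Replacing \<open>\<xi>\<close> by \<open>-\<xi>\<close> if necessary, let \<open>Re \<beta> \<ge> 0\<close>. The partition function \<open>Z\<close> of a subtree is a sum of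
  independent terms \<open>exp (b * \<xi>) * W\<close>, where \<open>W\<close> is the partition function of a subtree one level
  further down.

  Upper bound: let \<open>r\<close> be the minimum of \<open>2\<close> and \<open>\<sigma>\<^sub>k / Re \<beta>\<close>. If \<open>r \<le> 1\<close>, subadditivity of \<open>x \<mapsto> x powr r\<close>,
  and otherwise the von Bahr-Esseen inequality for \<open>Z - E Z\<close>, bounds the \<open>r\<close>-th moment of \<open>Z\<close> by that
  of \<open>W\<close>. Since \<open>\<sigma>\<^sub>k\<close> increases with \<open>k\<close>, so does \<open>r\<close>, and the levels can be chained.

  Lower bound: in phase \<open>E\<close> all deeper levels are in phase \<open>E\<close> too, and \<open>Z - E Z\<close> is of smaller
  exponential order than \<open>E Z\<close>. In the closures of \<open>G\<close> and \<open>F\<close> the law of \<open>Z\<close> is spread out over the scale of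
  its fluctuations: the characteristic function of \<open>Re (exp (b * \<xi>) * W)\<close> is bounded away from \<open>1\<close>
  because of the values of \<open>\<xi>\<close> near \<open>y * sqrt (n * a)\<close>, over which the phase makes one turn; here \<open>y < \<sigma>\<^sub>k\<close>
  is close to the minimum of \<open>2 * Re \<beta>\<close> and \<open>\<sigma>\<^sub>k\<close>. This also covers the boundaries of the phases.

  Convergence in \<open>L\<^sup>q\<close> follows from bounded exponential moments of \<open>ln |Z| / n\<close>, whose lower tail is
  controlled by the randomness of a single leaf.
\<close>

section \<open>Moments and concentration of sums of independent variables\<close>

text \<open>Let s stand for the \<sigma> of a level. About exp (n * a * (s^2 - y^2) / 2) children
  have a value near y * sqrt (n * a), each of size exp (n * a * Re \<beta> * y). Square-root
  cancellation gives the exponent a * (s^2 - y^2) / 4 + a * Re \<beta> * y, to be maximised over 0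
  \<le> y \<le> s; the r-th moment gives a * s^2 / (2 * r) + r * a * (Re \<beta>)^2 / 2, to be
  minimised over 0 < r \<le> 2. Both extremal values coincide; this is the origin of r and y. The
  obstacle is the boundary of phase E, where mean and fluctuations have the same exponential order
  and might cancel. A characteristic function is insensitive to shifts in modulus and shows directly
  that Z does not concentrate on balls slightly smaller than the fluctuation scale. About the size
  of W this needs only that it is of the right order with probability at least 1/2, whereas the
  argument by the mean needs moments of some order r > 1 and a common mean of all W. For L^q the
  danger is a partition function close to 0; a negative moment of the sine of a normal variable
  controls it.\<close>

lemma powr_add_le_add_powr:
  fixes x y r :: real
  assumes "x \<ge> 0" "y \<ge> 0" "0 < r" "r \<le> 1"
  shows "(x + y) powr r \<le> x powr r + y powr r"
proof (cases "x + y = 0")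
  case True
  then show ?thesis using assms by simp
next
  case False
  then have s: "x + y > 0" using assms by simp
  have le: "z / (x + y) \<le> (z / (x + y)) powr r" if "0 \<le> z" "z \<le> x + y" for z
  proof (cases "z = 0")
    case False
    have "(z / (x + y)) powr 1 \<le> (z / (x + y)) powr r"
      using that s assms False by (intro powr_mono') auto
    then show ?thesis using that s by simp
  qed auto
  have "1 = x / (x + y) + y / (x + y)" using s by (simp add: add_divide_distrib[symmetric])
  also have "\<dots> \<le> (x / (x + y)) powr r + (y / (x + y)) powr r"
    by (intro add_mono le) (use assms in auto)
  also have "\<dots> = (x powr r + y powr r) / (x + y) powr r"
    using assms s by (simp add: powr_divide add_divide_distrib)
  finally show ?thesis using s by (simp add: field_simps)
qed

lemma powr_sum_le_sum_powr:
  fixes f :: "'i \<Rightarrow> real"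
  assumes "finite I" "\<And>i. i \<in> I \<Longrightarrow> f i \<ge> 0" "0 < r" "r \<le> 1"
  shows "(\<Sum>i\<in>I. f i) powr r \<le> (\<Sum>i\<in>I. f i powr r)"
  using assms(1,2)
proof (induction I rule: finite_induct)
  case (insert j I)
  have "(f j + (\<Sum>i\<in>I. f i)) powr r \<le> f j powr r + (\<Sum>i\<in>I. f i) powr r"
    using insert.prems assms by (intro powr_add_le_add_powr) (auto intro: sum_nonneg)
  with insert show ?case by fastforce
qed simp

lemma powr_add_le:
  fixes x y r :: real
  assumes "x \<ge> 0" "y \<ge> 0" "0 \<le> r" "r \<le> 2"
  shows "(x + y) powr r \<le> 4 * (x powr r + y powr r)"
proof -
  have "(x + y) powr r \<le> (2 * max x y) powr r"
    using assms by (intro powr_mono2) auto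
  also have "\<dots> = 2 powr r * max x y powr r"
    using assms by (simp add: powr_mult)
  also have "\<dots> \<le> 2 powr 2 * (x powr r + y powr r)"
    using assms by (intro mult_mono powr_mono) (auto simp: max_def)
  finally show ?thesis by simp
qed

text \<open>Concavity: the power lies below its tangent at 1, here as the weighted inequality
  between the means of 1 + u and 1. It serves below as a pointwise form of Jensen's inequality,
  which yields integrability along with the bound.\<close>

lemma powr_le_Bernoulli:
  fixes u \<theta> :: real
  assumes "u \<ge> -1" "0 < \<theta>" "\<theta> \<le> 1"
  shows "(1 + u) powr \<theta> \<le> 1 + \<theta> * u"
proof (cases "u = -1")
  case False
  then have u: "1 + u > 0" using assms by simp
  have "(1 + u) powr \<theta> * 1 powr (1 - \<theta>) \<le> \<theta> * (1 + u) + (1 - \<theta>) * 1"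
    using assms u by (intro Youngs_inequality_0) auto
  then show ?thesis by (simp add: algebra_simps)
qed (use assms in auto)

text \<open>A first-order expansion at 1 whose remainder has order r instead of 2 and is valid for
  large y as well. For small y the square of the modulus is computed exactly, and Bernoulli's
  inequality with exponent r / 2 keeps its linear part. For large y everything is absorbed: 4 comes
  from |1 + y| \<le> 2 * |y| and 2 from the linear term, hence 6.\<close>

lemma norm_one_add_powr_le:
  fixes y :: complex
  assumes r: "1 < r" "r \<le> 2"
  shows "cmod (1 + y) powr r \<le> 1 + r * Re y + 6 * cmod y powr r"
proof -
  have sq: "(cmod (1 + y))\<^sup>2 = 1 + (2 * Re y + (cmod y)\<^sup>2)"
    by (simp add: cmod_power2) (simp add: power2_eq_square algebra_simps)
  show ?thesis
  proof (cases "cmod y \<le> 1")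
    case True
    have "cmod (1 + y) powr r = ((cmod (1 + y))\<^sup>2) powr (r / 2)"
      by (cases "1 + y = 0") (auto simp: powr_powr simp flip: powr_numeral)
    also have "\<dots> \<le> 1 + r / 2 * (2 * Re y + (cmod y)\<^sup>2)"
    proof -
      have "2 * Re y + (cmod y)\<^sup>2 \<ge> -1" using sq by (smt (verit) zero_le_power2)
      then show ?thesis unfolding sq using r by (intro powr_le_Bernoulli) auto
    qed
    also have "\<dots> = 1 + r * Re y + r / 2 * (cmod y)\<^sup>2" by (simp add: algebra_simps)
    also have "(cmod y)\<^sup>2 \<le> cmod y powr r"
    proof (cases "y = 0")
      case False
      have "cmod y powr 2 \<le> cmod y powr r" using True r False by (intro powr_mono') auto
      then show ?thesis using False by simp
    qed auto
    then have "r / 2 * (cmod y)\<^sup>2 \<le> 6 * cmod y powr r"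
      using r by (intro mult_mono) auto
    finally show ?thesis by simp
  next
    case False
    have "cmod (1 + y) \<le> 2 * cmod y" using False norm_triangle_ineq[of 1 y] by simp
    then have "cmod (1 + y) powr r \<le> (2 * cmod y) powr r"
      using r by (intro powr_mono2) auto
    also have "\<dots> = 2 powr r * cmod y powr r" by (simp add: powr_mult)
    also have "\<dots> \<le> 2 powr 2 * cmod y powr r" using r by (intro mult_right_mono powr_mono) auto
    finally have 1: "cmod (1 + y) powr r \<le> 4 * cmod y powr r" by simp
    have "cmod y powr 1 \<le> cmod y powr r" using r False by (intro powr_mono) linarith+
    then have "cmod y \<le> cmod y powr r" using False by simp
    moreover have "- r * Re y \<le> 2 * cmod y"
    proof -
      have "- r * Re y \<le> r * \<bar>Re y\<bar>" using r
        by (smt (verit, ccfv_SIG) minus_mult_minus mult_left_mono mult_minus_left)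
      also have "\<dots> \<le> 2 * cmod y" using r by (intro mult_mono abs_Re_le_cmod) auto
      finally show ?thesis .
    qed
    ultimately show ?thesis using 1 by simp
  qed
qed

text \<open>The homogeneous form of the preceding inequality, by division by x. For x = 0 the cross
  term vanishes because \<open>0 powr (r - 2) = 0\<close>.\<close>

lemma norm_add_powr_le:
  fixes x y :: complex
  assumes r: "1 < r" "r \<le> 2"
  shows "cmod (x + y) powr r \<le>
    cmod x powr r + r * cmod x powr (r - 2) * Re (cnj x * y) + 6 * cmod y powr r"
proof (cases "x = 0")
  case False
  then have x: "cmod x > 0" by simp
  have "cmod (x + y) powr r = cmod x powr r * cmod (1 + y / x) powr r"
  proof -
    have "x + y = x * (1 + y / x)" using False by (simp add: field_simps)
    then show ?thesis by (metis norm_mult powr_mult)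
  qed
  also have "\<dots> \<le> cmod x powr r * (1 + r * Re (y / x) + 6 * cmod (y / x) powr r)"
    using r by (intro mult_left_mono norm_one_add_powr_le) auto
  also have "\<dots> = cmod x powr r + r * (cmod x powr r * Re (y / x)) + 6 * cmod y powr r"
    using x by (simp add: norm_divide powr_divide algebra_simps)
  also have "cmod x powr r * Re (y / x) = cmod x powr (r - 2) * Re (cnj x * y)"
  proof -
    have "Re (y / x) = Re (cnj x * y) / (cmod x)\<^sup>2"
      unfolding complex_div_cnj[of y x] by (simp add: mult.commute complex_norm_square[symmetric])
    moreover have "cmod x powr (r - 2) = cmod x powr r / (cmod x)\<^sup>2"
      using x by (simp add: powr_diff)
    ultimately show ?thesis by simp
  qed
  finally show ?thesis by (simp add: mult.assoc)
qed (use r in simp)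

context prob_space
begin

text \<open>Lyapunov's inequality, obtained by integrating the tangent of z \<mapsto> z powr (r / s)
  at z = B. An upper bound B > 0 in place of the moment itself avoids dividing by a moment that may
  be 0.\<close>

lemma expectation_powr_le:
  fixes X :: "'a \<Rightarrow> real"
  assumes [measurable]: "X \<in> borel_measurable M" and nn: "\<And>\<omega>. X \<omega> \<ge> 0"
    and r: "0 < r" "r \<le> s"
    and int: "integrable M (\<lambda>\<omega>. X \<omega> powr s)"
    and B: "expectation (\<lambda>\<omega>. X \<omega> powr s) \<le> B" "B > 0"
  shows "integrable M (\<lambda>\<omega>. X \<omega> powr r)"
    and "expectation (\<lambda>\<omega>. X \<omega> powr r) \<le> B powr (r / s)"
proof -
  define \<theta> where "\<theta> = r / s"
  have \<theta>: "0 < \<theta>" "\<theta> \<le> 1" using r by (auto simp: \<theta>_def)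
  have pt: "X \<omega> powr r \<le> B powr \<theta> * (1 + \<theta> * (X \<omega> powr s / B - 1))" for \<omega>
  proof -
    have "X \<omega> powr r = (X \<omega> powr s) powr \<theta>" using r by (simp add: powr_powr \<theta>_def)
    also have "\<dots> = B powr \<theta> * (1 + (X \<omega> powr s / B - 1)) powr \<theta>"
      using B by (simp add: powr_divide)
    also have "\<dots> \<le> B powr \<theta> * (1 + \<theta> * (X \<omega> powr s / B - 1))"
      using \<theta> B nn[of \<omega>] by (intro mult_left_mono powr_le_Bernoulli) auto
    finally show ?thesis .
  qed
  have int': "integrable M (\<lambda>\<omega>. B powr \<theta> * (1 + \<theta> * (X \<omega> powr s / B - 1)))"
    using int by auto
  show i: "integrable M (\<lambda>\<omega>. X \<omega> powr r)"
    by (rule Bochner_Integration.integrable_bound[OF int'])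
       (use pt in \<open>auto intro!: AE_I2 order_trans[OF _ abs_ge_self]\<close>)
  have "expectation (\<lambda>\<omega>. X \<omega> powr r)
      \<le> expectation (\<lambda>\<omega>. B powr \<theta> * (1 + \<theta> * (X \<omega> powr s / B - 1)))"
    by (intro integral_mono i int' pt)
  also have "\<dots> = B powr \<theta> * (1 + \<theta> * (expectation (\<lambda>\<omega>. X \<omega> powr s) / B - 1))"
    using int by (simp add: prob_space)
  also have "\<dots> \<le> B powr \<theta> * 1"
    using B \<theta> by (intro mult_left_mono) (auto simp: divide_le_eq intro: mult_nonneg_nonpos)
  finally show "expectation (\<lambda>\<omega>. X \<omega> powr r) \<le> B powr (r / s)" by (simp add: \<theta>_def)
qed

lemma indep_vars_sum_complex:
  fixes X :: "'i \<Rightarrow> 'a \<Rightarrow> complex"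
  assumes I: "finite I" "i \<notin> I" and indep: "indep_vars (\<lambda>_. borel) X (insert i I)"
  shows "indep_var borel (X i) borel (\<lambda>\<omega>. \<Sum>i\<in>I. X i \<omega>)"
proof -
  have "indep_var
    borel ((\<lambda>f. f i) \<circ> (\<lambda>\<omega>. restrict (\<lambda>i. X i \<omega>) {i}))
    borel ((\<lambda>f. \<Sum>i\<in>I. f i) \<circ> (\<lambda>\<omega>. restrict (\<lambda>i. X i \<omega>) I))"
    using I by (intro indep_var_compose[OF indep_var_restrict[OF indep]] ) auto
  also have "((\<lambda>f. f i) \<circ> (\<lambda>\<omega>. restrict (\<lambda>i. X i \<omega>) {i})) = X i" by auto
  also have "((\<lambda>f. \<Sum>i\<in>I. f i) \<circ> (\<lambda>\<omega>. restrict (\<lambda>i. X i \<omega>) I)) = (\<lambda>\<omega>. \<Sum>i\<in>I. X i \<omega>)"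
    by (auto cong: rev_conj_cong)
  finally show ?thesis .
qed

lemma integrable_norm_powr_imp:
  fixes Y :: "'a \<Rightarrow> complex"
  assumes [measurable]: "Y \<in> borel_measurable M" and r: "1 \<le> r"
    and int: "integrable M (\<lambda>\<omega>. cmod (Y \<omega>) powr r)"
  shows "integrable M Y"
proof (rule Bochner_Integration.integrable_bound)
  show "integrable M (\<lambda>\<omega>. 1 + cmod (Y \<omega>) powr r)" using int by auto
  have "cmod (Y \<omega>) \<le> 1 + cmod (Y \<omega>) powr r" for \<omega>
  proof (cases "cmod (Y \<omega>) \<le> 1")
    case False
    then have "cmod (Y \<omega>) powr 1 \<le> cmod (Y \<omega>) powr r" using r by (intro powr_mono) auto
    then show ?thesis using False by simp
  qed (auto intro: order_trans)
  then show "AE \<omega> in M. cmod (Y \<omega>) \<le> norm (1 + cmod (Y \<omega>) powr r)"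
    by (intro AE_I2) (smt (verit) real_norm_def powr_ge_zero)
qed auto

text \<open>The cross term of \<open>norm_add_powr_le\<close> has mean zero, so the moments simply add up.\<close>

lemma von_Bahr_Esseen:
  fixes Y :: "'i \<Rightarrow> 'a \<Rightarrow> complex"
  assumes r: "1 < r" "r \<le> 2" and "finite I"
    and "indep_vars (\<lambda>_. borel) Y I"
    and "\<And>i. i \<in> I \<Longrightarrow> integrable M (\<lambda>\<omega>. cmod (Y i \<omega>) powr r)"
    and "\<And>i. i \<in> I \<Longrightarrow> expectation (Y i) = 0"
  shows "integrable M (\<lambda>\<omega>. cmod (\<Sum>i\<in>I. Y i \<omega>) powr r) \<and>
    expectation (\<lambda>\<omega>. cmod (\<Sum>i\<in>I. Y i \<omega>) powr r) \<le>
      6 * (\<Sum>i\<in>I. expectation (\<lambda>\<omega>. cmod (Y i \<omega>) powr r))"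
  using assms(3-)
proof (induction I rule: finite_induct)
  case (insert j I)
  define S where "S \<omega> = (\<Sum>i\<in>I. Y i \<omega>)" for \<omega>
  have indep: "indep_vars (\<lambda>_. borel) Y I"
    using insert.prems(1) by (rule indep_vars_subset) auto
  have IH: "integrable M (\<lambda>\<omega>. cmod (S \<omega>) powr r)"
    "expectation (\<lambda>\<omega>. cmod (S \<omega>) powr r) \<le>
      6 * (\<Sum>i\<in>I. expectation (\<lambda>\<omega>. cmod (Y i \<omega>) powr r))"
    using insert.IH[OF indep] insert.prems by (auto simp: S_def)
  have Ym[measurable]: "Y i \<in> borel_measurable M" if "i \<in> insert j I" for i
    using insert.prems(1) that unfolding indep_vars_def by auto
  have Yj[measurable]: "Y j \<in> borel_measurable M" by (rule Ym) simp
  have S[measurable]: "S \<in> borel_measurable M"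
    unfolding S_def by (intro borel_measurable_sum Ym) auto
  have ind: "indep_var borel (Y j) borel S"
    using indep_vars_sum_complex[OF insert.hyps(1,2) insert.prems(1)] unfolding S_def .
  \<comment> \<open>The cross term in the expansion around S is r * Re (Y j * T). As a function of
    S, T is independent of \<open>Y j\<close>, and its modulus |S|^(r - 1) is integrable by the
    induction hypothesis.\<close>
  define T where "T \<omega> = of_real (cmod (S \<omega>) powr (r - 2)) * cnj (S \<omega>)" for \<omega>
  have indT: "indep_var borel (Y j) borel T"
  proof -
    have "indep_var borel ((\<lambda>x. x) \<circ> Y j) borel
        ((\<lambda>s. of_real (cmod s powr (r - 2)) * cnj s) \<circ> S)"
      by (intro indep_var_compose[OF ind] borel_measurable_times
        borel_measurable_continuous_onI[of cnj]) (auto intro!: continuous_intros)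
    then show ?thesis by (simp add: T_def[abs_def] comp_def)
  qed
  have intY: "integrable M (Y j)"
    using insert.prems(2) r by (intro integrable_norm_powr_imp[of _ r]) auto
  have normT: "cmod (T \<omega>) = cmod (S \<omega>) powr (r - 1)" for \<omega>
    using powr_add[of "cmod (S \<omega>)" "r - 2" 1] by (simp add: T_def norm_mult)
  have "integrable M (\<lambda>\<omega>. cmod (S \<omega>) powr (r - 1))"
  proof (rule Bochner_Integration.integrable_bound)
    show "integrable M (\<lambda>\<omega>. 1 + cmod (S \<omega>) powr r)" using IH by auto
    have "cmod (S \<omega>) powr (r - 1) \<le> 1 + cmod (S \<omega>) powr r" for \<omega>
    proof (cases "cmod (S \<omega>) \<le> 1")
      case True
      then have "cmod (S \<omega>) powr (r - 1) \<le> 1" using r by (intro powr_le1) auto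
      then show ?thesis by (smt (verit) powr_ge_zero)
    next
      case False
      then have "cmod (S \<omega>) powr (r - 1) \<le> cmod (S \<omega>) powr r" by (intro powr_mono) auto
      then show ?thesis by simp
    qed
    then show "AE \<omega> in M. norm (cmod (S \<omega>) powr (r - 1)) \<le> norm (1 + cmod (S \<omega>) powr r)"
      by (intro AE_I2) (smt (verit) powr_ge_zero real_norm_def)
  qed auto
  then have intT: "integrable M T"
    using indep_var_rv2[OF indT] by (subst integrable_norm_iff[symmetric]) (auto simp: normT)
  have intYT: "integrable M (\<lambda>\<omega>. Y j \<omega> * T \<omega>)"
    using indep_var_integrable[OF indT intY intT] .
  have EYT: "expectation (\<lambda>\<omega>. Y j \<omega> * T \<omega>) = 0"
    using indep_var_lebesgue_integral[OF indT intY intT] insert.prems(3)[of j] by simp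
  define R where "R \<omega> = cmod (S \<omega>) powr r + r * Re (Y j \<omega> * T \<omega>) + 6 * cmod (Y j \<omega>) powr r" for \<omega>
  have pt: "cmod (S \<omega> + Y j \<omega>) powr r \<le> R \<omega>" for \<omega>
    using norm_add_powr_le[OF r, of "S \<omega>" "Y j \<omega>"] unfolding R_def T_def
    by (simp add: algebra_simps)
  have intR: "integrable M R"
    unfolding R_def using IH intYT insert.prems(2)[of j]
    by (intro Bochner_Integration.integrable_add integrable_mult_right integrable_Re) auto
  have i: "integrable M (\<lambda>\<omega>. cmod (S \<omega> + Y j \<omega>) powr r)"
    by (rule Bochner_Integration.integrable_bound[OF intR])
       (use pt in \<open>auto intro!: AE_I2 order_trans[OF _ abs_ge_self]\<close>)
  have "expectation (\<lambda>\<omega>. cmod (S \<omega> + Y j \<omega>) powr r) \<le> expectation R"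
    by (intro integral_mono i intR pt)
  also have "expectation R = expectation (\<lambda>\<omega>. cmod (S \<omega>) powr r)
      + r * Re (expectation (\<lambda>\<omega>. Y j \<omega> * T \<omega>)) + 6 * expectation (\<lambda>\<omega>. cmod (Y j \<omega>) powr r)"
    unfolding R_def using IH intYT insert.prems(2)[of j]
    by (simp add: integrable_Re del: times_complex.sel)
  finally have "expectation (\<lambda>\<omega>. cmod (S \<omega> + Y j \<omega>) powr r) \<le>
      6 * (\<Sum>i\<in>insert j I. expectation (\<lambda>\<omega>. cmod (Y i \<omega>) powr r))"
    using IH(2) EYT insert.hyps by simp
  then show ?case using i insert.hyps by (simp add: S_def add.commute)
qed (use r in auto)

text \<open>The left side is at most \<open>sqrt (exp 1)\<close> times the mean of \<open>exp (- X\<^sup>2 / (2 l\<^sup>2))\<close>, and the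
  Gaussian is its own Fourier transform.\<close>

lemma concentration_le_char:
  fixes X :: "'a \<Rightarrow> real"
  assumes [measurable]: "X \<in> borel_measurable M" and l: "l > 0"
    and b: "b \<in> borel_measurable borel" "\<And>t. b t \<le> 1" "\<And>t. b t \<ge> 0"
    and bnd: "\<And>t. cmod (expectation (\<lambda>\<omega>. cis (t / l * X \<omega>))) \<le> b t"
  shows "prob {\<omega>\<in>space M. \<bar>X \<omega>\<bar> \<le> l} \<le> exp (1/2) * (LINT t|std_normal_distribution. b t)"
proof -
  have intE: "integrable M (\<lambda>\<omega>. exp (- (X \<omega>)\<^sup>2 / (2 * l\<^sup>2)))"
    by (intro integrable_const_bound[of _ 1]) auto
  have intI: "integrable M (indicat_real {\<omega>\<in>space M. \<bar>X \<omega>\<bar> \<le> l})"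
    by (intro integrable_const_bound[of _ 1]) auto
  interpret N: prob_space std_normal_distribution
    by (rule prob_space_normal_density) simp
  interpret P: pair_prob_space M std_normal_distribution ..
  have int_le1: "integrable K f" if "prob_space K" "f \<in> borel_measurable K" "\<And>x. norm (f x) \<le> 1"
    for K :: "'z measure" and f :: "'z \<Rightarrow> complex"
    using that by (intro finite_measure.integrable_const_bound[of K _ 1])
      (auto simp: prob_space_def)
  have g: "(LINT t|std_normal_distribution. cis (t / l * x)) = of_real (exp (- x\<^sup>2 / (2 * l\<^sup>2)))" for x
  proof -
    have "(LINT t|std_normal_distribution. cis (t / l * x)) = char std_normal_distribution (x / l)"
      unfolding char_def by (intro Bochner_Integration.integral_cong) (auto simp: cis_conv_exp mult_ac)
    then show ?thesis by (simp add: char_std_normal_distribution power_divide)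
  qed
  have "of_real (expectation (\<lambda>\<omega>. exp (- (X \<omega>)\<^sup>2 / (2 * l\<^sup>2)))) =
      (LINT \<omega>|M. LINT t|std_normal_distribution. cis (t / l * X \<omega>))"
    by (simp only: g integral_complex_of_real)
  also have "\<dots> = (LINT t|std_normal_distribution. LINT \<omega>|M. cis (t / l * X \<omega>))"
    by (rule P.Fubini_integral[symmetric], rule int_le1) (unfold_locales, auto simp: cis_conv_exp)
  finally have "of_real (expectation (\<lambda>\<omega>. exp (- (X \<omega>)\<^sup>2 / (2 * l\<^sup>2)))) = \<dots>" .
  then have "\<bar>expectation (\<lambda>\<omega>. exp (- (X \<omega>)\<^sup>2 / (2 * l\<^sup>2)))\<bar> =
      cmod (LINT t|std_normal_distribution. LINT \<omega>|M. cis (t / l * X \<omega>))"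
    by (metis norm_of_real real_norm_def)
  also have "\<dots> \<le> (LINT t|std_normal_distribution. b t)"
  proof -
    have "cmod (expectation (\<lambda>\<omega>. cis (t / l * X \<omega>))) \<le> 1" for t
      using bnd[of t] b(2)[of t] by linarith
    then have "integrable std_normal_distribution (\<lambda>t. LINT \<omega>|M. cis (t / l * X \<omega>))"
      by (intro int_le1) (unfold_locales, auto simp: cis_conv_exp)
    moreover have "integrable std_normal_distribution b"
      using b by (intro N.integrable_const_bound[of _ 1]) auto
    ultimately show ?thesis
      by (intro order_trans[OF integral_norm_bound integral_mono] integrable_norm bnd)
  qed
  finally have main: "expectation (\<lambda>\<omega>. exp (- (X \<omega>)\<^sup>2 / (2 * l\<^sup>2)))
      \<le> (LINT t|std_normal_distribution. b t)" by simp
  have "prob {\<omega>\<in>space M. \<bar>X \<omega>\<bar> \<le> l} = expectation (indicator {\<omega>\<in>space M. \<bar>X \<omega>\<bar> \<le> l})" by simp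
  also have "\<dots> \<le> expectation (\<lambda>\<omega>. exp (1/2) * exp (- (X \<omega>)\<^sup>2 / (2 * l\<^sup>2)))"
  proof (rule integral_mono)
    fix \<omega>
    have "1 \<le> exp (1/2) * exp (- (X \<omega>)\<^sup>2 / (2 * l\<^sup>2))" if "\<bar>X \<omega>\<bar> \<le> l"
    proof -
      have "(X \<omega>)\<^sup>2 \<le> l\<^sup>2" using that l by (simp add: abs_le_square_iff[symmetric])
      then have "(X \<omega>)\<^sup>2 / (2 * l\<^sup>2) \<le> 1 / 2" using l by (simp add: field_simps)
      then show ?thesis by (simp add: mult_exp_exp)
    qed
    then show "indicator {\<omega>\<in>space M. \<bar>X \<omega>\<bar> \<le> l} \<omega> \<le> exp (1/2) * exp (- (X \<omega>)\<^sup>2 / (2 * l\<^sup>2))"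
      by (auto simp: indicator_def)
  qed (use intE intI in auto)
  also have "\<dots> = exp (1/2) * expectation (\<lambda>\<omega>. exp (- (X \<omega>)\<^sup>2 / (2 * l\<^sup>2)))" by simp
  finally show ?thesis using main by (meson exp_ge_zero mult_left_mono order_trans)
qed

end

section \<open>Exponentials of a standard normal variable\<close>

text \<open>Translation by Re b completes the square for the real part and leaves the characteristic
  function at Im b, so no contour has to be shifted.\<close>

lemma integral_std_normal_exp:
  fixes b :: complex
  shows "integrable std_normal_distribution (\<lambda>x. exp (b * of_real x))"
    and "(LINT x|std_normal_distribution. exp (b * of_real x)) = exp (b\<^sup>2 / 2)"
proof -
  define s t where "s = Re b" and "t = Im b"
  have b: "b = of_real s + \<i> * of_real t" by (simp add: s_def t_def complex_eq)
  have sh: "std_normal_density (s + x) *\<^sub>R exp (b * of_real (s + x)) =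
      exp ((of_real s)\<^sup>2 / 2 + \<i> * of_real (s * t)) * (std_normal_density x *\<^sub>R exp (\<i> * of_real (t * x)))" for x
  proof -
    have "of_real (std_normal_density (s + x)) * exp (b * of_real (s + x)) =
        of_real (1 / sqrt (2 * pi)) * (exp (of_real (- (s + x)\<^sup>2 / 2)) * exp (b * of_real (s + x)))"
      by (simp add: std_normal_density_def flip: exp_of_real)
    also have "exp (of_real (- (s + x)\<^sup>2 / 2)) * exp (b * of_real (s + x)) =
        exp ((of_real s)\<^sup>2 / 2 + \<i> * of_real (s * t)) * exp (of_real (- x\<^sup>2 / 2)) * exp (\<i> * of_real (t * x))"
      unfolding mult_exp_exp b
      by (rule arg_cong[where f = exp]) (simp add: power2_eq_square field_simps)
    also have "of_real (1 / sqrt (2 * pi)) * \<dots> = exp ((of_real s)\<^sup>2 / 2 + \<i> * of_real (s * t)) *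
        (of_real (std_normal_density x) * exp (\<i> * of_real (t * x)))"
      by (simp add: std_normal_density_def flip: exp_of_real)
    finally show ?thesis by (simp add: scaleR_conv_of_real)
  qed
  have i1: "integrable std_normal_distribution (\<lambda>x. exp (\<i> * of_real (t * x)))"
  proof -
    interpret N: prob_space std_normal_distribution by (rule prob_space_normal_density) simp
    show ?thesis by (rule N.integrable_const_bound[of _ 1]) auto
  qed
  then have i2: "integrable lborel (\<lambda>x. std_normal_density x *\<^sub>R exp (\<i> * of_real (t * x)))"
    by (subst (asm) integrable_density) auto
  have "integrable lborel (\<lambda>x. std_normal_density (s + x) *\<^sub>R exp (b * of_real (s + x)))"
    unfolding sh using i2 by (intro integrable_mult_right)
  then have "integrable lborel (\<lambda>x. std_normal_density x *\<^sub>R exp (b * of_real x))"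
    using lborel_integrable_real_affine_iff[of 1 "\<lambda>x. std_normal_density x *\<^sub>R exp (b * of_real x)" s]
    by (simp del: of_real_add)
  then show "integrable std_normal_distribution (\<lambda>x. exp (b * of_real x))"
    by (subst integrable_density) auto
  have "(LINT x|std_normal_distribution. exp (b * of_real x)) =
      (LINT x|lborel. std_normal_density x *\<^sub>R exp (b * of_real x))"
    by (subst integral_density) auto
  also have "\<dots> = (LINT x|lborel. std_normal_density (s + x) *\<^sub>R exp (b * of_real (s + x)))"
    using lborel_integral_real_affine[of 1 "\<lambda>x. std_normal_density x *\<^sub>R exp (b * of_real x)" s] by simp
  also have "\<dots> = exp ((of_real s)\<^sup>2 / 2 + \<i> * of_real (s * t)) *
      (LINT x|lborel. std_normal_density x *\<^sub>R exp (\<i> * of_real (t * x)))"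
    unfolding sh by (rule Bochner_Integration.integral_mult_right) (rule i2)
  also have "(LINT x|lborel. std_normal_density x *\<^sub>R exp (\<i> * of_real (t * x))) = char std_normal_distribution t"
    unfolding char_def by (subst integral_density) auto
  also have "\<dots> = exp (of_real (- t\<^sup>2 / 2))" by (simp add: char_std_normal_distribution flip: exp_of_real)
  also have "exp ((of_real s)\<^sup>2 / 2 + \<i> * of_real (s * t)) * exp (of_real (- t\<^sup>2 / 2)) = exp (b\<^sup>2 / 2)"
    unfolding mult_exp_exp b
    by (rule arg_cong[where f = exp]) (simp add: power2_eq_square field_simps)
  finally show "(LINT x|std_normal_distribution. exp (b * of_real x)) = exp (b\<^sup>2 / 2)" .
qed

lemma integral_std_normal_exp_real:
  fixes b :: real
  shows "integrable std_normal_distribution (\<lambda>x. exp (b * x))"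
    and "(LINT x|std_normal_distribution. exp (b * x)) = exp (b\<^sup>2 / 2)"
proof -
  have eq: "exp (of_real b * of_real x) = complex_of_real (exp (b * x))" for x
    by (simp flip: exp_of_real)
  note C = integral_std_normal_exp[of "of_real b", unfolded eq]
  show "integrable std_normal_distribution (\<lambda>x. exp (b * x))"
    using C(1) by (simp only: complex_of_real_integrable_eq)
  have "complex_of_real (LINT x|std_normal_distribution. exp (b * x)) = of_real (exp (b\<^sup>2 / 2))"
    using C(2) unfolding integral_complex_of_real by (simp add: exp_of_real[symmetric])
  then show "(LINT x|std_normal_distribution. exp (b * x)) = exp (b\<^sup>2 / 2)"
    by (simp only: of_real_eq_iff)
qed

section \<open>Quantitative bounds for the sine and for sums of two points of the unit
  circle\<close>

lemma abs_sin_diff_le: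
  fixes x :: real
  shows "\<bar>sin x - x\<bar> \<le> \<bar>x\<bar> ^ 3 / 6"
proof -
  have "\<bar>sin x - (\<Sum>m<3. sin_coeff m * x ^ m)\<bar> \<le> inverse (fact 3) * \<bar>x\<bar> ^ 3"
    by (rule Maclaurin_sin_bound)
  then show ?thesis by (simp add: sin_coeff_def eval_nat_numeral field_simps)
qed

lemma abs_sin_ge_half:
  fixes x :: real
  assumes "\<bar>x\<bar> \<le> 1"
  shows "\<bar>x\<bar> / 2 \<le> \<bar>sin x\<bar>"
proof -
  have "\<bar>x\<bar> ^ 3 \<le> \<bar>x\<bar> ^ 1" using assms by (intro power_decreasing) auto
  then show ?thesis using abs_sin_diff_le[of x] by (simp add: abs_if split: if_splits)
qed

lemma abs_sin_ge_third:
  fixes x :: real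
  assumes "\<bar>x\<bar> \<le> 2"
  shows "\<bar>x\<bar> / 3 \<le> \<bar>sin x\<bar>"
proof -
  have "\<bar>x\<bar> ^ 3 = \<bar>x\<bar> * \<bar>x\<bar>\<^sup>2" by (simp add: power3_eq_cube power2_eq_square)
  also have "\<dots> \<le> \<bar>x\<bar> * 2\<^sup>2" using assms by (intro mult_left_mono power_mono) auto
  finally show ?thesis using abs_sin_diff_le[of x] by (simp add: abs_if split: if_splits)
qed

text \<open>With v half the difference, the modulus is 2 * |cos v| \<le> 1 + (cos v)^2 = 2 - (sin
  v)^2, and |sin v| \<ge> |v| / 2.\<close>

lemma norm_cis_add_le:
  assumes "\<bar>y - z\<bar> \<le> 2"
  shows "cmod (cis y + cis z) \<le> 2 - (y - z)\<^sup>2 / 16"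
proof -
  define v where "v = (y - z) / 2"
  have v: "\<bar>v\<bar> \<le> 1" using assms by (simp add: v_def)
  have "cis y + cis z = cis ((y + z) / 2) * (2 * of_real (cos v))"
  proof -
    have "cis y = cis ((y + z) / 2) * cis v" "cis z = cis ((y + z) / 2) * cis (- v)"
      by (simp_all add: cis_mult v_def field_simps)
    moreover have "cis v + cis (- v) = 2 * of_real (cos v)" by (simp add: complex_eq_iff)
    ultimately show ?thesis by (simp flip: distrib_left)
  qed
  then have eq: "cmod (cis y + cis z) = 2 * \<bar>cos v\<bar>" by (simp add: norm_mult)
  have "(\<bar>v\<bar> / 2)\<^sup>2 \<le> \<bar>sin v\<bar>\<^sup>2" using abs_sin_ge_half[OF v] by (intro power_mono) auto
  then have s: "v\<^sup>2 / 4 \<le> (sin v)\<^sup>2" by (simp add: power_divide)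
  have "2 * \<bar>cos v\<bar> \<le> 1 + \<bar>cos v\<bar>\<^sup>2" using sum_squares_bound[of 1 "\<bar>cos v\<bar>"] by simp
  also have "\<dots> = 2 - (sin v)\<^sup>2" using cos_squared_eq[of v] by simp
  finally show ?thesis using s unfolding eq v_def by (simp add: power_divide)
qed

section \<open>Half a turn of the phase and the decay of a characteristic function\<close>

text \<open>A shift after which \<open>exp (\<beta> * x)\<close> is multiplied by a real number;
  real parts are then multiplied by the same number, whatever the complex prefactor. For non-real
  \<beta> it is half a period of the phase; for real \<beta> every shift has this property, and 1 is
  a mere choice.\<close>

definition half_turn :: "complex \<Rightarrow> real" where
  "half_turn \<beta> = (if Im \<beta> = 0 then 1 else pi / \<bar>Im \<beta>\<bar>)"

definition half_turn_factor :: "complex \<Rightarrow> real" where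
  "half_turn_factor \<beta> = (if Im \<beta> = 0 then exp (Re \<beta>) else - exp (Re \<beta> * half_turn \<beta>))"

lemma half_turn_pos: "half_turn \<beta> > 0"
  by (simp add: half_turn_def)

lemma exp_half_turn: "exp (\<beta> * of_real (half_turn \<beta>)) = of_real (half_turn_factor \<beta>)"
proof (cases "Im \<beta> = 0")
  case True
  then have "\<beta> = of_real (Re \<beta>)" by (simp add: complex_eq_iff)
  then show ?thesis using True
    by (metis exp_of_real half_turn_def half_turn_factor_def mult.right_neutral of_real_1)
next
  case False
  then have "Im \<beta> * half_turn \<beta> = pi \<or> Im \<beta> * half_turn \<beta> = - pi"
    by (auto simp: half_turn_def abs_if)
  then show ?thesis using False
    by (auto simp: exp_eq_polar half_turn_factor_def complex_eq_iff exp_of_real)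
qed

lemma half_turn_factor_neq_1:
  assumes "Im \<beta> \<noteq> 0 \<or> Re \<beta> \<noteq> 0"
  shows "half_turn_factor \<beta> \<noteq> 1"
proof -
  have "- exp (Re \<beta> * half_turn \<beta>) < 1" using exp_gt_zero[of "Re \<beta> * half_turn \<beta>"] by linarith
  then show ?thesis using assms by (auto simp: half_turn_factor_def simp del: exp_gt_zero)
qed

text \<open>The interval of length h is exactly one period of the squared phase, so the squared real
  part averages to half of the squared modulus, and by \<open>Re \<beta> \<ge> 0\<close> the modulus
  is smallest at the left end. For real \<beta> the phase does not rotate, and reality of u takes
  over.\<close>

lemma integral_half_turn_ge:
  fixes u :: complex
  assumes c: "c > 0" and \<beta>: "Re \<beta> \<ge> 0" "Im \<beta> \<noteq> 0 \<or> Im u = 0"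
    and h: "h = half_turn \<beta> / c"
  shows "(LINT x|lborel. indicator {x0..x0+h} x *\<^sub>R (Re (u * exp (\<beta> * of_real (c * x))))\<^sup>2)
     \<ge> (cmod u)\<^sup>2 * exp (2 * Re \<beta> * c * x0) * h / 2"
proof -
  have h0: "h > 0" using h c half_turn_pos[of \<beta>] by simp
  define E where "E = exp (2 * Re \<beta> * c * x0)"
  define q where "q x = E * (Re (u * cis (Im \<beta> * c * x)))\<^sup>2" for x
  have ge: "q x \<le> (Re (u * exp (\<beta> * of_real (c * x))))\<^sup>2" if "x \<in> {x0..x0+h}" for x
  proof -
    have "exp (\<beta> * of_real (c * x)) = of_real (exp (Re \<beta> * c * x)) * cis (Im \<beta> * c * x)"
      by (simp add: exp_eq_polar mult.assoc exp_of_real)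
    then have "(Re (u * exp (\<beta> * of_real (c * x))))\<^sup>2 =
        (exp (Re \<beta> * c * x))\<^sup>2 * (Re (u * cis (Im \<beta> * c * x)))\<^sup>2"
      by (simp add: power2_eq_square algebra_simps)
    moreover have "E \<le> (exp (Re \<beta> * c * x))\<^sup>2"
    proof -
      have "Re \<beta> * c * x0 \<le> Re \<beta> * c * x" using that \<beta> c by (intro mult_left_mono) auto
      then show ?thesis by (simp add: E_def flip: exp_double)
    qed
    ultimately show ?thesis unfolding q_def by (simp add: mult_right_mono)
  qed
  have I: "(LINT x|lborel. indicator {x0..x0+h} x *\<^sub>R q x) \<ge> (cmod u)\<^sup>2 * E * h / 2"
  proof (cases "Im \<beta> = 0")
    case True
    then have "Im u = 0" using \<beta> by simp
    then have "q x = E * (cmod u)\<^sup>2" for x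
      using True by (simp add: q_def cmod_power2)
    then have "(LINT x|lborel. indicator {x0..x0+h} x *\<^sub>R q x) = h * (E * (cmod u)\<^sup>2)"
      using h0 by simp
    moreover have "0 \<le> h * (E * (cmod u)\<^sup>2)" using h0 by (simp add: E_def)
    ultimately show ?thesis by (simp add: algebra_simps)
  next
    case False
    define k where "k = 2 * Im \<beta> * c"
    have k: "k \<noteq> 0" using False c by (simp add: k_def)
    \<comment> \<open>A primitive of q, read off from the double-angle form \<open>qc\<close> that
      follows.\<close>
    define F where "F x = E / 2 * ((cmod u)\<^sup>2 * x + (Re (u\<^sup>2) * sin (k * x) + Im (u\<^sup>2) * cos (k * x)) / k)" for x
    have qc: "q x = E / 2 * ((cmod u)\<^sup>2 + (Re (u\<^sup>2) * cos (k * x) - Im (u\<^sup>2) * sin (k * x)))" for x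
    proof -
      define v where "v = Im \<beta> * c * x"
      have kv: "k * x = 2 * v" by (simp add: k_def v_def)
      show ?thesis
      proof -
        have alg: "(p * C - q * S)\<^sup>2 = (p\<^sup>2 + q\<^sup>2) * (C\<^sup>2 + S\<^sup>2) / 2 +
            ((p\<^sup>2 - q\<^sup>2) * (C\<^sup>2 - S\<^sup>2) - 2 * p * q * (2 * S * C)) / 2" for p q C S :: real
          by (simp add: power2_eq_square field_simps)
        have "(Re (u * cis v))\<^sup>2 = (Re u * cos v - Im u * sin v)\<^sup>2" by simp
        also have "\<dots> = ((Re u)\<^sup>2 + (Im u)\<^sup>2) * ((cos v)\<^sup>2 + (sin v)\<^sup>2) / 2 +
            (((Re u)\<^sup>2 - (Im u)\<^sup>2) * ((cos v)\<^sup>2 - (sin v)\<^sup>2) - 2 * Re u * Im u * (2 * sin v * cos v)) / 2"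
          by (rule alg)
        also have "(cos v)\<^sup>2 + (sin v)\<^sup>2 = 1" by simp
        finally have eq: "(Re (u * cis v))\<^sup>2 = ((Re u)\<^sup>2 + (Im u)\<^sup>2) / 2 +
            (((Re u)\<^sup>2 - (Im u)\<^sup>2) * ((cos v)\<^sup>2 - (sin v)\<^sup>2) - 2 * Re u * Im u * (2 * sin v * cos v)) / 2"
          by simp
        show ?thesis
          unfolding q_def kv cos_double sin_double v_def[symmetric] cmod_power2 Re_power2 Im_power2 eq
          by (simp add: field_simps)
      qed
    qed
    have "has_bochner_integral lborel (\<lambda>x. q x * indicator {x0..x0+h} x) (F (x0 + h) - F x0)"
    proof (rule has_bochner_integral_FTC_Icc_real)
      show "DERIV F x :> q x" for x
        unfolding F_def qc using k by (auto intro!: derivative_eq_intros simp: field_simps)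
      show "isCont q x" for x unfolding qc by (intro continuous_intros)
    qed (use h0 in auto)
    then have "(LINT x|lborel. indicator {x0..x0+h} x *\<^sub>R q x) = F (x0 + h) - F x0"
      by (subst has_bochner_integral_integral_eq[symmetric]) (simp_all add: mult.commute)
    also have "\<dots> = (cmod u)\<^sup>2 * E * h / 2"
    proof -
      \<comment> \<open>Over the interval k * x changes by a full turn, in the direction given by
        the sign of Im \<beta>, so the trigonometric part of F contributes nothing.\<close>
      have "k * (x0 + h) = k * x0 + 2 * pi \<or> k * (x0 + h) = k * x0 - 2 * pi"
        using False c by (auto simp: k_def h half_turn_def abs_if field_simps)
      then have "sin (k * (x0 + h)) = sin (k * x0)" "cos (k * (x0 + h)) = cos (k * x0)"
        by (auto simp: sin_diff cos_diff)
      then show ?thesis by (simp add: F_def algebra_simps)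
    qed
    finally show ?thesis by simp
  qed
  also have "(LINT x|lborel. indicator {x0..x0+h} x *\<^sub>R q x) \<le>
      (LINT x|lborel. indicator {x0..x0+h} x *\<^sub>R (Re (u * exp (\<beta> * of_real (c * x))))\<^sup>2)"
    unfolding q_def
  proof (intro integral_mono borel_integrable_compact)
    show "indicator {x0..x0+h} x *\<^sub>R (E * (Re (u * cis (Im \<beta> * c * x)))\<^sup>2)
        \<le> indicator {x0..x0+h} x *\<^sub>R (Re (u * exp (\<beta> * of_real (c * x))))\<^sup>2" for x
      using ge[of x] by (auto simp: indicator_def q_def)
  qed (auto intro!: continuous_intros)
  finally show ?thesis by (simp add: E_def)
qed

text \<open>With \<rho> = \<open>half_turn_factor \<beta>\<close>: if the modulus at the left end
  stays below this radius, the real part V is at most 1 / (1 + |\<rho>|) on the whole interval. Then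
  V and \<rho> * V differ by at most 1, and \<open>norm_cis_add_le\<close> applies.\<close>

definition char_radius :: "complex \<Rightarrow> real" where
  "char_radius \<beta> = 1 / ((1 + \<bar>half_turn_factor \<beta>\<bar>) * exp (Re \<beta> * half_turn \<beta>))"

text \<open>The denominator is 2 * 16 * 2: a 2 from the average of the squared cosine, 16 from
  \<open>norm_cis_add_le\<close>, and a 2 from the halved minorant of the density.\<close>

definition char_decay :: "complex \<Rightarrow> real" where
  "char_decay \<beta> = (1 - half_turn_factor \<beta>)\<^sup>2 / 64"

lemma char_radius_pos: "char_radius \<beta> > 0"
  unfolding char_radius_def by (intro divide_pos_pos mult_pos_pos) auto

text \<open>The phase \<open>V x\<close> satisfies \<open>V (x + h) = \<rho> * V x\<close> with \<open>\<rho> \<noteq> 1\<close> real, so the contributions of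
  \<open>x\<close> and \<open>x + h\<close> cancel partially.\<close>

lemma norm_char_exp_normal_le:
  fixes u \<beta> :: complex
  assumes c: "c > 0" and \<beta>: "Re \<beta> \<ge> 0" "Im \<beta> \<noteq> 0 \<or> Im u = 0" and x0: "x0 \<ge> 0"
    and h: "h = half_turn \<beta> / c"
    and u: "cmod u * exp (Re \<beta> * c * x0) \<le> char_radius \<beta>"
  shows "cmod (LINT x|std_normal_distribution. cis (Re (u * exp (\<beta> * of_real (c * x)))))
    \<le> 1 - std_normal_density (x0 + 2 * h) * h * char_decay \<beta> * (cmod u)\<^sup>2 * exp (2 * Re \<beta> * c * x0)"
proof -
  have h0: "h > 0" using h c half_turn_pos[of \<beta>] by simp
  define \<rho> where "\<rho> = half_turn_factor \<beta>"
  define V where "V x = Re (u * exp (\<beta> * of_real (c * x)))" for x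
  \<comment> \<open>The minimum of the density over [x0, x0 + 2 * h], the union of B and its
    translate by h. As w equals 2 at their common endpoint, m / 2 * w is what can be split off while
    the remainder stays nonnegative.\<close>
  define m where "m = std_normal_density (x0 + 2 * h)"
  define B where "B = {x0..x0+h}"
  define w :: "real \<Rightarrow> real" where "w x = indicator B x + indicator B (x - h)" for x
  have m0: "m > 0" by (simp add: m_def normal_density_pos)
  have Vh: "V (x + h) = \<rho> * V x" for x
  proof -
    have "\<beta> * of_real (c * (x + h)) = \<beta> * of_real (c * x) + \<beta> * of_real (half_turn \<beta>)"
      using c by (simp add: h algebra_simps)
    then have "exp (\<beta> * of_real (c * (x + h))) = of_real \<rho> * exp (\<beta> * of_real (c * x))"
      by (simp add: exp_add exp_half_turn \<rho>_def)
    then show ?thesis by (simp add: V_def algebra_simps)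
  qed
  have contV: "continuous_on S V" for S unfolding V_def by (intro continuous_intros)
  have Vm[measurable]: "V \<in> borel_measurable borel"
    by (intro borel_measurable_continuous_onI contV)
  have contC: "continuous_on S (\<lambda>x. cis (V x))" for S
    unfolding cis_conv_exp using contV by (intro continuous_intros)
  have contCh: "continuous_on S (\<lambda>x. cis (V (x + h)))" for S
    unfolding Vh cis_conv_exp using contV by (intro continuous_intros)
  have iB: "integrable lborel (\<lambda>x. indicator B x *\<^sub>R g x)" if "continuous_on B g"
    for g :: "real \<Rightarrow> 'z::{banach, second_countable_topology}"
    using that by (intro borel_integrable_compact) (auto simp: B_def)
  have sh: "(LINT x|lborel. indicator B (x - h) *\<^sub>R g x) = (LINT x|lborel. indicator B x *\<^sub>R g (x + h))"
    for g :: "real \<Rightarrow> 'z::{banach, second_countable_topology}"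
    using lborel_integral_real_affine[of 1 "\<lambda>x. indicator B (x - h) *\<^sub>R g x" h] by (simp add: add.commute)
  have ish: "integrable lborel (\<lambda>x. indicator B (x - h) *\<^sub>R g x)"
    if "continuous_on B (\<lambda>x. g (x + h))" for g :: "real \<Rightarrow> 'z::{banach, second_countable_topology}"
    using lborel_integrable_real_affine_iff[of 1 "\<lambda>x. indicator B (x - h) *\<^sub>R g x" h] iB[OF that]
    by (simp add: add.commute)
  have w: "0 \<le> w x" "m / 2 * w x \<le> std_normal_density x" for x
  proof -
    show "0 \<le> w x" by (simp add: w_def)
    show "m / 2 * w x \<le> std_normal_density x"
    proof (cases "x \<in> {x0..x0 + 2 * h}")
      case True
      have "x\<^sup>2 \<le> (x0 + 2 * h)\<^sup>2" using True x0 by (intro power_mono) auto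
      then have "m \<le> std_normal_density x"
        unfolding m_def std_normal_density_def by (intro mult_left_mono) auto
      moreover have "w x \<le> 2" by (auto simp: w_def indicator_def)
      then have "m / 2 * w x \<le> m / 2 * 2" using m0 by (intro mult_left_mono) auto
      ultimately show ?thesis by simp
    next
      case False
      then have "w x = 0" using h0 by (auto simp: w_def B_def indicator_def)
      then show ?thesis by simp
    qed
  qed
  have iw: "integrable lborel w" and Iw: "(LINT x|lborel. w x) = 2 * h"
  proof -
    have 1: "integrable lborel (\<lambda>x. indicator B x *\<^sub>R (1::real))"
      and 2: "integrable lborel (\<lambda>x. indicator B (x - h) *\<^sub>R (1::real))"
      by (intro iB ish continuous_intros)+
    then show "integrable lborel w" unfolding w_def by simp
    have "(LINT x|lborel. w x) = (LINT x|lborel. indicator B x *\<^sub>R (1::real)) + (LINT x|lborel. indicator B x *\<^sub>R (1::real))"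
      using 1 2 sh[of "\<lambda>_. 1::real"] unfolding w_def by simp
    then show "(LINT x|lborel. w x) = 2 * h" using h0 by (simp add: B_def)
  qed
  have iphi: "integrable lborel std_normal_density"
    and Iphi: "(LINT x|lborel. std_normal_density x) = 1"
    using integral_normal_density[of 1 0] by auto
  have i1: "integrable lborel (\<lambda>x. (std_normal_density x - m / 2 * w x) *\<^sub>R cis (V x))"
  proof (rule Bochner_Integration.integrable_bound)
    show "integrable lborel (\<lambda>x. std_normal_density x - m / 2 * w x)"
      using iw iphi by auto
    show "(\<lambda>x. (std_normal_density x - m / 2 * w x) *\<^sub>R cis (V x)) \<in> borel_measurable lborel"
      unfolding w_def B_def cis_conv_exp by measurable
  qed auto
  have i2: "integrable lborel (\<lambda>x. indicator B x *\<^sub>R cis (V x))" by (intro iB contC)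
  have i3: "integrable lborel (\<lambda>x. indicator B (x - h) *\<^sub>R cis (V x))" by (intro ish contCh)
  have i4: "integrable lborel (\<lambda>x. indicator B x *\<^sub>R cis (V (x + h)))" by (intro iB contCh)
  have "(LINT x|std_normal_distribution. cis (V x)) = (LINT x|lborel. std_normal_density x *\<^sub>R cis (V x))"
    by (subst integral_density) (auto simp: cis_conv_exp)
  also have "\<dots> = (LINT x|lborel. (std_normal_density x - m / 2 * w x) *\<^sub>R cis (V x)
      + (m / 2) *\<^sub>R (indicator B x *\<^sub>R cis (V x) + indicator B (x - h) *\<^sub>R cis (V x)))"
    by (intro Bochner_Integration.integral_cong) (auto simp: w_def algebra_simps)
  also have "\<dots> = (LINT x|lborel. (std_normal_density x - m / 2 * w x) *\<^sub>R cis (V x))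
      + (m / 2) *\<^sub>R ((LINT x|lborel. indicator B x *\<^sub>R cis (V x)) + (LINT x|lborel. indicator B (x - h) *\<^sub>R cis (V x)))"
    using i1 i2 i3 by simp
  also have "(LINT x|lborel. indicator B x *\<^sub>R cis (V x)) + (LINT x|lborel. indicator B (x - h) *\<^sub>R cis (V x)) =
      (LINT x|lborel. indicator B x *\<^sub>R (cis (V x) + cis (\<rho> * V x)))"
    unfolding sh using i2 i4 by (simp add: Vh algebra_simps)
  finally have "cmod (LINT x|std_normal_distribution. cis (V x)) \<le>
      cmod (LINT x|lborel. (std_normal_density x - m / 2 * w x) *\<^sub>R cis (V x)) +
      m / 2 * cmod (LINT x|lborel. indicator B x *\<^sub>R (cis (V x) + cis (\<rho> * V x)))"
    using m0 by (simp add: norm_triangle_le)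
  also have "cmod (LINT x|lborel. (std_normal_density x - m / 2 * w x) *\<^sub>R cis (V x)) \<le>
      (LINT x|lborel. std_normal_density x - m / 2 * w x)"
  proof (rule order_trans[OF integral_norm_bound])
    have "norm ((std_normal_density x - m / 2 * w x) *\<^sub>R cis (V x)) = std_normal_density x - m / 2 * w x" for x
      using w(2)[of x] by simp
    then show "(LINT x|lborel. norm ((std_normal_density x - m / 2 * w x) *\<^sub>R cis (V x))) \<le>
      (LINT x|lborel. std_normal_density x - m / 2 * w x)" by simp
  qed
  also have "(LINT x|lborel. std_normal_density x - m / 2 * w x) = 1 - m * h"
    using iw iphi Iw Iphi by simp
  also have "cmod (LINT x|lborel. indicator B x *\<^sub>R (cis (V x) + cis (\<rho> * V x))) \<le>
      (LINT x|lborel. indicator B x *\<^sub>R (2 - (1 - \<rho>)\<^sup>2 / 16 * (V x)\<^sup>2))"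
  proof (rule order_trans[OF integral_norm_bound], rule integral_mono)
    show "integrable lborel (\<lambda>x. norm (indicator B x *\<^sub>R (cis (V x) + cis (\<rho> * V x))))"
      using i2 i4 by (intro integrable_norm) (simp add: Vh scaleR_add_right)
    show "integrable lborel (\<lambda>x. indicator B x *\<^sub>R (2 - (1 - \<rho>)\<^sup>2 / 16 * (V x)\<^sup>2))"
      by (intro iB continuous_intros contV)
    fix x
    show "norm (indicator B x *\<^sub>R (cis (V x) + cis (\<rho> * V x))) \<le>
        indicator B x *\<^sub>R (2 - (1 - \<rho>)\<^sup>2 / 16 * (V x)\<^sup>2)"
    proof (cases "x \<in> B")
      case True
      have "\<bar>V x\<bar> \<le> cmod u * exp (Re \<beta> * c * x)"
        unfolding V_def using abs_Re_le_cmod[of "u * exp (\<beta> * of_real (c * x))"]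
        by (simp add: norm_mult mult.assoc)
      also have "\<dots> \<le> cmod u * exp (Re \<beta> * c * x0 + Re \<beta> * half_turn \<beta>)"
      proof -
        have "Re \<beta> * c * x \<le> Re \<beta> * c * (x0 + h)"
          using True \<beta> c by (intro mult_left_mono) (auto simp: B_def)
        also have "\<dots> = Re \<beta> * c * x0 + Re \<beta> * half_turn \<beta>" using c by (simp add: h field_simps)
        finally show ?thesis by (intro mult_left_mono) auto
      qed
      also have "\<dots> = (cmod u * exp (Re \<beta> * c * x0)) * exp (Re \<beta> * half_turn \<beta>)"
        by (simp add: exp_add)
      also have "\<dots> \<le> char_radius \<beta> * exp (Re \<beta> * half_turn \<beta>)"
        using u by (intro mult_right_mono) auto
      also have "\<dots> = 1 / (1 + \<bar>\<rho>\<bar>)" by (simp add: char_radius_def \<rho>_def)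
      finally have V1: "\<bar>V x\<bar> * (1 + \<bar>\<rho>\<bar>) \<le> 1" by (simp add: field_simps)
      have "\<bar>V x - \<rho> * V x\<bar> = \<bar>V x\<bar> * \<bar>1 - \<rho>\<bar>" by (simp add: algebra_simps flip: abs_mult)
      also have "\<dots> \<le> \<bar>V x\<bar> * (1 + \<bar>\<rho>\<bar>)" by (intro mult_left_mono) auto
      finally have "cmod (cis (V x) + cis (\<rho> * V x)) \<le> 2 - (V x - \<rho> * V x)\<^sup>2 / 16"
        using V1 by (intro norm_cis_add_le) linarith
      also have "V x - \<rho> * V x = (1 - \<rho>) * V x" by (simp add: algebra_simps)
      finally show ?thesis using True by (simp add: power_mult_distrib)
    qed simp
  qed
  also have "\<dots> = (LINT x|lborel. indicator B x *\<^sub>R 2 - (1 - \<rho>)\<^sup>2 / 16 * (indicator B x *\<^sub>R (V x)\<^sup>2))"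
    by (intro Bochner_Integration.integral_cong) (auto simp: algebra_simps)
  also have "\<dots> = 2 * h - (1 - \<rho>)\<^sup>2 / 16 * (LINT x|lborel. indicator B x *\<^sub>R (V x)\<^sup>2)"
  proof (subst Bochner_Integration.integral_diff)
    show "integrable lborel (\<lambda>x. (1 - \<rho>)\<^sup>2 / 16 * (indicator B x *\<^sub>R (V x)\<^sup>2))"
      by (intro integrable_mult_right iB continuous_intros contV)
    show "integrable lborel (\<lambda>x. indicator B x *\<^sub>R (2::real))" by (intro iB continuous_intros)
  qed (use h0 in \<open>simp add: B_def\<close>)
  also have "\<dots> \<le> 2 * h - (1 - \<rho>)\<^sup>2 / 16 * ((cmod u)\<^sup>2 * exp (2 * Re \<beta> * c * x0) * h / 2)"
    using integral_half_turn_ge[OF c \<beta> h, of x0] unfolding V_def B_def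
    by (intro diff_left_mono mult_left_mono) auto
  finally have "cmod (LINT x|std_normal_distribution. cis (V x)) \<le> 1 - m * h +
      m / 2 * (2 * h - (1 - \<rho>)\<^sup>2 / 16 * ((cmod u)\<^sup>2 * exp (2 * Re \<beta> * c * x0) * h / 2))"
    using m0 by (simp add: mult_left_mono)
  also have "\<dots> = 1 - m * h * char_decay \<beta> * (cmod u)\<^sup>2 * exp (2 * Re \<beta> * c * x0)"
    by (simp add: char_decay_def \<rho>_def field_simps)
  finally show ?thesis by (simp only: V_def m_def)
qed

section \<open>A normal exponential times an independent factor\<close>

context prob_space
begin

lemma distributed_std_normalD:
  assumes "distributed M lborel X std_normal_density"
  shows "X \<in> borel_measurable M" and "distr M borel X = std_normal_distribution"
proof -
  show X: "X \<in> borel_measurable M"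
    using distributed_measurable[OF assms] by simp
  have "distr M borel X = distr M lborel X" by (rule distr_cong) auto
  then show "distr M borel X = std_normal_distribution"
    using distributed_distr_eq_density[OF assms] by simp
qed

lemma distributed_std_normal_integral:
  fixes g :: "real \<Rightarrow> 'z::{banach, second_countable_topology}"
  assumes X: "distributed M lborel X std_normal_density" and [measurable]: "g \<in> borel_measurable borel"
  shows "integrable M (\<lambda>\<omega>. g (X \<omega>)) \<longleftrightarrow> integrable std_normal_distribution g"
    and "expectation (\<lambda>\<omega>. g (X \<omega>)) = (LINT x|std_normal_distribution. g x)"
proof -
  note [measurable] = distributed_std_normalD(1)[OF X]
  show "integrable M (\<lambda>\<omega>. g (X \<omega>)) \<longleftrightarrow> integrable std_normal_distribution g"
    unfolding distributed_std_normalD(2)[OF X, symmetric] by (subst integrable_distr_eq) auto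
  show "expectation (\<lambda>\<omega>. g (X \<omega>)) = (LINT x|std_normal_distribution. g x)"
    unfolding distributed_std_normalD(2)[OF X, symmetric] by (subst integral_distr) auto
qed

text \<open>The modulus splits into a real exponential of X and |W|, and independence factorises the
  moment. X is embedded in the complex numbers because \<open>indep_var\<close> relates two
  variables with values in the same type.\<close>

lemma normal_times_indep_moment:
  fixes W :: "'a \<Rightarrow> complex"
  assumes X: "distributed M lborel X std_normal_density" and ind: "indep_var borel (\<lambda>\<omega>. complex_of_real (X \<omega>)) borel W"
    and int: "integrable M (\<lambda>\<omega>. cmod (W \<omega>) powr r)"
  shows "integrable M (\<lambda>\<omega>. cmod (exp (b * of_real (X \<omega>)) * W \<omega>) powr r)"
    and "expectation (\<lambda>\<omega>. cmod (exp (b * of_real (X \<omega>)) * W \<omega>) powr r) =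
      exp ((r * Re b)\<^sup>2 / 2) * expectation (\<lambda>\<omega>. cmod (W \<omega>) powr r)"
proof -
  have eq: "cmod (exp (b * of_real (X \<omega>)) * W \<omega>) powr r = exp (r * Re b * X \<omega>) * cmod (W \<omega>) powr r" for \<omega>
    by (simp add: norm_mult powr_mult exp_powr_real mult_ac)
  have "indep_var borel ((\<lambda>z. exp (r * Re b * Re z)) \<circ> (\<lambda>\<omega>. complex_of_real (X \<omega>))) borel ((\<lambda>w. cmod w powr r) \<circ> W)"
    by (intro indep_var_compose[OF ind]) auto
  then have ind': "indep_var borel (\<lambda>\<omega>. exp (r * Re b * X \<omega>)) borel (\<lambda>\<omega>. cmod (W \<omega>) powr r)"
    by (simp add: comp_def)
  have iX: "integrable M (\<lambda>\<omega>. exp (r * Re b * X \<omega>))"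
    and EX: "expectation (\<lambda>\<omega>. exp (r * Re b * X \<omega>)) = exp ((r * Re b)\<^sup>2 / 2)"
    using distributed_std_normal_integral[OF X, of "\<lambda>x. exp (r * Re b * x)"]
      integral_std_normal_exp_real[of "r * Re b"] by auto
  show "integrable M (\<lambda>\<omega>. cmod (exp (b * of_real (X \<omega>)) * W \<omega>) powr r)"
    unfolding eq by (rule indep_var_integrable[OF ind' iX int])
  show "expectation (\<lambda>\<omega>. cmod (exp (b * of_real (X \<omega>)) * W \<omega>) powr r) =
      exp ((r * Re b)\<^sup>2 / 2) * expectation (\<lambda>\<omega>. cmod (W \<omega>) powr r)"
    unfolding eq using indep_var_lebesgue_integral[OF ind' iX int] EX by simp
qed

lemma normal_times_indep_mean:
  fixes W :: "'a \<Rightarrow> complex"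
  assumes X: "distributed M lborel X std_normal_density" and ind: "indep_var borel (\<lambda>\<omega>. complex_of_real (X \<omega>)) borel W"
    and int: "integrable M W"
  shows "integrable M (\<lambda>\<omega>. exp (b * of_real (X \<omega>)) * W \<omega>)"
    and "expectation (\<lambda>\<omega>. exp (b * of_real (X \<omega>)) * W \<omega>) = exp (b\<^sup>2 / 2) * expectation W"
proof -
  have "indep_var borel ((\<lambda>z. exp (b * z)) \<circ> (\<lambda>\<omega>. complex_of_real (X \<omega>))) borel ((\<lambda>w. w) \<circ> W)"
    by (intro indep_var_compose[OF ind]) auto
  then have ind': "indep_var borel (\<lambda>\<omega>. exp (b * of_real (X \<omega>))) borel W"
    by (simp add: comp_def)
  have iX: "integrable M (\<lambda>\<omega>. exp (b * of_real (X \<omega>)))"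
    and EX: "expectation (\<lambda>\<omega>. exp (b * of_real (X \<omega>))) = exp (b\<^sup>2 / 2)"
    using distributed_std_normal_integral[OF X, of "\<lambda>x. exp (b * complex_of_real x)"]
      integral_std_normal_exp[of b] by auto
  show "integrable M (\<lambda>\<omega>. exp (b * of_real (X \<omega>)) * W \<omega>)"
    by (rule indep_var_integrable[OF ind' iX int])
  show "expectation (\<lambda>\<omega>. exp (b * of_real (X \<omega>)) * W \<omega>) = exp (b\<^sup>2 / 2) * expectation W"
    using indep_var_lebesgue_integral[OF ind' iX int] EX by simp
qed

lemma normal_times_indep_char:
  fixes W :: "'a \<Rightarrow> complex"
  assumes X: "distributed M lborel X std_normal_density" and ind: "indep_var borel (\<lambda>\<omega>. complex_of_real (X \<omega>)) borel W"
    and c: "c > 0" and \<beta>: "Re \<beta> \<ge> 0" and real: "Im \<beta> \<noteq> 0 \<or> (\<forall>\<omega>. Im (W \<omega>) = 0)"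
    and x0: "x0 \<ge> 0" and h: "h = half_turn \<beta> / c"
    and A: "0 < A" and half: "prob {\<omega>\<in>space M. A \<le> cmod (W \<omega>) \<and> cmod (W \<omega>) \<le> B} \<ge> 1/2"
    and t: "\<bar>t\<bar> * B * exp (Re \<beta> * c * x0) \<le> char_radius \<beta>"
  shows "cmod (expectation (\<lambda>\<omega>. cis (t * Re (exp (\<beta> * of_real c * of_real (X \<omega>)) * W \<omega>))))
    \<le> 1 - std_normal_density (x0 + 2 * h) * h * char_decay \<beta> * (t * A)\<^sup>2 * exp (2 * Re \<beta> * c * x0) / 2"
proof -
  interpret N: prob_space std_normal_distribution by (rule prob_space_normal_density) simp
  note [measurable] = distributed_std_normalD(1)[OF X] indep_var_rv2[OF ind]
  let ?X = "\<lambda>\<omega>. complex_of_real (X \<omega>)"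
  interpret DX: prob_space "distr M borel ?X" by (rule prob_space_distr) simp
  interpret D: prob_space "distr M borel W" by (rule prob_space_distr) simp
  interpret P: pair_prob_space "distr M borel ?X" "distr M borel W" ..
  define \<kappa> where "\<kappa> = std_normal_density (x0 + 2 * h) * h * char_decay \<beta> * (t * A)\<^sup>2 * exp (2 * Re \<beta> * c * x0)"
  have h0: "h > 0" using h c half_turn_pos[of \<beta>] by simp
  have \<kappa>0: "\<kappa> \<ge> 0" using h0 by (simp add: \<kappa>_def char_decay_def)
  define \<psi> where "\<psi> w = (LINT x|std_normal_distribution. cis (Re ((of_real t * w) * exp (\<beta> * of_real (c * x)))))" for w
  define f where "f = (\<lambda>(z, w). cis (Re ((of_real t * w) * exp (\<beta> * (of_real c * z)))))"
  have fm[measurable]: "f \<in> borel_measurable (borel \<Otimes>\<^sub>M borel)"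
    unfolding f_def cis_conv_exp by measurable
  have fm2[measurable]: "f \<in> borel_measurable (distr M borel ?X \<Otimes>\<^sub>M distr M borel W)"
    by (subst measurable_cong_sets[OF sets_pair_measure_cong refl, of _ borel _ borel]) auto
  have eq: "distr M borel ?X \<Otimes>\<^sub>M distr M borel W = distr M (borel \<Otimes>\<^sub>M borel) (\<lambda>\<omega>. (?X \<omega>, W \<omega>))"
    using ind unfolding indep_var_distribution_eq by simp
  have intf: "integrable (distr M borel ?X \<Otimes>\<^sub>M distr M borel W) f"
  proof -
    have "cmod (f z) \<le> 1" for z by (cases z) (simp add: f_def)
    then show ?thesis using fm2 by (intro P.integrable_const_bound[of _ 1]) auto
  qed
  have inner: "(LINT z|distr M borel ?X. f (z, w)) = \<psi> w" for w
  proof -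
    have "(LINT z|distr M borel ?X. f (z, w)) = expectation (\<lambda>\<omega>. f (?X \<omega>, w))"
      by (rule integral_distr) (auto simp: f_def cis_conv_exp intro!: borel_measurable_continuous_onI continuous_intros)
    also have "\<dots> = \<psi> w"
      unfolding \<psi>_def by (subst distributed_std_normal_integral(2)[OF X, symmetric])
        (auto simp: f_def cis_conv_exp)
    finally show ?thesis .
  qed
  have "expectation (\<lambda>\<omega>. cis (t * Re (exp (\<beta> * of_real c * of_real (X \<omega>)) * W \<omega>))) =
      expectation (\<lambda>\<omega>. f (?X \<omega>, W \<omega>))"
    by (simp add: f_def algebra_simps)
  also have "\<dots> = integral\<^sup>L (distr M (borel \<Otimes>\<^sub>M borel) (\<lambda>\<omega>. (?X \<omega>, W \<omega>))) f"
    by (subst integral_distr) auto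
  also have "\<dots> = integral\<^sup>L (distr M borel ?X \<Otimes>\<^sub>M distr M borel W) f"
    unfolding eq[symmetric] ..
  also have "\<dots> = (LINT w|distr M borel W. LINT z|distr M borel ?X. f (z, w))"
    using P.integral_snd[of "\<lambda>z w. f (z, w)"] intf by simp
  also have "\<dots> = (LINT w|distr M borel W. \<psi> w)" by (simp only: inner)
  also have "\<dots> = expectation (\<lambda>\<omega>. \<psi> (W \<omega>))"
  proof (rule integral_distr)
    have "(\<lambda>w. LINT x|std_normal_distribution. cis (Re ((of_real t * w) * exp (\<beta> * of_real (c * x)))))
        \<in> borel_measurable borel"
      by (rule N.borel_measurable_lebesgue_integral)
        (auto simp: cis_conv_exp split_beta)
    then show "\<psi> \<in> borel_measurable borel" by (simp add: \<psi>_def[abs_def])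
  qed simp
  finally have E: "expectation (\<lambda>\<omega>. cis (t * Re (exp (\<beta> * of_real c * of_real (X \<omega>)) * W \<omega>))) =
    expectation (\<lambda>\<omega>. \<psi> (W \<omega>))" .
  define S where "S = {\<omega>\<in>space M. A \<le> cmod (W \<omega>) \<and> cmod (W \<omega>) \<le> B}"
  have S[measurable]: "S \<in> sets M" unfolding S_def by measurable
  have bnd: "cmod (\<psi> (W \<omega>)) \<le> 1 - \<kappa> * indicator S \<omega>" if "\<omega> \<in> space M" for \<omega>
  proof (cases "\<omega> \<in> S")
    case False
    have "cmod (\<psi> (W \<omega>)) \<le> (LINT x|std_normal_distribution. 1)"
      unfolding \<psi>_def by (rule order_trans[OF integral_norm_bound]) simp
    also have "\<dots> = 1" using N.prob_space by simp
    finally show ?thesis using False by simp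
  next
    case True
    then have AB: "A \<le> cmod (W \<omega>)" "cmod (W \<omega>) \<le> B" by (auto simp: S_def)
    have "cmod (\<psi> (W \<omega>)) \<le> 1 - std_normal_density (x0 + 2 * h) * h * char_decay \<beta> *
        (cmod (of_real t * W \<omega>))\<^sup>2 * exp (2 * Re \<beta> * c * x0)"
      unfolding \<psi>_def
    proof (rule norm_char_exp_normal_le[OF c \<beta> _ x0 h])
      have "\<bar>t\<bar> * cmod (W \<omega>) * exp (Re \<beta> * c * x0) \<le> \<bar>t\<bar> * B * exp (Re \<beta> * c * x0)"
        using AB by (intro mult_right_mono mult_left_mono) auto
      then show "cmod (of_real t * W \<omega>) * exp (Re \<beta> * c * x0) \<le> char_radius \<beta>"
        using t by (simp add: norm_mult)
    qed (use real in auto)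
    moreover have "(t * A)\<^sup>2 \<le> (cmod (of_real t * W \<omega>))\<^sup>2"
    proof -
      have "\<bar>t\<bar> * A \<le> \<bar>t\<bar> * cmod (W \<omega>)" using AB by (intro mult_left_mono) auto
      then have "(\<bar>t\<bar> * A)\<^sup>2 \<le> (\<bar>t\<bar> * cmod (W \<omega>))\<^sup>2" using A by (intro power_mono) auto
      then show ?thesis by (simp add: norm_mult power_mult_distrib)
    qed
    then have "\<kappa> \<le> std_normal_density (x0 + 2 * h) * h * char_decay \<beta> *
        (cmod (of_real t * W \<omega>))\<^sup>2 * exp (2 * Re \<beta> * c * x0)"
      unfolding \<kappa>_def using h0 by (intro mult_right_mono mult_left_mono) (auto simp: char_decay_def)
    ultimately show ?thesis using True by simp
  qed
  have "cmod (expectation (\<lambda>\<omega>. \<psi> (W \<omega>))) \<le> expectation (\<lambda>\<omega>. cmod (\<psi> (W \<omega>)))"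
    by (rule integral_norm_bound)
  also have "\<dots> \<le> expectation (\<lambda>\<omega>. 1 - \<kappa> * indicator S \<omega>)"
  proof (rule integral_mono')
    show "integrable M (\<lambda>\<omega>. 1 - \<kappa> * indicator S \<omega>)"
      by (intro Bochner_Integration.integrable_diff integrable_mult_right integrable_real_indicator)
        (auto simp: emeasure_eq_measure)
  qed (use bnd order_trans[OF norm_ge_zero bnd] in auto)
  also have "\<dots> = 1 - \<kappa> * prob S"
    by (subst Bochner_Integration.integral_diff)
      (auto simp: emeasure_eq_measure prob_space intro!: integrable_mult_right integrable_real_indicator)
  also have "\<dots> \<le> 1 - \<kappa> * (1/2)" using half \<kappa>0 unfolding S_def by (intro diff_left_mono mult_left_mono) auto
  finally show ?thesis unfolding E \<kappa>_def by simp
qed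

end

section \<open>Exponential rates under branching\<close>

text \<open>Below, \<open>\<W> n\<close> stands for the set of the partition functions of all subtrees rooted at one level
  of the tree, so that every estimate is uniform in the root.\<close>

definition branching :: "'w measure \<Rightarrow> complex \<Rightarrow> nat \<Rightarrow> ('w \<Rightarrow> complex) set \<Rightarrow> ('w \<Rightarrow> complex) set" where
  "branching M b N \<W> = {Z. \<exists>X W.
     (\<forall>i\<in>{1..N}. W i \<in> \<W> \<and> distributed M lborel (X i) std_normal_density \<and>
        prob_space.indep_var M borel (\<lambda>\<omega>. complex_of_real (X i \<omega>)) borel (W i)) \<and>
     prob_space.indep_vars M (\<lambda>_. borel) (\<lambda>i \<omega>. exp (b * of_real (X i \<omega>)) * W i \<omega>) {1..N} \<and>
     Z = (\<lambda>\<omega>. \<Sum>i=1..N. exp (b * of_real (X i \<omega>)) * W i \<omega>)}"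

text \<open>An upper bound only. The rate p is that of |W| and not of its r-th power, so that rates
  for different r are comparable.\<close>

definition moment_rate :: "'w measure \<Rightarrow> real \<Rightarrow> real \<Rightarrow> (nat \<Rightarrow> ('w \<Rightarrow> complex) set) \<Rightarrow> bool" where
  "moment_rate M r p \<W> \<longleftrightarrow> (\<forall>\<epsilon>>0. \<forall>\<^sub>F n in sequentially. \<forall>W\<in>\<W> n.
     W \<in> borel_measurable M \<and> integrable M (\<lambda>\<omega>. cmod (W \<omega>) powr r) \<and>
     (LINT \<omega>|M. cmod (W \<omega>) powr r) \<le> exp (real n * (r * (p + \<epsilon>))))"

text \<open>All members for one n share their mean, so that the children of a vertex contribute
  equal terms, which cannot cancel. Only a lower bound on this mean is recorded; upper bounds are
  the business of \<open>moment_rate\<close>.\<close>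

definition mean_rate :: "'w measure \<Rightarrow> real \<Rightarrow> (nat \<Rightarrow> ('w \<Rightarrow> complex) set) \<Rightarrow> bool" where
  "mean_rate M p \<W> \<longleftrightarrow> (\<exists>\<mu>.
     (\<forall>\<^sub>F n in sequentially. \<forall>W\<in>\<W> n. integrable M W \<and> integral\<^sup>L M W = \<mu> n) \<and>
     (\<forall>\<epsilon>>0. \<forall>\<^sub>F n in sequentially. exp (real n * (p - \<epsilon>)) \<le> cmod (\<mu> n)))"

definition lower_rate :: "'w measure \<Rightarrow> real \<Rightarrow> (nat \<Rightarrow> ('w \<Rightarrow> complex) set) \<Rightarrow> bool" where
  "lower_rate M p \<W> \<longleftrightarrow> (\<forall>\<epsilon>>0. \<forall>\<eta>>0. \<forall>\<^sub>F n in sequentially. \<forall>W\<in>\<W> n.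
     W \<in> borel_measurable M \<and>
     measure M {\<omega>\<in>space M. cmod (W \<omega>) \<le> exp (real n * (p - \<epsilon>))} \<le> \<eta>)"

lemma eventually_card_le_exp:
  fixes N :: "nat \<Rightarrow> nat"
  assumes N: "(\<lambda>n. real (N n) / \<alpha> ^ n) \<longlonglongrightarrow> 1" and \<alpha>: "\<alpha> > 1" and \<epsilon>: "\<epsilon> > 0"
  shows "\<forall>\<^sub>F n in sequentially. real (N n) \<le> exp (real n * (ln \<alpha> + \<epsilon>))"
    and "\<forall>\<^sub>F n in sequentially. exp (real n * (ln \<alpha> - \<epsilon>)) \<le> real (N n)"
proof -
  have pw: "\<alpha> ^ n = exp (real n * ln \<alpha>)" for n
    using \<alpha> by (simp add: exp_of_nat_mult)
  have "filterlim (\<lambda>n. exp (real n * \<epsilon>)) at_top sequentially" using \<epsilon> by real_asymp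
  then have e: "\<forall>\<^sub>F n in sequentially. 2 \<le> exp (real n * \<epsilon>)"
    by (auto simp: filterlim_at_top)
  have "\<forall>\<^sub>F n in sequentially. real (N n) / \<alpha> ^ n < 2"
    using N by (rule order_tendstoD) simp
  with e show "\<forall>\<^sub>F n in sequentially. real (N n) \<le> exp (real n * (ln \<alpha> + \<epsilon>))"
  proof eventually_elim
    case (elim n)
    then have "real (N n) \<le> 2 * \<alpha> ^ n" using \<alpha> by (simp add: field_simps)
    also have "\<dots> \<le> exp (real n * \<epsilon>) * \<alpha> ^ n" using elim \<alpha> by (intro mult_right_mono) auto
    finally show ?case by (simp add: pw mult_exp_exp distrib_left add.commute)
  qed
  have "\<forall>\<^sub>F n in sequentially. 1/2 < real (N n) / \<alpha> ^ n"
    using N by (rule order_tendstoD) simp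
  with e show "\<forall>\<^sub>F n in sequentially. exp (real n * (ln \<alpha> - \<epsilon>)) \<le> real (N n)"
  proof eventually_elim
    case (elim n)
    have "\<alpha> ^ n \<le> 2 * real (N n)" using elim \<alpha> by (simp add: field_simps)
    also have "\<dots> \<le> exp (real n * \<epsilon>) * real (N n)" using elim by (intro mult_right_mono) auto
    finally show ?case by (simp add: pw right_diff_distrib exp_diff field_simps)
  qed
qed

section \<open>Moments of a single branching sum\<close>

context prob_space
begin

lemma branchingE:
  assumes "Z \<in> branching M b N \<W>"
  obtains X W where "\<And>i. i \<in> {1..N} \<Longrightarrow> W i \<in> \<W>"
    "\<And>i. i \<in> {1..N} \<Longrightarrow> distributed M lborel (X i) std_normal_density"
    "\<And>i. i \<in> {1..N} \<Longrightarrow> indep_var borel (\<lambda>\<omega>. complex_of_real (X i \<omega>)) borel (W i)"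
    "indep_vars (\<lambda>_. borel) (\<lambda>i \<omega>. exp (b * of_real (X i \<omega>)) * W i \<omega>) {1..N}"
    "Z = (\<lambda>\<omega>. \<Sum>i=1..N. exp (b * of_real (X i \<omega>)) * W i \<omega>)"
    "Z \<in> borel_measurable M"
proof -
  from assms obtain X W where *: "\<forall>i\<in>{1..N}. W i \<in> \<W> \<and> distributed M lborel (X i) std_normal_density \<and>
        indep_var borel (\<lambda>\<omega>. complex_of_real (X i \<omega>)) borel (W i)"
    "indep_vars (\<lambda>_. borel) (\<lambda>i \<omega>. exp (b * of_real (X i \<omega>)) * W i \<omega>) {1..N}"
    "Z = (\<lambda>\<omega>. \<Sum>i=1..N. exp (b * of_real (X i \<omega>)) * W i \<omega>)"
    unfolding branching_def mem_Collect_eq by (elim exE conjE) (rule that)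
  have "Z \<in> borel_measurable M"
    unfolding *(3) using *(2) by (intro borel_measurable_sum) (auto simp: indep_vars_def)
  with * show ?thesis by (intro that[OF _ _ _ *(2,3)]) auto
qed

lemma branching_moment_le_1:
  assumes Z: "Z \<in> branching M b N \<W>" and r: "0 < r" "r \<le> 1"
    and W: "\<And>W. W \<in> \<W> \<Longrightarrow> integrable M (\<lambda>\<omega>. cmod (W \<omega>) powr r)"
      "\<And>W. W \<in> \<W> \<Longrightarrow> expectation (\<lambda>\<omega>. cmod (W \<omega>) powr r) \<le> D"
  shows "integrable M (\<lambda>\<omega>. cmod (Z \<omega>) powr r)"
    and "expectation (\<lambda>\<omega>. cmod (Z \<omega>) powr r) \<le> real N * (exp ((r * Re b)\<^sup>2 / 2) * D)"
proof -
  from Z obtain X W where *: "\<And>i. i \<in> {1..N} \<Longrightarrow> W i \<in> \<W>"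
    "\<And>i. i \<in> {1..N} \<Longrightarrow> distributed M lborel (X i) std_normal_density"
    "\<And>i. i \<in> {1..N} \<Longrightarrow> indep_var borel (\<lambda>\<omega>. complex_of_real (X i \<omega>)) borel (W i)"
    "indep_vars (\<lambda>_. borel) (\<lambda>i \<omega>. exp (b * of_real (X i \<omega>)) * W i \<omega>) {1..N}"
    "Z = (\<lambda>\<omega>. \<Sum>i=1..N. exp (b * of_real (X i \<omega>)) * W i \<omega>)"
    and [measurable]: "Z \<in> borel_measurable M" by (rule branchingE) (rule that)
  define Y where "Y i \<omega> = exp (b * of_real (X i \<omega>)) * W i \<omega>" for i \<omega>
  have Y: "integrable M (\<lambda>\<omega>. cmod (Y i \<omega>) powr r)"
    "expectation (\<lambda>\<omega>. cmod (Y i \<omega>) powr r) \<le> exp ((r * Re b)\<^sup>2 / 2) * D" if "i \<in> {1..N}" for i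
    using normal_times_indep_moment[OF *(2,3)[OF that] W(1)[OF *(1)[OF that]], of b] W(2)[OF *(1)[OF that]]
    by (auto simp: Y_def)
  have pt: "cmod (Z \<omega>) powr r \<le> (\<Sum>i=1..N. cmod (Y i \<omega>) powr r)" for \<omega>
  proof -
    have "cmod (Z \<omega>) powr r \<le> (\<Sum>i=1..N. cmod (Y i \<omega>)) powr r"
      unfolding *(5) Y_def using r by (intro powr_mono2 norm_sum) auto
    also have "\<dots> \<le> (\<Sum>i=1..N. cmod (Y i \<omega>) powr r)"
      using r by (intro powr_sum_le_sum_powr) auto
    finally show ?thesis .
  qed
  have iS: "integrable M (\<lambda>\<omega>. \<Sum>i=1..N. cmod (Y i \<omega>) powr r)"
    by (rule Bochner_Integration.integrable_sum) (rule Y)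
  show iZ: "integrable M (\<lambda>\<omega>. cmod (Z \<omega>) powr r)"
    by (rule Bochner_Integration.integrable_bound[OF iS])
       (use pt in \<open>auto intro!: AE_I2 order_trans[OF _ abs_ge_self]\<close>)
  have "expectation (\<lambda>\<omega>. cmod (Z \<omega>) powr r) \<le> expectation (\<lambda>\<omega>. \<Sum>i=1..N. cmod (Y i \<omega>) powr r)"
    by (intro integral_mono iZ iS pt)
  also have "\<dots> = (\<Sum>i=1..N. expectation (\<lambda>\<omega>. cmod (Y i \<omega>) powr r))"
    by (rule Bochner_Integration.integral_sum) (rule Y)
  also have "\<dots> \<le> (\<Sum>i=1..N. exp ((r * Re b)\<^sup>2 / 2) * D)" by (intro sum_mono Y)
  finally show "expectation (\<lambda>\<omega>. cmod (Z \<omega>) powr r) \<le> real N * (exp ((r * Re b)\<^sup>2 / 2) * D)" by simp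
qed

lemma norm_expectation_powr_le:
  fixes Y :: "'a \<Rightarrow> complex"
  assumes [measurable]: "Y \<in> borel_measurable M" and r: "1 \<le> r"
    and int: "integrable M (\<lambda>\<omega>. cmod (Y \<omega>) powr r)"
    and D: "expectation (\<lambda>\<omega>. cmod (Y \<omega>) powr r) \<le> D" "D > 0"
  shows "cmod (expectation Y) powr r \<le> D"
proof -
  have "cmod (expectation Y) \<le> expectation (\<lambda>\<omega>. cmod (Y \<omega>) powr 1)"
    by (simp add: integral_norm_bound)
  also have "\<dots> \<le> D powr (1 / r)"
    by (rule expectation_powr_le[OF _ _ _ _ int D]) (use r in auto)
  finally have "cmod (expectation Y) powr r \<le> (D powr (1 / r)) powr r"
    using r by (intro powr_mono2) auto
  then show ?thesis using r D by (simp add: powr_powr)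
qed

text \<open>Every summand is centred by itself before \<open>von_Bahr_Esseen\<close> is applied. The
  constant is 48 = 6 * 8: the 6 is that of the inequality, and the 8 is the cost of centring, 4 from
  \<open>powr_add_le\<close>, doubled because the moment and the power of the mean are each at most
  E.\<close>

lemma branching_centred_moment:
  assumes Z: "Z \<in> branching M b N \<W>" and r: "1 < r" "r \<le> 2"
    and W: "\<And>W. W \<in> \<W> \<Longrightarrow> W \<in> borel_measurable M"
      "\<And>W. W \<in> \<W> \<Longrightarrow> integrable M (\<lambda>\<omega>. cmod (W \<omega>) powr r)"
      "\<And>W. W \<in> \<W> \<Longrightarrow> expectation (\<lambda>\<omega>. cmod (W \<omega>) powr r) \<le> D" and D: "D > 0"
  shows "integrable M Z"
    and "integrable M (\<lambda>\<omega>. cmod (Z \<omega> - expectation Z) powr r)"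
    and "expectation (\<lambda>\<omega>. cmod (Z \<omega> - expectation Z) powr r) \<le> 48 * (real N * (exp ((r * Re b)\<^sup>2 / 2) * D))"
    and "cmod (expectation Z) \<le> real N * (cmod (exp (b\<^sup>2 / 2)) * D powr (1 / r))"
    and "\<And>\<mu>. (\<And>W. W \<in> \<W> \<Longrightarrow> expectation W = \<mu>) \<Longrightarrow> expectation Z = of_nat N * (exp (b\<^sup>2 / 2) * \<mu>)"
proof -
  from Z obtain X W where *: "\<And>i. i \<in> {1..N} \<Longrightarrow> W i \<in> \<W>"
    "\<And>i. i \<in> {1..N} \<Longrightarrow> distributed M lborel (X i) std_normal_density"
    "\<And>i. i \<in> {1..N} \<Longrightarrow> indep_var borel (\<lambda>\<omega>. complex_of_real (X i \<omega>)) borel (W i)"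
    "indep_vars (\<lambda>_. borel) (\<lambda>i \<omega>. exp (b * of_real (X i \<omega>)) * W i \<omega>) {1..N}"
    "Z = (\<lambda>\<omega>. \<Sum>i=1..N. exp (b * of_real (X i \<omega>)) * W i \<omega>)"
    and [measurable]: "Z \<in> borel_measurable M" by (rule branchingE) (rule that)
  define Y where "Y i \<omega> = exp (b * of_real (X i \<omega>)) * W i \<omega>" for i \<omega>
  define E where "E = exp ((r * Re b)\<^sup>2 / 2) * D"
  have E0: "E > 0" using D by (simp add: E_def)
  have Ym: "Y i \<in> borel_measurable M" if "i \<in> {1..N}" for i
    using *(4) that by (auto simp: indep_vars_def Y_def[abs_def])
  have Wi: "integrable M (W i)" if "i \<in> {1..N}" for i
    using integrable_norm_powr_imp[OF W(1)[OF *(1)[OF that]] _ W(2)[OF *(1)[OF that]]] r by simp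
  have Y: "integrable M (\<lambda>\<omega>. cmod (Y i \<omega>) powr r)"
    "expectation (\<lambda>\<omega>. cmod (Y i \<omega>) powr r) \<le> E" if "i \<in> {1..N}" for i
    using normal_times_indep_moment[OF *(2,3)[OF that] W(2)[OF *(1)[OF that]], of b] W(3)[OF *(1)[OF that]]
    by (auto simp: Y_def E_def)
  have Yi: "integrable M (Y i)" "expectation (Y i) = exp (b\<^sup>2 / 2) * expectation (W i)" if "i \<in> {1..N}" for i
    using normal_times_indep_mean[OF *(2,3)[OF that] Wi[OF that], of b] by (auto simp: Y_def[abs_def])
  have ZY: "Z = (\<lambda>\<omega>. \<Sum>i=1..N. Y i \<omega>)" by (simp add: *(5) Y_def)
  show "integrable M Z" unfolding ZY by (rule Bochner_Integration.integrable_sum) (rule Yi)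
  have EZ: "expectation Z = (\<Sum>i=1..N. expectation (Y i))"
    unfolding ZY by (rule Bochner_Integration.integral_sum) (rule Yi)
  show "expectation Z = of_nat N * (exp (b\<^sup>2 / 2) * \<mu>)" if "\<And>W. W \<in> \<W> \<Longrightarrow> expectation W = \<mu>" for \<mu>
    unfolding EZ using Yi(2) that *(1) by simp
  have "cmod (expectation Z) \<le> (\<Sum>i=1..N. cmod (expectation (Y i)))"
    unfolding EZ by (rule norm_sum)
  also have "\<dots> \<le> (\<Sum>i=1..N. cmod (exp (b\<^sup>2 / 2)) * D powr (1 / r))"
  proof (rule sum_mono)
    fix i assume i: "i \<in> {1..N}"
    have "cmod (expectation (W i)) powr r \<le> D"
      using r W *(1)[OF i] D by (intro norm_expectation_powr_le) auto
    then have "(cmod (expectation (W i)) powr r) powr (1 / r) \<le> D powr (1 / r)"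
      using r by (intro powr_mono2) auto
    then have "cmod (expectation (W i)) \<le> D powr (1 / r)" using r by (simp add: powr_powr)
    then show "cmod (expectation (Y i)) \<le> cmod (exp (b\<^sup>2 / 2)) * D powr (1 / r)"
      unfolding Yi(2)[OF i] norm_mult by (intro mult_left_mono) auto
  qed
  finally show "cmod (expectation Z) \<le> real N * (cmod (exp (b\<^sup>2 / 2)) * D powr (1 / r))" by simp
  define U where "U i \<omega> = Y i \<omega> - expectation (Y i)" for i \<omega>
  have ZU: "Z \<omega> - expectation Z = (\<Sum>i=1..N. U i \<omega>)" for \<omega>
    unfolding EZ U_def sum_subtractf by (simp add: ZY)
  have ind: "indep_vars (\<lambda>_. borel) U {1..N}"
    unfolding U_def[abs_def]
    by (rule indep_vars_compose2[OF *(4)[folded Y_def]]) auto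
  have U: "integrable M (\<lambda>\<omega>. cmod (U i \<omega>) powr r)"
    "expectation (\<lambda>\<omega>. cmod (U i \<omega>) powr r) \<le> 8 * E" if i: "i \<in> {1..N}" for i
  proof -
    note [measurable] = Ym[OF i]
    have mu: "cmod (expectation (Y i)) powr r \<le> E"
      using r Y[OF i] E0 by (intro norm_expectation_powr_le) auto
    have pt: "cmod (U i \<omega>) powr r \<le> 4 * (cmod (Y i \<omega>) powr r + E)" for \<omega>
    proof -
      have "cmod (U i \<omega>) powr r \<le> (cmod (Y i \<omega>) + cmod (expectation (Y i))) powr r"
        unfolding U_def using r by (intro powr_mono2 norm_triangle_ineq4) auto
      also have "\<dots> \<le> 4 * (cmod (Y i \<omega>) powr r + cmod (expectation (Y i)) powr r)"
        using r by (intro powr_add_le) auto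
      finally show ?thesis using mu by simp
    qed
    have i4: "integrable M (\<lambda>\<omega>. 4 * (cmod (Y i \<omega>) powr r + E))" using Y(1)[OF i] by auto
    have Um[measurable]: "U i \<in> borel_measurable M" unfolding U_def by measurable
    show iU: "integrable M (\<lambda>\<omega>. cmod (U i \<omega>) powr r)"
      by (rule Bochner_Integration.integrable_bound[OF i4])
        (use pt in \<open>auto intro!: AE_I2 order_trans[OF _ abs_ge_self]\<close>)
    have "expectation (\<lambda>\<omega>. cmod (U i \<omega>) powr r) \<le> expectation (\<lambda>\<omega>. 4 * (cmod (Y i \<omega>) powr r + E))"
      by (intro integral_mono iU i4 pt)
    also have "\<dots> = 4 * (expectation (\<lambda>\<omega>. cmod (Y i \<omega>) powr r) + E)"
      using Y(1)[OF i] by (simp add: prob_space)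
    finally show "expectation (\<lambda>\<omega>. cmod (U i \<omega>) powr r) \<le> 8 * E" using Y(2)[OF i] by simp
  qed
  have "expectation (U i) = 0" if "i \<in> {1..N}" for i
    using Yi(1)[OF that] by (simp add: U_def[abs_def] prob_space)
  note vBE = von_Bahr_Esseen[OF r _ ind U(1) this, simplified]
  show "integrable M (\<lambda>\<omega>. cmod (Z \<omega> - expectation Z) powr r)" unfolding ZU using vBE by simp
  have "expectation (\<lambda>\<omega>. cmod (Z \<omega> - expectation Z) powr r) \<le>
      6 * (\<Sum>i=1..N. expectation (\<lambda>\<omega>. cmod (U i \<omega>) powr r))" unfolding ZU using vBE by simp
  also have "\<dots> \<le> 6 * (\<Sum>i=1..N. 8 * E)" by (intro mult_left_mono sum_mono U) auto
  finally show "expectation (\<lambda>\<omega>. cmod (Z \<omega> - expectation Z) powr r) \<le> 48 * (real N * (exp ((r * Re b)\<^sup>2 / 2) * D))"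
    by (simp add: E_def)
qed

text \<open>The mean is added back to the centred sum, again at the price of a factor 4; 200 is a
  round bound for 4 * 48.\<close>

lemma branching_moment_gt_1:
  assumes Z: "Z \<in> branching M b N \<W>" and r: "1 < r" "r \<le> 2"
    and W: "\<And>W. W \<in> \<W> \<Longrightarrow> W \<in> borel_measurable M"
      "\<And>W. W \<in> \<W> \<Longrightarrow> integrable M (\<lambda>\<omega>. cmod (W \<omega>) powr r)"
      "\<And>W. W \<in> \<W> \<Longrightarrow> expectation (\<lambda>\<omega>. cmod (W \<omega>) powr r) \<le> D" and D: "D > 0"
  shows "integrable M (\<lambda>\<omega>. cmod (Z \<omega>) powr r)"
    and "expectation (\<lambda>\<omega>. cmod (Z \<omega>) powr r) \<le>
      200 * (real N * (exp ((r * Re b)\<^sup>2 / 2) * D) + (real N * cmod (exp (b\<^sup>2 / 2))) powr r * D)"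
proof -
  note C = branching_centred_moment[OF Z r W D]
  have [measurable]: "Z \<in> borel_measurable M" using Z by (rule branchingE)
  define m where "m = (real N * cmod (exp (b\<^sup>2 / 2))) powr r * D"
  have m: "cmod (expectation Z) powr r \<le> m" "m \<ge> 0"
  proof -
    have "cmod (expectation Z) powr r \<le> (real N * (cmod (exp (b\<^sup>2 / 2)) * D powr (1 / r))) powr r"
      using r C(4) by (intro powr_mono2) auto
    also have "\<dots> = m" using r D by (simp add: m_def powr_mult powr_powr)
    finally show "cmod (expectation Z) powr r \<le> m" .
    show "m \<ge> 0" using D by (simp add: m_def)
  qed
  have pt: "cmod (Z \<omega>) powr r \<le> 4 * (cmod (Z \<omega> - expectation Z) powr r + m)" for \<omega>
  proof -
    have "cmod (Z \<omega>) powr r \<le> (cmod (Z \<omega> - expectation Z) + cmod (expectation Z)) powr r"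
      using r norm_triangle_ineq[of "Z \<omega> - expectation Z" "expectation Z"] by (intro powr_mono2) auto
    also have "\<dots> \<le> 4 * (cmod (Z \<omega> - expectation Z) powr r + cmod (expectation Z) powr r)"
      using r by (intro powr_add_le) auto
    finally show ?thesis using m by simp
  qed
  have i4: "integrable M (\<lambda>\<omega>. 4 * (cmod (Z \<omega> - expectation Z) powr r + m))" using C(2) by auto
  show iU: "integrable M (\<lambda>\<omega>. cmod (Z \<omega>) powr r)"
    by (rule Bochner_Integration.integrable_bound[OF i4])
      (use pt in \<open>auto intro!: AE_I2 order_trans[OF _ abs_ge_self]\<close>)
  have "expectation (\<lambda>\<omega>. cmod (Z \<omega>) powr r) \<le> expectation (\<lambda>\<omega>. 4 * (cmod (Z \<omega> - expectation Z) powr r + m))"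
    by (intro integral_mono iU i4 pt)
  also have "\<dots> = 4 * (expectation (\<lambda>\<omega>. cmod (Z \<omega> - expectation Z) powr r) + m)"
    using C(2) by (simp add: prob_space)
  also have "\<dots> \<le> 4 * (48 * (real N * (exp ((r * Re b)\<^sup>2 / 2) * D)) + m)"
    using C(3) by (intro mult_left_mono add_right_mono) auto
  also have "\<dots> \<le> 200 * (real N * (exp ((r * Re b)\<^sup>2 / 2) * D) + m)"
    using m D by simp
  finally show "expectation (\<lambda>\<omega>. cmod (Z \<omega>) powr r) \<le>
      200 * (real N * (exp ((r * Re b)\<^sup>2 / 2) * D) + (real N * cmod (exp (b\<^sup>2 / 2))) powr r * D)"
    by (simp add: m_def)
qed

end

lemma eventually_const_le_exp:
  fixes C \<delta> :: real
  assumes "\<delta> > 0"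
  shows "\<forall>\<^sub>F n in sequentially. C \<le> exp (real n * \<delta>)"
proof -
  have "filterlim (\<lambda>n. exp (real n * \<delta>)) at_top sequentially" using assms by real_asymp
  then show ?thesis by (auto simp: filterlim_at_top)
qed

lemma Re_scaled: "(s * Re (\<beta> * of_real (sqrt (real n * a))))\<^sup>2 / 2 = real n * ((s * Re \<beta>)\<^sup>2 * a / 2)"
  if "a \<ge> 0"
  using that by (simp add: power_mult_distrib)

lemma norm_exp_scaled:
  assumes "a \<ge> 0"
  shows "cmod (exp ((\<beta> * of_real (sqrt (real n * a)))\<^sup>2 / 2)) = exp (real n * (a * ((Re \<beta>)\<^sup>2 - (Im \<beta>)\<^sup>2) / 2))"
proof -
  have "(\<beta> * of_real (sqrt (real n * a)))\<^sup>2 / 2 = of_real (real n * a / 2) * \<beta>\<^sup>2"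
    using assms by (simp add: power_mult_distrib flip: of_real_power)
  then have "Re ((\<beta> * of_real (sqrt (real n * a)))\<^sup>2 / 2) = real n * (a * ((Re \<beta>)\<^sup>2 - (Im \<beta>)\<^sup>2) / 2)"
    by (simp only: Re_power2 Re_complex_of_real Im_complex_of_real times_complex.sel)
       (simp add: field_simps)
  then show ?thesis by simp
qed

section \<open>Rates across one level: moments, means, and the lower bound by the mean\<close>

context prob_space
begin

text \<open>Lyapunov's inequality on the exponential scale. It lets a level work with its own
  critical order when the subtrees below are controlled for a larger one.\<close>

lemma moment_rate_mono:
  assumes W: "moment_rate M s p \<W>" and r: "0 < r" "r \<le> s"
  shows "moment_rate M r p \<W>"
  unfolding moment_rate_def
proof (intro allI impI)
  fix \<epsilon> :: real assume "\<epsilon> > 0"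
  with W have "\<forall>\<^sub>F n in sequentially. \<forall>W\<in>\<W> n. W \<in> borel_measurable M \<and>
     integrable M (\<lambda>\<omega>. cmod (W \<omega>) powr s) \<and>
     expectation (\<lambda>\<omega>. cmod (W \<omega>) powr s) \<le> exp (real n * (s * (p + \<epsilon>)))"
    unfolding moment_rate_def by blast
  then show "\<forall>\<^sub>F n in sequentially. \<forall>W\<in>\<W> n. W \<in> borel_measurable M \<and>
     integrable M (\<lambda>\<omega>. cmod (W \<omega>) powr r) \<and>
     expectation (\<lambda>\<omega>. cmod (W \<omega>) powr r) \<le> exp (real n * (r * (p + \<epsilon>)))"
  proof eventually_elim
    case (elim n)
    show ?case
    proof
      fix W assume "W \<in> \<W> n"
      with elim have W: "W \<in> borel_measurable M" "integrable M (\<lambda>\<omega>. cmod (W \<omega>) powr s)"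
        "expectation (\<lambda>\<omega>. cmod (W \<omega>) powr s) \<le> exp (real n * (s * (p + \<epsilon>)))" by auto
      have "(\<lambda>\<omega>. cmod (W \<omega>)) \<in> borel_measurable M" using W by measurable
      from expectation_powr_le[OF this _ r W(2,3)]
      have "integrable M (\<lambda>\<omega>. cmod (W \<omega>) powr r)"
        "expectation (\<lambda>\<omega>. cmod (W \<omega>) powr r) \<le> exp (real n * (s * (p + \<epsilon>))) powr (r / s)" by auto
      moreover have "exp (real n * (s * (p + \<epsilon>))) powr (r / s) = exp (real n * (r * (p + \<epsilon>)))"
        using r by (simp add: exp_powr_real)
      ultimately show "W \<in> borel_measurable M \<and> integrable M (\<lambda>\<omega>. cmod (W \<omega>) powr r) \<and>
          expectation (\<lambda>\<omega>. cmod (W \<omega>) powr r) \<le> exp (real n * (r * (p + \<epsilon>)))"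
        using W by simp
    qed
  qed
qed

lemma prob_norm_ge_le:
  fixes U :: "'a \<Rightarrow> complex"
  assumes r: "r > 0" and int: "integrable M (\<lambda>\<omega>. cmod (U \<omega>) powr r)"
    and D: "expectation (\<lambda>\<omega>. cmod (U \<omega>) powr r) \<le> exp D"
  shows "prob {\<omega>\<in>space M. exp l \<le> cmod (U \<omega>)} \<le> exp (D - r * l)"
proof -
  have "prob {\<omega>\<in>space M. exp (r * l) \<le> cmod (U \<omega>) powr r} \<le>
      expectation (\<lambda>\<omega>. cmod (U \<omega>) powr r) / exp (r * l)"
    using int by (intro integral_Markov_inequality_measure[where A = "{}"]) auto
  also have "\<dots> \<le> exp D / exp (r * l)" using D by (intro divide_right_mono) auto
  also have "{\<omega>\<in>space M. exp (r * l) \<le> cmod (U \<omega>) powr r} = {\<omega>\<in>space M. exp l \<le> cmod (U \<omega>)}"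
  proof -
    have "exp (r * l) \<le> x powr r \<longleftrightarrow> exp l \<le> x" if "x \<ge> 0" for x :: real
    proof -
      have "exp (r * l) = exp l powr r" by (simp add: exp_powr_real mult.commute)
      then show ?thesis using r that powr_mono2[of r "exp l" x] powr_less_mono2[of r x "exp l"] by force
    qed
    then show ?thesis by simp
  qed
  finally show ?thesis by (simp add: exp_diff)
qed

lemma moment_rate_upper:
  assumes W: "moment_rate M r p \<W>" and r: "0 < r" and \<epsilon>: "\<epsilon> > 0" and \<eta>: "\<eta> > 0"
  shows "\<forall>\<^sub>F n in sequentially. \<forall>W\<in>\<W> n. W \<in> borel_measurable M \<and>
    prob {\<omega>\<in>space M. exp (real n * (p + \<epsilon>)) \<le> cmod (W \<omega>)} \<le> \<eta>"
proof -
  have "\<forall>\<^sub>F n in sequentially. \<forall>W\<in>\<W> n. W \<in> borel_measurable M \<and>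
     integrable M (\<lambda>\<omega>. cmod (W \<omega>) powr r) \<and>
     expectation (\<lambda>\<omega>. cmod (W \<omega>) powr r) \<le> exp (real n * (r * (p + \<epsilon> / 2)))"
    using W \<epsilon> unfolding moment_rate_def by (auto dest!: spec[of _ "\<epsilon> / 2"])
  moreover have "\<forall>\<^sub>F n in sequentially. 1 / \<eta> \<le> exp (real n * (r * \<epsilon> / 2))"
    using r \<epsilon> by (intro eventually_const_le_exp) auto
  ultimately show ?thesis
  proof eventually_elim
    case (elim n)
    show ?case
    proof
      fix W assume "W \<in> \<W> n"
      with elim have W: "W \<in> borel_measurable M" "integrable M (\<lambda>\<omega>. cmod (W \<omega>) powr r)"
        "expectation (\<lambda>\<omega>. cmod (W \<omega>) powr r) \<le> exp (real n * (r * (p + \<epsilon> / 2)))" by auto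
      from prob_norm_ge_le[OF r W(2,3)]
      have "prob {\<omega>\<in>space M. exp (real n * (p + \<epsilon>)) \<le> cmod (W \<omega>)} \<le>
          exp (real n * (r * (p + \<epsilon> / 2)) - r * (real n * (p + \<epsilon>)))" by blast
      also have "real n * (r * (p + \<epsilon> / 2)) - r * (real n * (p + \<epsilon>)) = - (real n * (r * \<epsilon> / 2))"
        by (simp add: field_simps)
      also have "exp (- (real n * (r * \<epsilon> / 2))) \<le> \<eta>"
        using elim(2) \<eta> by (simp add: exp_minus field_simps)
      finally show "W \<in> borel_measurable M \<and>
        prob {\<omega>\<in>space M. exp (real n * (p + \<epsilon>)) \<le> cmod (W \<omega>)} \<le> \<eta>" using W by simp
    qed
  qed
qed

text \<open>On top of the rate p of W, the centred sum has the exponent (ln \<alpha> + (r * Re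
  \<beta>)^2 * a / 2) / r and the mean has ln \<alpha> + a * ((Re \<beta>)^2 - (Im \<beta>)^2) / 2;
  q has to dominate both. For r \<le> 1 nothing is centred and no mean appears.\<close>

lemma moment_rate_branching:
  fixes N :: "nat \<Rightarrow> nat"
  assumes N: "(\<lambda>n. real (N n) / \<alpha> ^ n) \<longlonglongrightarrow> 1" and \<alpha>: "\<alpha> > 1" and a: "a \<ge> 0"
    and W: "moment_rate M r p \<W>" and r: "0 < r" "r \<le> 2"
    and fluct: "ln \<alpha> + (r * Re \<beta>)\<^sup>2 * a / 2 \<le> r * q"
    and mean: "r > 1 \<Longrightarrow> ln \<alpha> + a * ((Re \<beta>)\<^sup>2 - (Im \<beta>)\<^sup>2) / 2 \<le> q"
  shows "moment_rate M r (q + p) (\<lambda>n. branching M (\<beta> * of_real (sqrt (real n * a))) (N n) (\<W> n))"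
  unfolding moment_rate_def
proof (intro allI impI)
  fix \<epsilon> :: real assume \<epsilon>: "\<epsilon> > 0"
  \<comment> \<open>The losses are \<delta> for the number of children, raised to the power r \<le>
    2 in the term of the mean, and \<delta> for the constant 400. They add up to at most 3 *
    \<delta>, against a reserve of r * \<epsilon> / 2.\<close>
  define \<delta> where "\<delta> = r * \<epsilon> / 8"
  have \<delta>: "\<delta> > 0" using r \<epsilon> by (simp add: \<delta>_def)
  have "\<forall>\<^sub>F n in sequentially. \<forall>W\<in>\<W> n. W \<in> borel_measurable M \<and>
     integrable M (\<lambda>\<omega>. cmod (W \<omega>) powr r) \<and>
     expectation (\<lambda>\<omega>. cmod (W \<omega>) powr r) \<le> exp (real n * (r * (p + \<epsilon> / 2)))"
    using W \<epsilon> unfolding moment_rate_def by (auto dest!: spec[of _ "\<epsilon> / 2"])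
  moreover note eventually_card_le_exp(1)[OF N \<alpha> \<delta>] eventually_const_le_exp[OF \<delta>, of 400]
  ultimately show "\<forall>\<^sub>F n in sequentially. \<forall>Z\<in>branching M (\<beta> * of_real (sqrt (real n * a))) (N n) (\<W> n).
     Z \<in> borel_measurable M \<and> integrable M (\<lambda>\<omega>. cmod (Z \<omega>) powr r) \<and>
     expectation (\<lambda>\<omega>. cmod (Z \<omega>) powr r) \<le> exp (real n * (r * (q + p + \<epsilon>)))"
  proof eventually_elim
    case (elim n)
    define b where "b = \<beta> * of_real (sqrt (real n * a))"
    define D where "D = exp (real n * (r * (p + \<epsilon> / 2)))"
    have D0: "D > 0" by (simp add: D_def)
    have E: "exp ((r * Re b)\<^sup>2 / 2) = exp (real n * ((r * Re \<beta>)\<^sup>2 * a / 2))"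
      unfolding b_def Re_scaled[OF a] ..
    have t1: "real (N n) * (exp ((r * Re b)\<^sup>2 / 2) * D) \<le> exp (real n * (r * (q + p + \<epsilon> / 2) + \<delta>))"
    proof -
      have "real (N n) * (exp ((r * Re b)\<^sup>2 / 2) * D) \<le>
          exp (real n * (ln \<alpha> + \<delta>)) * (exp (real n * ((r * Re \<beta>)\<^sup>2 * a / 2)) * D)"
        unfolding E using elim(2) D0 by (intro mult_right_mono) auto
      also have "\<dots> = exp (real n * (ln \<alpha> + (r * Re \<beta>)\<^sup>2 * a / 2 + \<delta> + r * (p + \<epsilon> / 2)))"
        by (simp add: D_def mult_exp_exp algebra_simps)
      also have "\<dots> \<le> exp (real n * (r * q + \<delta> + r * (p + \<epsilon> / 2)))"
        using fluct unfolding exp_le_cancel_iff by (intro mult_left_mono) auto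
      finally show ?thesis by (simp add: algebra_simps)
    qed
    show ?case
    proof
      fix Z assume "Z \<in> branching M (\<beta> * of_real (sqrt (real n * a))) (N n) (\<W> n)"
      then have Z: "Z \<in> branching M b (N n) (\<W> n)" by (simp add: b_def)
      have Zm: "Z \<in> borel_measurable M" using Z by (rule branchingE)
      show "Z \<in> borel_measurable M \<and> integrable M (\<lambda>\<omega>. cmod (Z \<omega>) powr r) \<and>
         expectation (\<lambda>\<omega>. cmod (Z \<omega>) powr r) \<le> exp (real n * (r * (q + p + \<epsilon>)))"
      proof (cases "r \<le> 1")
        case True
        note * = branching_moment_le_1[OF Z r(1) True, of D]
        have "expectation (\<lambda>\<omega>. cmod (Z \<omega>) powr r) \<le> real (N n) * (exp ((r * Re b)\<^sup>2 / 2) * D)"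
          using elim(1) by (intro *(2)) (auto simp: D_def)
        also note t1
        also have "exp (real n * (r * (q + p + \<epsilon> / 2) + \<delta>)) \<le> exp (real n * (r * (q + p + \<epsilon>)))"
          using r \<epsilon> unfolding exp_le_cancel_iff by (intro mult_left_mono) (auto simp: \<delta>_def algebra_simps)
        finally show ?thesis using *(1) Zm elim(1) by (auto simp: D_def)
      next
        case False
        then have r1: "1 < r" by simp
        have t2: "(real (N n) * cmod (exp (b\<^sup>2 / 2))) powr r * D \<le> exp (real n * (r * (q + p + \<epsilon> / 2) + r * \<delta>))"
        proof -
          have "real (N n) * cmod (exp (b\<^sup>2 / 2)) \<le> exp (real n * (ln \<alpha> + \<delta>)) * cmod (exp (b\<^sup>2 / 2))"
            using elim(2) by (intro mult_right_mono) auto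
          also have "\<dots> = exp (real n * (ln \<alpha> + a * ((Re \<beta>)\<^sup>2 - (Im \<beta>)\<^sup>2) / 2 + \<delta>))"
            unfolding b_def norm_exp_scaled[OF a] mult_exp_exp by (simp add: algebra_simps)
          also have "\<dots> \<le> exp (real n * (q + \<delta>))"
            using mean[OF r1] unfolding exp_le_cancel_iff by (intro mult_left_mono) auto
          finally have "(real (N n) * cmod (exp (b\<^sup>2 / 2))) powr r \<le> exp (real n * (q + \<delta>)) powr r"
            using r by (intro powr_mono2) auto
          then have "(real (N n) * cmod (exp (b\<^sup>2 / 2))) powr r * D \<le> exp (real n * (q + \<delta>)) powr r * D"
            using D0 by (intro mult_right_mono) auto
          also have "\<dots> = exp (real n * (r * (q + p + \<epsilon> / 2) + r * \<delta>))"
            by (simp add: exp_powr_real D_def mult_exp_exp algebra_simps)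
          finally show ?thesis .
        qed
        note * = branching_moment_gt_1[OF Z r1 r(2) _ _ _ D0]
        have "expectation (\<lambda>\<omega>. cmod (Z \<omega>) powr r) \<le>
            200 * (real (N n) * (exp ((r * Re b)\<^sup>2 / 2) * D) + (real (N n) * cmod (exp (b\<^sup>2 / 2))) powr r * D)"
          using elim(1) by (intro *(2)) (auto simp: D_def)
        also have "\<dots> \<le> 200 * (exp (real n * (r * (q + p + \<epsilon> / 2) + r * \<delta>)) + exp (real n * (r * (q + p + \<epsilon> / 2) + r * \<delta>)))"
        proof (intro mult_left_mono add_mono t2 order_trans[OF t1])
          have "1 * \<delta> \<le> r * \<delta>" using r1 \<delta> by (intro mult_right_mono) auto
          then show "exp (real n * (r * (q + p + \<epsilon> / 2) + \<delta>)) \<le> exp (real n * (r * (q + p + \<epsilon> / 2) + r * \<delta>))"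
            unfolding exp_le_cancel_iff by (intro mult_left_mono) auto
        qed auto
        also have "\<dots> = 400 * exp (real n * (r * (q + p + \<epsilon> / 2) + r * \<delta>))" by simp
        also have "\<dots> \<le> exp (real n * \<delta>) * exp (real n * (r * (q + p + \<epsilon> / 2) + r * \<delta>))"
          using elim(3) by (intro mult_right_mono) auto
        also have "\<dots> \<le> exp (real n * (r * (q + p + \<epsilon>)))"
        proof -
          have "r * \<delta> \<le> 2 * \<delta>" using r \<delta> by (intro mult_right_mono) auto
          moreover have "3 * \<delta> \<le> r * \<epsilon> / 2" using r \<epsilon> by (simp add: \<delta>_def)
          ultimately have "\<delta> + (r * (q + p + \<epsilon> / 2) + r * \<delta>) \<le> r * (q + p + \<epsilon>)"
            by (simp add: algebra_simps)
          then show ?thesis unfolding mult_exp_exp exp_le_cancel_iff distrib_left[symmetric]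
            by (intro mult_left_mono) auto
        qed
        finally show ?thesis using *(1) Zm elim(1) by (auto simp: D_def)
      qed
    qed
  qed
qed

text \<open>Means multiply exactly from level to level, so the only loss lies in counting the
  children. The moments of order r > 1 enter through integrability, which is why they are used with
  the arbitrary value 1 of \<epsilon>.\<close>

lemma mean_rate_branching:
  fixes N :: "nat \<Rightarrow> nat"
  assumes N: "(\<lambda>n. real (N n) / \<alpha> ^ n) \<longlonglongrightarrow> 1" and \<alpha>: "\<alpha> > 1" and a: "a \<ge> 0"
    and W: "moment_rate M r p' \<W>" "mean_rate M p \<W>" and r: "1 < r" "r \<le> 2"
  shows "mean_rate M (ln \<alpha> + a * ((Re \<beta>)\<^sup>2 - (Im \<beta>)\<^sup>2) / 2 + p)
    (\<lambda>n. branching M (\<beta> * of_real (sqrt (real n * a))) (N n) (\<W> n))"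
proof -
  define b where "b n = \<beta> * of_real (sqrt (real n * a))" for n
  define e where "e = ln \<alpha> + a * ((Re \<beta>)\<^sup>2 - (Im \<beta>)\<^sup>2) / 2"
  obtain \<mu> where \<mu>: "\<forall>\<^sub>F n in sequentially. \<forall>W\<in>\<W> n. integrable M W \<and> expectation W = \<mu> n"
    "\<And>\<epsilon>. \<epsilon> > 0 \<Longrightarrow> \<forall>\<^sub>F n in sequentially. exp (real n * (p - \<epsilon>)) \<le> cmod (\<mu> n)"
    using W(2) unfolding mean_rate_def by auto
  define \<nu> where "\<nu> n = of_nat (N n) * (exp ((b n)\<^sup>2 / 2) * \<mu> n)" for n
  have "\<forall>\<^sub>F n in sequentially. \<forall>W\<in>\<W> n. W \<in> borel_measurable M \<and>
     integrable M (\<lambda>\<omega>. cmod (W \<omega>) powr r) \<and>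
     expectation (\<lambda>\<omega>. cmod (W \<omega>) powr r) \<le> exp (real n * (r * (p' + 1)))"
    using W(1) unfolding moment_rate_def by (auto dest!: spec[of _ "1"])
  with \<mu>(1) have 1: "\<forall>\<^sub>F n in sequentially. \<forall>Z\<in>branching M (b n) (N n) (\<W> n). integrable M Z \<and> expectation Z = \<nu> n"
  proof eventually_elim
    case (elim n)
    show ?case
    proof
      fix Z assume Z: "Z \<in> branching M (b n) (N n) (\<W> n)"
      have W: "\<And>W. W \<in> \<W> n \<Longrightarrow> W \<in> borel_measurable M"
        "\<And>W. W \<in> \<W> n \<Longrightarrow> integrable M (\<lambda>\<omega>. cmod (W \<omega>) powr r)"
        "\<And>W. W \<in> \<W> n \<Longrightarrow> expectation (\<lambda>\<omega>. cmod (W \<omega>) powr r) \<le> exp (real n * (r * (p' + 1)))"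
        "\<And>W. W \<in> \<W> n \<Longrightarrow> expectation W = \<mu> n" using elim by blast+
      show "integrable M Z \<and> expectation Z = \<nu> n"
        unfolding \<nu>_def using branching_centred_moment(1,5)[OF Z r W(1,2,3) exp_gt_zero] W(4) by blast
    qed
  qed
  have 2: "\<forall>\<^sub>F n in sequentially. exp (real n * (e + p - \<epsilon>)) \<le> cmod (\<nu> n)" if \<epsilon>: "\<epsilon> > 0" for \<epsilon>
  proof -
    have e2: "\<epsilon> / 2 > 0" using \<epsilon> by simp
    show ?thesis
      using \<mu>(2)[OF e2] eventually_card_le_exp(2)[OF N \<alpha> e2]
    proof eventually_elim
      case (elim n)
      have "exp (real n * (e + p - \<epsilon>)) = exp (real n * (ln \<alpha> - \<epsilon> / 2)) *
          (exp (real n * (a * ((Re \<beta>)\<^sup>2 - (Im \<beta>)\<^sup>2) / 2)) * exp (real n * (p - \<epsilon> / 2)))"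
        by (simp add: mult_exp_exp e_def algebra_simps)
      also have "\<dots> \<le> real (N n) * (exp (real n * (a * ((Re \<beta>)\<^sup>2 - (Im \<beta>)\<^sup>2) / 2)) * cmod (\<mu> n))"
        using elim by (intro mult_mono) auto
      also have "\<dots> = cmod (\<nu> n)" by (simp add: \<nu>_def norm_mult norm_exp_scaled[OF a] b_def del: norm_exp_eq_Re)
      finally show ?case .
    qed
  qed
  show ?thesis unfolding mean_rate_def
    using 1[unfolded b_def] 2[unfolded e_def] by (intro exI[of _ \<nu>] conjI allI impI)
qed

text \<open>If |Z| is far below the modulus of its mean, the centred variable is about as large as
  the mean. By Markov's inequality for the r-th moment this has exponentially small probability,
  since \<open>less\<close> gives the fluctuations a strictly smaller exponent than the
  mean.\<close>

lemma lower_rate_branching_mean: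
  fixes N :: "nat \<Rightarrow> nat"
  assumes N: "(\<lambda>n. real (N n) / \<alpha> ^ n) \<longlonglongrightarrow> 1" and \<alpha>: "\<alpha> > 1" and a: "a \<ge> 0"
    and W: "moment_rate M r p \<W>" and r: "1 < r" "r \<le> 2"
    and Z: "mean_rate M (e + p) (\<lambda>n. branching M (\<beta> * of_real (sqrt (real n * a))) (N n) (\<W> n))"
    and less: "ln \<alpha> + (r * Re \<beta>)\<^sup>2 * a / 2 < r * e"
  shows "lower_rate M (e + p) (\<lambda>n. branching M (\<beta> * of_real (sqrt (real n * a))) (N n) (\<W> n))"
  unfolding lower_rate_def
proof (intro allI impI)
  fix \<epsilon> \<eta> :: real assume \<epsilon>: "\<epsilon> > 0" and \<eta>: "\<eta> > 0"
  define g where "g = r * e - (ln \<alpha> + (r * Re \<beta>)\<^sup>2 * a / 2)"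
  have g: "g > 0" using less by (simp add: g_def)
  \<comment> \<open>Markov's inequality will produce the exponent \<delta> + 3 * r * \<delta> - g
    per unit of n. As r \<le> 2, the bound 14 * \<delta> \<le> g makes it at most - g / 2.\<close>
  define \<delta> where "\<delta> = min (\<epsilon> / 2) (g / 14)"
  have \<delta>: "\<delta> > 0" "\<delta> \<le> \<epsilon> / 2" "14 * \<delta> \<le> g" using \<epsilon> g by (auto simp: \<delta>_def)
  obtain \<mu> where \<mu>: "\<forall>\<^sub>F n in sequentially. \<forall>Z\<in>branching M (\<beta> * of_real (sqrt (real n * a))) (N n) (\<W> n).
      integrable M Z \<and> expectation Z = \<mu> n"
    "\<And>\<epsilon>. \<epsilon> > 0 \<Longrightarrow> \<forall>\<^sub>F n in sequentially. exp (real n * (e + p - \<epsilon>)) \<le> cmod (\<mu> n)"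
    using Z unfolding mean_rate_def by auto
  have "\<forall>\<^sub>F n in sequentially. \<forall>W\<in>\<W> n. W \<in> borel_measurable M \<and>
     integrable M (\<lambda>\<omega>. cmod (W \<omega>) powr r) \<and>
     expectation (\<lambda>\<omega>. cmod (W \<omega>) powr r) \<le> exp (real n * (r * (p + \<delta>)))"
    using W \<delta> unfolding moment_rate_def by auto
  moreover note eventually_card_le_exp(1)[OF N \<alpha> \<delta>(1)] eventually_const_le_exp[OF \<delta>(1), of 2] \<mu>(1) \<mu>(2)[OF \<delta>(1)]
  moreover have "\<forall>\<^sub>F n in sequentially. 48 / \<eta> \<le> exp (real n * (g / 2))"
    using g by (intro eventually_const_le_exp) auto
  ultimately show "\<forall>\<^sub>F n in sequentially. \<forall>Z\<in>branching M (\<beta> * of_real (sqrt (real n * a))) (N n) (\<W> n).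
     Z \<in> borel_measurable M \<and> prob {\<omega>\<in>space M. cmod (Z \<omega>) \<le> exp (real n * (e + p - \<epsilon>))} \<le> \<eta>"
  proof eventually_elim
    case (elim n)
    define b where "b = \<beta> * of_real (sqrt (real n * a))"
    define D where "D = exp (real n * (r * (p + \<delta>)))"
    have D0: "D > 0" by (simp add: D_def)
    show ?case
    proof
      fix Z assume Z0: "Z \<in> branching M (\<beta> * of_real (sqrt (real n * a))) (N n) (\<W> n)"
      then have Z: "Z \<in> branching M b (N n) (\<W> n)" by (simp add: b_def)
      have Zm[measurable]: "Z \<in> borel_measurable M" using Z by (rule branchingE)
      have EZ: "exp (real n * (e + p - \<delta>)) \<le> cmod (expectation Z)"
        using elim(4)[rule_format, OF Z0] elim(5) by simp
      define U where "U \<omega> = Z \<omega> - expectation Z" for \<omega>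
      have [measurable]: "U \<in> borel_measurable M" unfolding U_def by measurable
      note * = branching_centred_moment[OF Z r _ _ _ D0, folded U_def]
      have iU: "integrable M (\<lambda>\<omega>. cmod (U \<omega>) powr r)" using elim(1) by (intro *(2)) (auto simp: D_def)
      have "expectation (\<lambda>\<omega>. cmod (U \<omega>) powr r) \<le> 48 * (real (N n) * (exp ((r * Re b)\<^sup>2 / 2) * D))"
        using elim(1) by (intro *(3)) (auto simp: D_def)
      also have "\<dots> \<le> 48 * (exp (real n * (ln \<alpha> + \<delta>)) * (exp (real n * ((r * Re \<beta>)\<^sup>2 * a / 2)) * D))"
        unfolding b_def Re_scaled[OF a] using elim(2) D0 by (intro mult_left_mono mult_right_mono) auto
      also have "\<dots> = exp (ln 48 + real n * (ln \<alpha> + (r * Re \<beta>)\<^sup>2 * a / 2 + \<delta> + r * (p + \<delta>)))"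
      proof -
        have "48 * (exp x * (exp y * exp z)) = exp (ln 48 + (x + y + z))" for x y z :: real
          by (simp add: exp_add)
        then show ?thesis unfolding D_def by (simp add: distrib_left add_ac)
      qed
      finally have m: "expectation (\<lambda>\<omega>. cmod (U \<omega>) powr r) \<le> \<dots>" .
      have sub: "{\<omega>\<in>space M. cmod (Z \<omega>) \<le> exp (real n * (e + p - \<epsilon>))} \<subseteq>
          {\<omega>\<in>space M. exp (real n * (e + p - 2 * \<delta>)) \<le> cmod (U \<omega>)}"
      proof safe
        fix \<omega> assume "cmod (Z \<omega>) \<le> exp (real n * (e + p - \<epsilon>))"
        also have "\<dots> \<le> exp (real n * (e + p - 2 * \<delta>))"
          using \<delta> unfolding exp_le_cancel_iff by (intro mult_left_mono) auto
        finally have 1: "cmod (Z \<omega>) \<le> exp (real n * (e + p - 2 * \<delta>))" .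
        have "2 * exp (real n * (e + p - 2 * \<delta>)) \<le> exp (real n * \<delta>) * exp (real n * (e + p - 2 * \<delta>))"
          using elim(3) by (intro mult_right_mono) auto
        also have "\<dots> = exp (real n * (e + p - \<delta>))" by (simp add: mult_exp_exp algebra_simps)
        finally have "2 * exp (real n * (e + p - 2 * \<delta>)) \<le> cmod (expectation Z)" using EZ by simp
        also have "\<dots> \<le> cmod (Z \<omega>) + cmod (U \<omega>)"
          unfolding U_def using norm_triangle_ineq4[of "Z \<omega>" "Z \<omega> - expectation Z"] by simp
        finally show "exp (real n * (e + p - 2 * \<delta>)) \<le> cmod (U \<omega>)" using 1 by simp
      qed
      have "prob {\<omega>\<in>space M. cmod (Z \<omega>) \<le> exp (real n * (e + p - \<epsilon>))} \<le>
          prob {\<omega>\<in>space M. exp (real n * (e + p - 2 * \<delta>)) \<le> cmod (U \<omega>)}"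
        by (rule finite_measure_mono[OF sub]) measurable
      also have "\<dots> \<le> exp (ln 48 + real n * (ln \<alpha> + (r * Re \<beta>)\<^sup>2 * a / 2 + \<delta> + r * (p + \<delta>))
          - r * (real n * (e + p - 2 * \<delta>)))"
        using r by (intro prob_norm_ge_le[OF _ iU m]) auto
      also have "\<dots> = exp (ln 48 + real n * (\<delta> + 3 * r * \<delta> - g))"
        by (rule arg_cong[where f = exp]) (simp add: g_def algebra_simps)
      also have "\<dots> \<le> exp (ln 48 + real n * (- (g / 2)))"
      proof -
        have "3 * r * \<delta> \<le> 6 * \<delta>" using r \<delta> by (intro mult_right_mono) auto
        then have "\<delta> + 3 * r * \<delta> - g \<le> - (g / 2)" using \<delta> by linarith
        then show ?thesis unfolding exp_le_cancel_iff by (intro add_left_mono mult_left_mono) auto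
      qed
      also have "\<dots> = 48 / exp (real n * (g / 2))"
      proof -
        have "exp (ln 48 + - x) = 48 / exp x" for x :: real
          by (subst exp_add) (simp add: exp_minus divide_inverse)
        then show ?thesis by (metis mult_minus_right)
      qed
      also have "\<dots> \<le> \<eta>" using elim(6) \<eta> by (simp add: field_simps)
      finally show "Z \<in> borel_measurable M \<and> prob {\<omega>\<in>space M. cmod (Z \<omega>) \<le> exp (real n * (e + p - \<epsilon>))} \<le> \<eta>"
        using Zm by simp
    qed
  qed
qed

end

section \<open>The lower bound by anti-concentration\<close>

context prob_space
begin

text \<open>It suffices to bound |Re Z| \<le> l. The characteristic function of Re Z is a product of
  N factors, each at most 1 - q * t^2 \<le> exp (- q * t^2) while t stays within
  \<open>char_radius\<close>, and at most 1 beyond. T compares the largest relevant summand near x0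
  with l; up to constants, \<kappa> compares the variance carried by the window at x0 with
  l^2.\<close>

lemma branching_concentration:
  assumes Z: "Z \<in> branching M (\<beta> * of_real c) N \<W>"
    and c: "c > 0" and \<beta>: "Re \<beta> \<ge> 0"
    and real: "Im \<beta> \<noteq> 0 \<or> (\<forall>W\<in>\<W>. \<forall>\<omega>. Im (W \<omega>) = 0)"
    and x0: "x0 \<ge> 0" and h: "h = half_turn \<beta> / c"
    and A: "0 < A" and half: "\<And>W. W \<in> \<W> \<Longrightarrow> prob {\<omega>\<in>space M. A \<le> cmod (W \<omega>) \<and> cmod (W \<omega>) \<le> B} \<ge> 1/2"
    and l: "l > 0"
    and \<kappa>: "\<kappa> = real N * (std_normal_density (x0 + 2 * h) * h * char_decay \<beta> * exp (2 * Re \<beta> * c * x0)) * (A / l)\<^sup>2 / 2"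
    and T: "T = B * exp (Re \<beta> * c * x0) / l"
  shows "prob {\<omega>\<in>space M. cmod (Z \<omega>) \<le> l} \<le> exp (1/2) *
    (LINT t|std_normal_distribution. (if \<bar>t\<bar> * T \<le> char_radius \<beta> then exp (- (\<kappa> * t\<^sup>2)) else 1))"
proof -
  define b where "b t = (if \<bar>t\<bar> * T \<le> char_radius \<beta> then exp (- (\<kappa> * t\<^sup>2)) else 1)" for t :: real
  from Z obtain X W where *: "\<And>i. i \<in> {1..N} \<Longrightarrow> W i \<in> \<W>"
    "\<And>i. i \<in> {1..N} \<Longrightarrow> distributed M lborel (X i) std_normal_density"
    "\<And>i. i \<in> {1..N} \<Longrightarrow> indep_var borel (\<lambda>\<omega>. complex_of_real (X i \<omega>)) borel (W i)"
    "indep_vars (\<lambda>_. borel) (\<lambda>i \<omega>. exp (\<beta> * of_real c * of_real (X i \<omega>)) * W i \<omega>) {1..N}"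
    "Z = (\<lambda>\<omega>. \<Sum>i=1..N. exp (\<beta> * of_real c * of_real (X i \<omega>)) * W i \<omega>)"
    and [measurable]: "Z \<in> borel_measurable M" by (rule branchingE) (rule that)
  define Y where "Y i \<omega> = exp (\<beta> * of_real c * of_real (X i \<omega>)) * W i \<omega>" for i \<omega>
  have ZY: "Z \<omega> = (\<Sum>i=1..N. Y i \<omega>)" for \<omega> by (simp add: *(5) Y_def)
  have h0: "h > 0" using h c half_turn_pos[of \<beta>] by simp
  define q where "q = std_normal_density (x0 + 2 * h) * h * char_decay \<beta> * exp (2 * Re \<beta> * c * x0) * (A / l)\<^sup>2 / 2"
  have q0: "q \<ge> 0" using h0 by (simp add: q_def char_decay_def)
  have \<kappa>q: "\<kappa> = real N * q" by (simp add: \<kappa> q_def)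
  have bnd: "cmod (expectation (\<lambda>\<omega>. cis (t / l * Re (Z \<omega>)))) \<le> b t" for t
  proof -
    have ind: "indep_vars (\<lambda>_. borel) (\<lambda>i \<omega>. cis (t / l * Re (Y i \<omega>))) {1..N}"
      unfolding Y_def by (rule indep_vars_compose2[OF *(4)]) (auto simp: cis_conv_exp)
    have int: "integrable M (\<lambda>\<omega>. cis (t / l * Re (Y i \<omega>)))" if "i \<in> {1..N}" for i
    proof -
      have m: "(\<lambda>\<omega>. cis (t / l * Re (Y i \<omega>))) \<in> borel_measurable M"
        using ind that unfolding indep_vars_def by blast
      show ?thesis by (rule integrable_const_bound[OF _ m, of 1]) simp
    qed
    have prodE: "expectation (\<lambda>\<omega>. cis (t / l * Re (Z \<omega>))) = (\<Prod>i=1..N. expectation (\<lambda>\<omega>. cis (t / l * Re (Y i \<omega>))))"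
    proof -
      have "cis (t / l * Re (Z \<omega>)) = (\<Prod>i=1..N. cis (t / l * Re (Y i \<omega>)))" for \<omega>
      proof -
        have "cis (\<Sum>i\<in>I. f i) = (\<Prod>i\<in>I. cis (f i))" if "finite I" for I :: "nat set" and f
          using that by (induction I rule: finite_induct) (simp_all flip: cis_mult)
        then show ?thesis unfolding ZY Re_sum sum_distrib_left by simp
      qed
      then show ?thesis using indep_vars_lebesgue_integral[OF _ ind int] by simp
    qed
    have norm1: "cmod (expectation (\<lambda>\<omega>. cis (t / l * Re (Y i \<omega>)))) \<le> 1" if "i \<in> {1..N}" for i
    proof -
      have "cmod (expectation (\<lambda>\<omega>. cis (t / l * Re (Y i \<omega>)))) \<le> expectation (\<lambda>\<omega>. cmod (cis (t / l * Re (Y i \<omega>))))"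
        by (rule integral_norm_bound)
      then show ?thesis by (simp add: prob_space)
    qed
    show ?thesis
    proof (cases "\<bar>t\<bar> * T \<le> char_radius \<beta>")
      case False
      have "cmod (expectation (\<lambda>\<omega>. cis (t / l * Re (Z \<omega>)))) \<le> (\<Prod>i=1..N. 1)"
        unfolding prodE prod_norm[symmetric] by (intro prod_mono) (use norm1 in auto)
      then show ?thesis using False by (simp add: b_def)
    next
      case True
      have t: "\<bar>t / l\<bar> * B * exp (Re \<beta> * c * x0) \<le> char_radius \<beta>"
        using True l by (simp add: T abs_divide)
      have "cmod (expectation (\<lambda>\<omega>. cis (t / l * Re (Y i \<omega>)))) \<le> exp (- (q * t\<^sup>2))" if i: "i \<in> {1..N}" for i
      proof -
        have "cmod (expectation (\<lambda>\<omega>. cis (t / l * Re (Y i \<omega>)))) \<le>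
          1 - std_normal_density (x0 + 2 * h) * h * char_decay \<beta> * (t / l * A)\<^sup>2 * exp (2 * Re \<beta> * c * x0) / 2"
          unfolding Y_def
          by (rule normal_times_indep_char[OF *(2,3)[OF i] c \<beta> _ x0 h A half[OF *(1)[OF i]] t])
             (use real *(1)[OF i] in auto)
        also have "\<dots> = 1 + - (q * t\<^sup>2)"
          by (simp add: q_def power_mult_distrib power_divide)
        also have "\<dots> \<le> exp (- (q * t\<^sup>2))" by (rule exp_ge_add_one_self)
        finally show ?thesis .
      qed
      then have "(\<Prod>i=1..N. cmod (expectation (\<lambda>\<omega>. cis (t / l * Re (Y i \<omega>))))) \<le> (\<Prod>i=1..N. exp (- (q * t\<^sup>2)))"
        by (intro prod_mono) auto
      also have "\<dots> = exp (- (\<kappa> * t\<^sup>2))" by (simp add: \<kappa>q exp_of_nat_mult[symmetric] mult.assoc)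
      finally show ?thesis using True unfolding prodE prod_norm by (simp add: b_def)
    qed
  qed
  have "prob {\<omega>\<in>space M. cmod (Z \<omega>) \<le> l} \<le> prob {\<omega>\<in>space M. \<bar>Re (Z \<omega>)\<bar> \<le> l}"
    by (rule finite_measure_mono) (auto intro: order_trans[OF abs_Re_le_cmod])
  also have "\<dots> \<le> exp (1/2) * (LINT t|std_normal_distribution. b t)"
  proof (rule concentration_le_char[OF _ l _ _ _ bnd])
    show "b t \<le> 1" "b t \<ge> 0" for t using q0 by (auto simp: b_def \<kappa>q)
    show "b \<in> borel_measurable borel" unfolding b_def by measurable
  qed measurable
  finally show ?thesis by (simp only: b_def)
qed

text \<open>With l slightly below the fluctuation scale, T tends to 0 and \<kappa> to infinity. The
  integrand of the concentration bound then tends to 0 for every t \<noteq> 0, and dominated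
  convergence concludes. The hypothesis \<open>q\<close> offers points y whose exponent comes
  arbitrarily close to q; the strict inequality y < s keeps the number of children near y
  exponentially large, so that no single summand there reaches the scale l.\<close>

lemma lower_rate_branching_fluct:
  fixes N :: "nat \<Rightarrow> nat"
  assumes N: "(\<lambda>n. real (N n) / \<alpha> ^ n) \<longlonglongrightarrow> 1" and \<alpha>: "\<alpha> > 1" and a: "a > 0" and s: "ln \<alpha> = a * s\<^sup>2 / 2"
    and \<beta>: "Re \<beta> \<ge> 0" "Im \<beta> \<noteq> 0 \<or> Re \<beta> > 0 \<and> (\<forall>n. \<forall>W\<in>\<W> n. \<forall>\<omega>. Im (W \<omega>) = 0)"
    and W: "moment_rate M r p \<W>" "r > 0" "lower_rate M p \<W>"
    and q: "\<And>\<epsilon>. \<epsilon> > 0 \<Longrightarrow> \<exists>y\<ge>0. y < s \<and> q - \<epsilon> \<le> a * (s\<^sup>2 - y\<^sup>2) / 4 + a * Re \<beta> * y"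
  shows "lower_rate M (q + p) (\<lambda>n. branching M (\<beta> * of_real (sqrt (real n * a))) (N n) (\<W> n))"
  unfolding lower_rate_def
proof (intro allI impI)
  fix \<epsilon> \<eta> :: real assume \<epsilon>: "\<epsilon> > 0" and \<eta>: "\<eta> > 0"
  obtain y where y: "y \<ge> 0" "y < s" "q - \<epsilon> / 2 \<le> a * (s\<^sup>2 - y\<^sup>2) / 4 + a * Re \<beta> * y"
    using q[of "\<epsilon> / 2"] \<epsilon> by auto
  \<comment> \<open>Half of the exponential rate of the number of children with value near y * sqrt
    (n * a): this is the square-root cancellation. R below is the resulting exponent of the
    fluctuations of Z relative to W.\<close>
  define g where "g = a * (s\<^sup>2 - y\<^sup>2) / 4"
  have "y\<^sup>2 < s\<^sup>2" using y by (intro power_strict_mono) auto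
  then have g: "g > 0" using a by (simp add: g_def)
  \<comment> \<open>A and B enclose |W| up to \<delta> in the exponent, and l lies 4 * \<delta>
    below the scale R + p. Thus T decays at rate g - 5 * \<delta> > 0 and \<kappa> grows at rate 6 *
    \<delta>, while l still exceeds the target because 4 * \<delta> \<le> \<epsilon> / 2.\<close>
  define \<delta> where "\<delta> = min (\<epsilon> / 8) (g / 10)"
  have \<delta>: "\<delta> > 0" "8 * \<delta> \<le> \<epsilon>" "10 * \<delta> \<le> g" using \<epsilon> g by (auto simp: \<delta>_def)
  define R where "R = g + a * Re \<beta> * y"
  define c where "c n = sqrt (real n * a)" for n
  define h where "h n = half_turn \<beta> / c n" for n
  define A where "A n = exp (real n * (p - \<delta>))" for n
  define B where "B n = exp (real n * (p + \<delta>))" for n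
  define l where "l n = exp (real n * (R + p - 4 * \<delta>))" for n
  define T where "T n = B n * exp (Re \<beta> * c n * (y * c n)) / l n" for n
  define \<kappa> where "\<kappa> n = real (N n) * (std_normal_density (y * c n + 2 * h n) * h n * char_decay \<beta>
      * exp (2 * Re \<beta> * c n * (y * c n))) * (A n / l n)\<^sup>2 / 2" for n
  have cc: "c n * (y * c n) = real n * (a * y)" for n
    using a by (simp add: c_def algebra_simps)
  have T_eq: "T n = exp (- (real n * (g - 5 * \<delta>)))" for n
  proof -
    have "Re \<beta> * c n * (y * c n) = real n * (Re \<beta> * (a * y))" by (simp only: mult.assoc cc) (simp add: algebra_simps)
    then have "T n = exp (real n * (p + \<delta>) + real n * (Re \<beta> * (a * y)) - real n * (R + p - 4 * \<delta>))"
      unfolding T_def B_def l_def by (simp only: mult_exp_exp exp_diff)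
    also have "real n * (p + \<delta>) + real n * (Re \<beta> * (a * y)) - real n * (R + p - 4 * \<delta>) = - (real n * (g - 5 * \<delta>))"
      by (simp add: R_def algebra_simps)
    finally show ?thesis .
  qed
  have T0: "T \<longlonglongrightarrow> 0"
  proof -
    have "g - 5 * \<delta> > 0" using \<delta> g by linarith
    then show ?thesis unfolding T_eq[abs_def] by real_asymp
  qed
  \<comment> \<open>k1 and k2 / n come from evaluating the density at 2 * h beyond y * c n; they
    stay bounded since h is of order 1 / sqrt n. The factor h of \<kappa> is also the source of the
    1 / sqrt n next to K.\<close>
  define k1 k2 K where "k1 = 2 * y * half_turn \<beta>" and "k2 = 2 * (half_turn \<beta>)\<^sup>2 / a"
    and "K = half_turn \<beta> * char_decay \<beta> / (2 * sqrt (2 * pi) * sqrt a)"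
  have \<kappa>_eq: "\<kappa> n = (real (N n) / \<alpha> ^ n) * (K * exp (real n * (6 * \<delta>) - k1 - k2 / real n) / sqrt (real n))"
    if n: "n > 0" for n
  proof -
    have c0: "c n > 0" using n a by (simp add: c_def)
    have c2: "(c n)\<^sup>2 = real n * a" using a by (simp add: c_def)
    have "(y * c n + 2 * h n)\<^sup>2 / 2 = y\<^sup>2 * (c n)\<^sup>2 / 2 + k1 + 2 * (half_turn \<beta>)\<^sup>2 / (c n)\<^sup>2"
      using c0 by (simp add: h_def k1_def power2_eq_square field_simps)
    also have "\<dots> = real n * (a * y\<^sup>2 / 2) + k1 + k2 / real n"
      unfolding c2 k2_def using n a by (simp add: field_simps)
    finally have 1: "std_normal_density (y * c n + 2 * h n) =
        exp (- (real n * (a * y\<^sup>2 / 2) + k1 + k2 / real n)) / sqrt (2 * pi)"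
      by (simp add: std_normal_density_def)
    have 2: "exp (2 * Re \<beta> * c n * (y * c n)) = exp (real n * (2 * Re \<beta> * a * y))"
      by (simp only: mult.assoc cc) (simp add: algebra_simps)
    have 3: "(A n / l n)\<^sup>2 = exp (real n * (6 * \<delta> - 2 * R))"
      unfolding A_def l_def exp_diff[symmetric] exp_double[symmetric] by (simp add: algebra_simps)
    have 4: "\<alpha> ^ n = exp (real n * (a * s\<^sup>2 / 2))"
      using \<alpha> by (simp add: s[symmetric] exp_of_nat_mult)
    have "exp (- (real n * (a * y\<^sup>2 / 2) + k1 + k2 / real n)) * exp (real n * (2 * Re \<beta> * a * y)) *
        exp (real n * (6 * \<delta> - 2 * R)) =
      exp (real n * (6 * \<delta>) - k1 - k2 / real n) / exp (real n * (a * s\<^sup>2 / 2))"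
      unfolding mult_exp_exp exp_diff[symmetric]
      by (rule arg_cong[where f = exp]) (simp add: R_def g_def field_simps)
    then have 5: "exp (- (real n * (a * y\<^sup>2 / 2) + k1 + k2 / real n)) * exp (real n * (2 * Re \<beta> * a * y)) *
        exp (real n * (6 * \<delta> - 2 * R)) = exp (real n * (6 * \<delta>) - k1 - k2 / real n) / \<alpha> ^ n"
      unfolding 4 .
    have "\<kappa> n = real (N n) * (h n * char_decay \<beta> / (2 * sqrt (2 * pi))) *
       (exp (- (real n * (a * y\<^sup>2 / 2) + k1 + k2 / real n)) * exp (real n * (2 * Re \<beta> * a * y)) *
        exp (real n * (6 * \<delta> - 2 * R)))"
      unfolding \<kappa>_def 1 2 3 by (simp add: algebra_simps)
    also have "\<dots> = real (N n) * (h n * char_decay \<beta> / (2 * sqrt (2 * pi))) *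
        (exp (real n * (6 * \<delta>) - k1 - k2 / real n) / \<alpha> ^ n)"
      unfolding 5 ..
    also have "h n * char_decay \<beta> / (2 * sqrt (2 * pi)) = K / sqrt (real n)"
      by (simp add: h_def K_def c_def real_sqrt_mult)
    finally show ?thesis by (simp add: mult_ac)
  qed
  \<comment> \<open>This rests on \<beta> \<noteq> 0, by which \<open>half_turn_factor\<close>
    differs from 1.\<close>
  have K0: "K > 0"
    using half_turn_factor_neq_1[of \<beta>] \<beta> half_turn_pos[of \<beta>] a
    by (auto simp: K_def char_decay_def intro!: divide_pos_pos mult_pos_pos)
  have "filterlim (\<lambda>n. (real (N n) / \<alpha> ^ n) * (K * exp (real n * (6 * \<delta>) - k1 - k2 / real n) / sqrt (real n)))
      at_top sequentially"
  proof (rule filterlim_tendsto_pos_mult_at_top[OF N])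
    show "filterlim (\<lambda>n. K * exp (real n * (6 * \<delta>) - k1 - k2 / real n) / sqrt (real n)) at_top sequentially"
      using K0 \<delta>(1) by real_asymp
  qed simp
  moreover have "\<forall>\<^sub>F n in sequentially. (real (N n) / \<alpha> ^ n) * (K * exp (real n * (6 * \<delta>) - k1 - k2 / real n) / sqrt (real n)) = \<kappa> n"
    using eventually_gt_at_top[of 0] by eventually_elim (rule \<kappa>_eq[symmetric])
  ultimately have \<kappa>_lim: "filterlim \<kappa> at_top sequentially"
    by (rule filterlim_cong[OF refl refl, THEN iffD1, rotated])
  define b where "b n t = (if \<bar>t\<bar> * T n \<le> char_radius \<beta> then exp (- (\<kappa> n * t\<^sup>2)) else 1)" for n t
  have blim: "(\<lambda>n. LINT t|std_normal_distribution. b n t) \<longlonglongrightarrow> (LINT t|std_normal_distribution. (0::real))"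
  proof (rule integral_dominated_convergence[where w = "\<lambda>_. 1"])
    interpret N: prob_space std_normal_distribution by (rule prob_space_normal_density) simp
    show "integrable std_normal_distribution (\<lambda>_. 1 :: real)" by simp
    show "b n \<in> borel_measurable std_normal_distribution" for n unfolding b_def by measurable
    have \<kappa>0: "\<kappa> n \<ge> 0" for n
      unfolding \<kappa>_def h_def c_def using half_turn_pos[of \<beta>] a
      by (auto simp: char_decay_def intro!: mult_nonneg_nonneg divide_nonneg_nonneg)
    show "AE t in std_normal_distribution. norm (b n t) \<le> 1" for n
      using \<kappa>0 by (auto simp: b_def)
    \<comment> \<open>At t = 0 the integrand equals 1 for every n, so that the convergence holds
      only almost everywhere.\<close>
    have "AE t in lborel. t \<noteq> (0::real)" by (rule AE_lborel_singleton)
    then have "AE t in std_normal_distribution. t \<noteq> 0" by (subst AE_density) auto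
    then show "AE t in std_normal_distribution. (\<lambda>n. b n t) \<longlonglongrightarrow> 0"
    proof eventually_elim
      case (elim t)
      have "(\<lambda>n. \<bar>t\<bar> * T n) \<longlonglongrightarrow> \<bar>t\<bar> * 0" by (intro tendsto_intros T0)
      then have "\<forall>\<^sub>F n in sequentially. \<bar>t\<bar> * T n < char_radius \<beta>"
        by (rule order_tendstoD) (simp add: char_radius_pos)
      then have "\<forall>\<^sub>F n in sequentially. exp (- (\<kappa> n * t\<^sup>2)) = b n t"
        by eventually_elim (simp add: b_def)
      moreover have "(\<lambda>n. exp (- (\<kappa> n * t\<^sup>2))) \<longlonglongrightarrow> 0"
      proof -
        have "filterlim (\<lambda>n. \<kappa> n * t\<^sup>2) at_top sequentially"
          using elim by (intro filterlim_at_top_mult_tendsto_pos[OF tendsto_const _ \<kappa>_lim]) auto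
        then have "filterlim (\<lambda>n. - (\<kappa> n * t\<^sup>2)) at_bot sequentially"
          by (simp add: filterlim_uminus_at_top)
        then show ?thesis by (rule filterlim_compose[OF exp_at_bot])
      qed
      ultimately show ?case by (rule Lim_transform_eventually[rotated])
    qed
  qed simp
  have "(\<lambda>n. exp (1/2) * (LINT t|std_normal_distribution. b n t)) \<longlonglongrightarrow> exp (1/2) * 0"
    using blim by (intro tendsto_intros) simp
  then have small: "\<forall>\<^sub>F n in sequentially. exp (1/2) * (LINT t|std_normal_distribution. b n t) < \<eta>"
    by (rule order_tendstoD) (use \<eta> in simp)
  have lowW: "\<forall>\<^sub>F n in sequentially. \<forall>W\<in>\<W> n. W \<in> borel_measurable M \<and>
      prob {\<omega>\<in>space M. cmod (W \<omega>) \<le> exp (real n * (p - \<delta>))} \<le> 1/4"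
    using W(3)[unfolded lower_rate_def, rule_format, of \<delta> "1/4"] \<delta>(1) by simp
  have upW: "\<forall>\<^sub>F n in sequentially. \<forall>W\<in>\<W> n. W \<in> borel_measurable M \<and>
      prob {\<omega>\<in>space M. exp (real n * (p + \<delta>)) \<le> cmod (W \<omega>)} \<le> 1/4"
    using \<delta>(1) by (intro moment_rate_upper[OF W(1,2)]) auto
  show "\<forall>\<^sub>F n in sequentially. \<forall>Z\<in>branching M (\<beta> * of_real (sqrt (real n * a))) (N n) (\<W> n).
     Z \<in> borel_measurable M \<and> prob {\<omega>\<in>space M. cmod (Z \<omega>) \<le> exp (real n * (q + p - \<epsilon>))} \<le> \<eta>"
    using small lowW upW eventually_gt_at_top[of 0]
  proof eventually_elim
    case (elim n)
    show ?case
    proof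
      fix Z assume Z: "Z \<in> branching M (\<beta> * of_real (sqrt (real n * a))) (N n) (\<W> n)"
      have Zm[measurable]: "Z \<in> borel_measurable M" using Z by (rule branchingE)
      have half: "1/2 \<le> prob {\<omega>\<in>space M. A n \<le> cmod (W \<omega>) \<and> cmod (W \<omega>) \<le> B n}" if "W \<in> \<W> n" for W
      proof -
        have [measurable]: "W \<in> borel_measurable M" using elim that by auto
        have "prob (space M) \<le> prob ({\<omega>\<in>space M. A n \<le> cmod (W \<omega>) \<and> cmod (W \<omega>) \<le> B n} \<union>
          ({\<omega>\<in>space M. cmod (W \<omega>) \<le> A n} \<union> {\<omega>\<in>space M. B n \<le> cmod (W \<omega>)}))"
          by (intro finite_measure_mono) (auto, measurable)
        also have "\<dots> \<le> prob {\<omega>\<in>space M. A n \<le> cmod (W \<omega>) \<and> cmod (W \<omega>) \<le> B n} +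
            (prob {\<omega>\<in>space M. cmod (W \<omega>) \<le> A n} + prob {\<omega>\<in>space M. B n \<le> cmod (W \<omega>)})"
          by (intro order_trans[OF measure_Un_le] add_left_mono) measurable
        also have "\<dots> \<le> prob {\<omega>\<in>space M. A n \<le> cmod (W \<omega>) \<and> cmod (W \<omega>) \<le> B n} + (1/4 + 1/4)"
          using elim(2,3) that by (intro add_left_mono add_mono) (auto simp: A_def B_def)
        finally show ?thesis by (simp add: prob_space)
      qed
      have "prob {\<omega>\<in>space M. cmod (Z \<omega>) \<le> exp (real n * (q + p - \<epsilon>))} \<le> prob {\<omega>\<in>space M. cmod (Z \<omega>) \<le> l n}"
      proof (intro finite_measure_mono)
        have "real n * (q + p - \<epsilon>) \<le> real n * (R + p - 4 * \<delta>)"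
          using y(3) \<delta> by (intro mult_left_mono) (auto simp: R_def g_def)
        then have "exp (real n * (q + p - \<epsilon>)) \<le> l n" by (simp add: l_def)
        then show "{\<omega>\<in>space M. cmod (Z \<omega>) \<le> exp (real n * (q + p - \<epsilon>))} \<subseteq> {\<omega>\<in>space M. cmod (Z \<omega>) \<le> l n}"
          by auto
      qed measurable
      also have "\<dots> \<le> exp (1/2) * (LINT t|std_normal_distribution. b n t)"
        unfolding b_def
      proof (rule branching_concentration[OF Z[folded c_def] _ \<beta>(1) _ _ h_def _ half _ \<kappa>_def T_def])
        show "c n > 0" using elim a by (simp add: c_def)
        then show "0 \<le> y * c n" using y by simp
      qed (use \<beta>(2) in \<open>auto simp: A_def l_def\<close>)
      also have "\<dots> \<le> \<eta>" using elim by simp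
      finally show "Z \<in> borel_measurable M \<and>
          prob {\<omega>\<in>space M. cmod (Z \<omega>) \<le> exp (real n * (q + p - \<epsilon>))} \<le> \<eta>"
        using Zm by simp
    qed
  qed
qed

end

section \<open>Phases\<close>

definition fluct_dominates :: "real \<Rightarrow> complex \<Rightarrow> bool" where
  "fluct_dominates s \<beta> \<longleftrightarrow>
     (if 2 * Re \<beta> \<le> s then s\<^sup>2 \<le> 2 * ((Re \<beta>)\<^sup>2 + (Im \<beta>)\<^sup>2) else s \<le> Re \<beta> + \<bar>Im \<beta>\<bar>)"

text \<open>The value of p in the phases F and G, with ln \<alpha> expressed through s.\<close>

definition fluct_exponent :: "real \<Rightarrow> real \<Rightarrow> complex \<Rightarrow> real" where
  "fluct_exponent a s \<beta> = (if 2 * Re \<beta> \<le> s then a * s\<^sup>2 / 4 + a * (Re \<beta>)\<^sup>2 else a * s * Re \<beta>)"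

definition critical_moment :: "real \<Rightarrow> complex \<Rightarrow> real" where
  "critical_moment s \<beta> = (if 2 * Re \<beta> \<le> s then 2 else s / Re \<beta>)"

lemma critical_moment_bounds:
  assumes "s > 0" "Re \<beta> \<ge> 0"
  shows "0 < critical_moment s \<beta>" "critical_moment s \<beta> \<le> 2"
  using assms by (auto simp: critical_moment_def field_simps)

lemma critical_moment_mono:
  assumes "s \<le> s'" "s > 0" "Re \<beta> \<ge> 0"
  shows "critical_moment s \<beta> \<le> critical_moment s' \<beta>"
  using assms by (auto simp: critical_moment_def field_simps)

lemma critical_moment_fluct:
  assumes "s > 0" "Re \<beta> \<ge> 0"
  shows "a * s\<^sup>2 / 2 + (critical_moment s \<beta> * Re \<beta>)\<^sup>2 * a / 2 = critical_moment s \<beta> * fluct_exponent a s \<beta>"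
  using assms by (auto simp: critical_moment_def fluct_exponent_def power2_eq_square field_simps)

text \<open>For Re \<beta> > s the exponent of the mean can exceed that of the fluctuations. The
  critical moment is then below 1, where moments are bounded without centring; the last hypothesis
  excludes this range.\<close>

lemma fluct_dominates_mean_le:
  assumes "fluct_dominates s \<beta>" "s > 0" "Re \<beta> \<ge> 0" "a > 0" "critical_moment s \<beta> > 1"
  shows "a * s\<^sup>2 / 2 + a * ((Re \<beta>)\<^sup>2 - (Im \<beta>)\<^sup>2) / 2 \<le> fluct_exponent a s \<beta>"
proof (cases "2 * Re \<beta> \<le> s")
  case True
  then have "0 \<le> a * (2 * ((Re \<beta>)\<^sup>2 + (Im \<beta>)\<^sup>2) - s\<^sup>2)"
    using assms by (auto simp: fluct_dominates_def)
  then show ?thesis using True by (simp add: fluct_exponent_def field_simps)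
next
  case False
  then have "Re \<beta> > 0" using assms by simp
  then have "Re \<beta> < s" using False assms by (simp add: critical_moment_def)
  moreover have "s - Re \<beta> \<le> \<bar>Im \<beta>\<bar>" using assms False by (simp add: fluct_dominates_def)
  ultimately have "(s - Re \<beta>)\<^sup>2 \<le> \<bar>Im \<beta>\<bar>\<^sup>2" by (intro power_mono) auto
  then have "0 \<le> a * ((Im \<beta>)\<^sup>2 - (s - Re \<beta>)\<^sup>2)" using assms by simp
  then show ?thesis using False by (simp add: fluct_exponent_def power2_diff field_simps)
qed

text \<open>The two ingredients of the argument by the mean in phase E: moments of an order above 1
  and a strict gap between the exponents. For 2 * Re \<beta> > s the first one follows from Re
  \<beta> < s.\<close>

lemma not_fluct_dominates:
  assumes "\<not> fluct_dominates s \<beta>" "s > 0" "Re \<beta> \<ge> 0" "a > 0"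
  shows "critical_moment s \<beta> > 1"
    and "fluct_exponent a s \<beta> < a * s\<^sup>2 / 2 + a * ((Re \<beta>)\<^sup>2 - (Im \<beta>)\<^sup>2) / 2"
proof -
  show "critical_moment s \<beta> > 1"
    using assms by (auto simp: critical_moment_def fluct_dominates_def field_simps split: if_splits)
  show "fluct_exponent a s \<beta> < a * s\<^sup>2 / 2 + a * ((Re \<beta>)\<^sup>2 - (Im \<beta>)\<^sup>2) / 2"
  proof (cases "2 * Re \<beta> \<le> s")
    case True
    then have "0 < a * (s\<^sup>2 - 2 * ((Re \<beta>)\<^sup>2 + (Im \<beta>)\<^sup>2))"
      using assms by (auto simp: fluct_dominates_def)
    then show ?thesis using True by (simp add: fluct_exponent_def field_simps)
  next
    case False
    then have "\<bar>Im \<beta>\<bar> < s - Re \<beta>" using assms by (simp add: fluct_dominates_def)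
    then have "\<bar>Im \<beta>\<bar>\<^sup>2 < (s - Re \<beta>)\<^sup>2" by (intro power_strict_mono) auto
    then have "0 < a * ((s - Re \<beta>)\<^sup>2 - (Im \<beta>)\<^sup>2)" using assms by simp
    then show ?thesis using False by (simp add: fluct_exponent_def power2_diff field_simps)
  qed
qed

text \<open>The delicate case is the change of branch, 2 * Re \<beta> > s but 2 * Re \<beta> \<le>
  s'. There |Im \<beta>| < s - Re \<beta> < Re \<beta>, and therefore 2 * |\<beta>|^2 < (2 * Re
  \<beta>)^2 \<le> s'^2.\<close>

lemma not_fluct_dominates_mono:
  assumes "\<not> fluct_dominates s \<beta>" "s < s'" "s > 0" "Re \<beta> \<ge> 0"
  shows "\<not> fluct_dominates s' \<beta>"
proof (cases "2 * Re \<beta> \<le> s")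
  case True
  then have "2 * ((Re \<beta>)\<^sup>2 + (Im \<beta>)\<^sup>2) < s\<^sup>2" using assms by (auto simp: fluct_dominates_def)
  moreover have "s\<^sup>2 < s'\<^sup>2" using assms by (intro power_strict_mono) auto
  ultimately show ?thesis using True assms by (auto simp: fluct_dominates_def)
next
  case False
  then have "Re \<beta> + \<bar>Im \<beta>\<bar> < s" using assms by (auto simp: fluct_dominates_def)
  moreover have "2 * ((Re \<beta>)\<^sup>2 + (Im \<beta>)\<^sup>2) < s'\<^sup>2" if "2 * Re \<beta> \<le> s'"
  proof -
    have "\<bar>Im \<beta>\<bar> < Re \<beta>" using calculation False by linarith
    then have "\<bar>Im \<beta>\<bar>\<^sup>2 < (Re \<beta>)\<^sup>2" by (intro power_strict_mono) auto
    moreover have "(2 * Re \<beta>)\<^sup>2 \<le> s'\<^sup>2" using that assms by (intro power_mono) auto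
    ultimately show ?thesis by (simp add: power_mult_distrib)
  qed
  ultimately show ?thesis using assms by (auto simp: fluct_dominates_def)
qed

text \<open>The point y = 2 * Re \<beta> attains the maximum if it lies below s. Otherwise the
  supremum sits at the excluded point y = s, and stepping back by \<theta> costs at most a * Re
  \<beta> * \<theta> \<le> \<epsilon>.\<close>

lemma fluct_exponent_approx:
  assumes s: "s > 0" and \<beta>: "Re \<beta> \<ge> 0" and a: "a > 0" and \<epsilon>: "\<epsilon> > 0"
  shows "\<exists>y\<ge>0. y < s \<and> fluct_exponent a s \<beta> - \<epsilon> \<le> a * (s\<^sup>2 - y\<^sup>2) / 4 + a * Re \<beta> * y"
proof (cases "2 * Re \<beta> < s")
  case True
  then show ?thesis using \<beta> \<epsilon>
    by (intro exI[of _ "2 * Re \<beta>"]) (auto simp: fluct_exponent_def power2_eq_square field_simps)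
next
  case False
  then have \<beta>0: "Re \<beta> > 0" using s by simp
  define \<theta> where "\<theta> = min s (\<epsilon> / (a * Re \<beta>))"
  have \<theta>: "\<theta> > 0" "\<theta> \<le> s" using s \<epsilon> a \<beta>0 by (auto simp: \<theta>_def)
  have "\<theta> * (a * Re \<beta>) \<le> \<epsilon> / (a * Re \<beta>) * (a * Re \<beta>)"
    using a \<beta>0 by (intro mult_right_mono) (auto simp: \<theta>_def)
  then have \<theta>2: "a * Re \<beta> * \<theta> \<le> \<epsilon>" using a \<beta>0 by (simp add: mult_ac)
  have eq: "fluct_exponent a s \<beta> = a * Re \<beta> * s"
    using False by (auto simp: fluct_exponent_def power2_eq_square)
  have "(s - \<theta>)\<^sup>2 \<le> s\<^sup>2" using \<theta> by (intro power_mono) auto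
  then have "0 \<le> a * (s\<^sup>2 - (s - \<theta>)\<^sup>2) / 4" using a by simp
  moreover have "a * Re \<beta> * (s - \<theta>) = a * Re \<beta> * s - a * Re \<beta> * \<theta>" by (simp add: algebra_simps)
  ultimately have "fluct_exponent a s \<beta> - \<epsilon> \<le> a * (s\<^sup>2 - (s - \<theta>)\<^sup>2) / 4 + a * Re \<beta> * (s - \<theta>)"
    using \<theta>2 unfolding eq by linarith
  then show ?thesis using \<theta> by (intro exI[of _ "s - \<theta>"]) auto
qed

text \<open>This trades topological closures for inequalities. A point in the closure of E that
  satisfies \<open>fluct_dominates\<close> lies on a phase boundary, and the equation of that
  boundary makes the two formulas agree.\<close>

lemma grem_p_fluct_or_mean:
  assumes a: "a > 0" and \<alpha>: "\<alpha> > 1" and \<beta>: "Re \<beta> \<ge> 0"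
  defines "s \<equiv> grem_sigma a \<alpha>"
  shows "grem_p a \<alpha> \<beta> = (if fluct_dominates s \<beta> then fluct_exponent a s \<beta>
    else ln \<alpha> + a * ((Re \<beta>)\<^sup>2 - (Im \<beta>)\<^sup>2) / 2)"
proof -
  note sf = grem_sigma_facts[OF a \<alpha>, folded s_def]
  have G: "grem_p a \<alpha> \<beta> = a * s * Re \<beta>" "s \<le> 2 * Re \<beta>" "s \<le> Re \<beta> + \<bar>Im \<beta>\<bar>"
    if "\<beta> \<in> closure (phase_G s)"
    using grem_p_G[OF that[unfolded s_def]] closure_phase_G_subset[of s] that \<beta> sf(3) by auto
  have F: "grem_p a \<alpha> \<beta> = a * s\<^sup>2 / 4 + a * (Re \<beta>)\<^sup>2" "2 * Re \<beta> \<le> s" "s\<^sup>2 \<le> 2 * ((Re \<beta>)\<^sup>2 + (Im \<beta>)\<^sup>2)"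
    if "\<beta> \<in> closure (phase_F s)"
    using grem_p_F[OF a \<alpha> that[unfolded s_def]] closure_phase_F_subset[of s] that \<beta> sf(2) by auto
  have E: "grem_p a \<alpha> \<beta> = ln \<alpha> + a * ((Re \<beta>)\<^sup>2 - (Im \<beta>)\<^sup>2) / 2"
    if "\<beta> \<in> closure (phase_E s)"
    using grem_p_E[OF a \<alpha> that[unfolded s_def]] by simp
  consider "\<beta> \<in> closure (phase_G s)" | "\<beta> \<in> closure (phase_F s)" | "\<beta> \<in> closure (phase_E s)"
    using phases_cover[of s] by blast
  then show ?thesis
  proof cases
    case 1
    note G = G[OF 1]
    have "fluct_dominates s \<beta>"
    proof (cases "2 * Re \<beta> \<le> s")
      case True
      then have eq: "s = 2 * Re \<beta>" using G by simp
      then have "Re \<beta> \<le> \<bar>Im \<beta>\<bar>" using G by simp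
      then have "(Re \<beta>)\<^sup>2 \<le> \<bar>Im \<beta>\<bar>\<^sup>2" using \<beta> by (intro power_mono) auto
      then show ?thesis by (simp add: fluct_dominates_def eq power_mult_distrib)
    qed (use G in \<open>simp add: fluct_dominates_def\<close>)
    moreover have "fluct_exponent a s \<beta> = a * s * Re \<beta>"
      using G(2) by (auto simp: fluct_exponent_def power2_eq_square)
    ultimately show ?thesis using G by simp
  next
    case 2
    then show ?thesis using F by (simp add: fluct_dominates_def fluct_exponent_def)
  next
    case 3
    note d = closure_phase_E_disjoint[OF sf(1) 3]
    note E = E[OF 3]
    show ?thesis
    proof (cases "fluct_dominates s \<beta>")
      case True
      have "a * s\<^sup>2 / 2 + a * ((Re \<beta>)\<^sup>2 - (Im \<beta>)\<^sup>2) / 2 = fluct_exponent a s \<beta>"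
      proof (cases "2 * Re \<beta> < s")
        case lt: True
        then have "2 * ((Re \<beta>)\<^sup>2 + (Im \<beta>)\<^sup>2) = s\<^sup>2"
          using True d(2) \<beta> by (auto simp: fluct_dominates_def phase_F_def)
        then have im: "(Im \<beta>)\<^sup>2 = s\<^sup>2 / 2 - (Re \<beta>)\<^sup>2" by simp
        show ?thesis unfolding im using lt by (simp add: fluct_exponent_def field_simps)
      next
        case ge: False
        have "s \<le> Re \<beta> + \<bar>Im \<beta>\<bar>"
        proof (cases "2 * Re \<beta> = s")
          case eq: True
          have "(2 * Re \<beta>)\<^sup>2 \<le> 2 * ((Re \<beta>)\<^sup>2 + (Im \<beta>)\<^sup>2)"
            using True unfolding eq[symmetric] by (simp add: fluct_dominates_def)
          then have "(Re \<beta>)\<^sup>2 \<le> (Im \<beta>)\<^sup>2" by (simp add: power_mult_distrib)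
          then have "\<bar>Re \<beta>\<bar> \<le> \<bar>Im \<beta>\<bar>" by (simp only: abs_le_square_iff)
          then show ?thesis using eq by linarith
        qed (use True ge in \<open>auto simp: fluct_dominates_def\<close>)
        moreover have "\<not> s < Re \<beta> + \<bar>Im \<beta>\<bar>"
          using d(1,3) ge \<beta> by (auto simp: phase_G_def)
        ultimately have "\<bar>Im \<beta>\<bar> = s - Re \<beta>" by linarith
        then have "(Im \<beta>)\<^sup>2 = (s - Re \<beta>)\<^sup>2" by (metis power2_abs)
        then have im: "(Im \<beta>)\<^sup>2 = s\<^sup>2 - 2 * s * Re \<beta> + (Re \<beta>)\<^sup>2" by (simp add: power2_diff)
        have "fluct_exponent a s \<beta> = a * s * Re \<beta>"
          using ge by (auto simp: fluct_exponent_def power2_eq_square)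
        then show ?thesis unfolding im by (simp add: field_simps)
      qed
      then show ?thesis using True E sf(2) by simp
    qed (use E in simp)
  qed
qed

section \<open>The recursion along the tree\<close>

text \<open>The argument m counts the levels below w. The variable at w itself is left out, so the
  sum depends only on strict descendants. The disorder is an explicit argument so that a
  configuration restricted to an index set can be inserted in independence arguments.\<close>

primrec subtree_sum :: "(nat \<Rightarrow> complex) \<Rightarrow> (nat \<Rightarrow> nat) \<Rightarrow> (nat list \<Rightarrow> real) \<Rightarrow> nat \<Rightarrow> nat list \<Rightarrow> complex" where
  "subtree_sum b N x 0 w = 1"
| "subtree_sum b N x (Suc m) w = (\<Sum>i=1..N (Suc (length w)).
     exp (b (Suc (length w)) * of_real (x (w @ [i]))) * subtree_sum b N x m (w @ [i]))"

definition descendants :: "nat \<Rightarrow> (nat \<Rightarrow> nat) \<Rightarrow> nat list \<Rightarrow> nat list set" where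
  "descendants d N w = {v \<in> grem_vertices d N. \<exists>u. u \<noteq> [] \<and> v = w @ u}"

lemma length_grem_leaves: "w \<in> grem_leaves k N \<Longrightarrow> length w = k"
  by (simp add: grem_leaves_def)

lemma finite_grem_leaves: "finite (grem_leaves k N)"
proof (rule finite_subset)
  show "grem_leaves k N \<subseteq> {xs. set xs \<subseteq> (\<Union>i<k. {1..N (Suc i)}) \<and> length xs = k}"
    by (force simp: grem_leaves_def in_set_conv_nth)
  show "finite {xs. set xs \<subseteq> (\<Union>i<k. {1..N (Suc i)}) \<and> length xs = k}"
    by (rule finite_lists_length_eq) auto
qed

lemma grem_leaves_snoc:
  "w @ [i] \<in> grem_leaves (Suc k) N \<longleftrightarrow> w \<in> grem_leaves k N \<and> i \<in> {1..N (Suc k)}"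
  by (auto simp: grem_leaves_def nth_append less_Suc_eq)

lemma grem_vertices_iff: "w \<in> grem_vertices d N \<longleftrightarrow> (\<exists>k\<in>{1..d}. w \<in> grem_leaves k N)"
  by (auto simp: grem_vertices_def grem_leaves_def)

lemma take_grem_leaves: "e \<in> grem_leaves k N \<Longrightarrow> j \<le> k \<Longrightarrow> take j e \<in> grem_leaves j N"
  by (auto simp: grem_leaves_def)

lemma snoc_in_descendants:
  assumes "w \<in> grem_leaves k N" "i \<in> {1..N (Suc k)}" "Suc k \<le> d"
  shows "w @ [i] \<in> descendants d N w" and "w @ [i] \<in> grem_leaves (Suc k) N"
    and "descendants d N (w @ [i]) \<subseteq> descendants d N w"
proof -
  show 1: "w @ [i] \<in> grem_leaves (Suc k) N" using assms by (simp add: grem_leaves_snoc)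
  then show "w @ [i] \<in> descendants d N w"
    using assms by (auto simp: descendants_def grem_vertices_iff)
  show "descendants d N (w @ [i]) \<subseteq> descendants d N w"
    by (auto simp: descendants_def)
qed

text \<open>The recursion unrolled; at the root of the whole tree it identifies the recursive sum
  with the partition function. The leaves below w are split according to their child of w.\<close>

lemma subtree_sum_eq:
  assumes "w \<in> grem_leaves k N"
  shows "subtree_sum b N x m w = (\<Sum>e | e \<in> grem_leaves (k + m) N \<and> take k e = w.
    exp (\<Sum>j=Suc k..k+m. b j * of_real (x (take j e))))"
  using assms
proof (induction m arbitrary: k w)
  case 0
  have "{e. e \<in> grem_leaves (k + 0) N \<and> take k e = w} = {w}"
    using 0 by (auto simp: length_grem_leaves)
  then show ?case by simp
next
  case (Suc m)
  have len: "length w = k" using Suc.prems by (rule length_grem_leaves)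
  define L where "L i = {e. e \<in> grem_leaves (Suc k + m) N \<and> take (Suc k) e = w @ [i]}" for i
  have split: "{e. e \<in> grem_leaves (k + Suc m) N \<and> take k e = w} = (\<Union>i\<in>{1..N (Suc k)}. L i)"
  proof (intro set_eqI iffI)
    fix e assume e: "e \<in> {e. e \<in> grem_leaves (k + Suc m) N \<and> take k e = w}"
    then have "take (Suc k) e = w @ [e ! k]"
      using take_Suc_conv_app_nth[of k e] by (auto simp: length_grem_leaves)
    moreover have "e ! k \<in> {1..N (Suc k)}" using e by (auto simp: grem_leaves_def)
    ultimately show "e \<in> (\<Union>i\<in>{1..N (Suc k)}. L i)" using e by (auto simp: L_def)
  next
    fix e assume "e \<in> (\<Union>i\<in>{1..N (Suc k)}. L i)"
    then obtain i where ei: "e \<in> grem_leaves (Suc k + m) N" "take (Suc k) e = w @ [i]"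
      by (auto simp: L_def)
    note ei(1)
    moreover have "take k e = w"
    proof -
      have "take k e = take k (take (Suc k) e)" by (simp add: min_def)
      also have "\<dots> = w" unfolding ei(2) using len by simp
      finally show ?thesis .
    qed
    ultimately show "e \<in> {e. e \<in> grem_leaves (k + Suc m) N \<and> take k e = w}" by simp
  qed
  have "(\<Sum>e | e \<in> grem_leaves (k + Suc m) N \<and> take k e = w. exp (\<Sum>j=Suc k..k+Suc m. b j * of_real (x (take j e))))
      = (\<Sum>i=1..N (Suc k). \<Sum>e\<in>L i. exp (\<Sum>j=Suc k..k+Suc m. b j * of_real (x (take j e))))"
    unfolding split
    by (rule sum.UNION_disjoint) (auto simp: L_def intro: finite_subset[OF _ finite_grem_leaves])
  also have "\<dots> = (\<Sum>i=1..N (Suc k). exp (b (Suc k) * of_real (x (w @ [i]))) * subtree_sum b N x m (w @ [i]))"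
  proof (rule sum.cong[OF refl])
    fix i assume i: "i \<in> {1..N (Suc k)}"
    have wi: "w @ [i] \<in> grem_leaves (Suc k) N" using Suc.prems i by (simp add: grem_leaves_snoc)
    have "(\<Sum>e\<in>L i. exp (\<Sum>j=Suc k..k+Suc m. b j * of_real (x (take j e)))) =
        (\<Sum>e\<in>L i. exp (b (Suc k) * of_real (x (w @ [i]))) * exp (\<Sum>j=Suc (Suc k)..Suc k+m. b j * of_real (x (take j e))))"
    proof (rule sum.cong[OF refl])
      fix e assume "e \<in> L i"
      then have "take (Suc k) e = w @ [i]" by (simp add: L_def)
      then show "exp (\<Sum>j=Suc k..k+Suc m. b j * of_real (x (take j e))) =
          exp (b (Suc k) * of_real (x (w @ [i]))) * exp (\<Sum>j=Suc (Suc k)..Suc k+m. b j * of_real (x (take j e)))"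
        by (simp add: sum.atLeast_Suc_atMost exp_add)
    qed
    also have "\<dots> = exp (b (Suc k) * of_real (x (w @ [i]))) * subtree_sum b N x m (w @ [i])"
      unfolding Suc.IH[OF wi] L_def by (simp add: sum_distrib_left)
    finally show "(\<Sum>e\<in>L i. exp (\<Sum>j=Suc k..k+Suc m. b j * of_real (x (take j e)))) = \<dots>" .
  qed
  finally show ?case using len by simp
qed

text \<open>Locality: the disorder may be replaced by its restriction to the descendants. Together
  with measurability on the product over these indices, it turns subtree sums into functions of
  independent blocks.\<close>

lemma subtree_sum_cong:
  assumes "w \<in> grem_leaves k N" "k + m \<le> d" "\<And>v. v \<in> descendants d N w \<Longrightarrow> x v = y v"
  shows "subtree_sum b N x m w = subtree_sum b N y m w"
  using assms
proof (induction m arbitrary: k w)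
  case (Suc m)
  have "exp (b (Suc k) * of_real (x (w @ [i]))) * subtree_sum b N x m (w @ [i]) =
      exp (b (Suc k) * of_real (y (w @ [i]))) * subtree_sum b N y m (w @ [i])" if i: "i \<in> {1..N (Suc k)}" for i
  proof -
    have "Suc k \<le> d" using Suc.prems by simp
    note * = snoc_in_descendants[OF Suc.prems(1) i this]
    show ?thesis
      using Suc.IH[OF *(2)] Suc.prems(2,3) *(1,3) by fastforce
  qed
  then show ?case by (simp add: length_grem_leaves[OF Suc.prems(1)])
qed simp

lemma measurable_subtree_sum:
  assumes "w \<in> grem_leaves k N" "k + m \<le> d" "descendants d N w \<subseteq> A"
  shows "(\<lambda>x. subtree_sum b N x m w) \<in> borel_measurable (PiM A (\<lambda>_. borel))"
  using assms
proof (induction m arbitrary: k w)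
  case (Suc m)
  have "(\<lambda>x. exp (b (Suc k) * of_real (x (w @ [i]))) * subtree_sum b N x m (w @ [i]))
      \<in> borel_measurable (PiM A (\<lambda>_. borel))" if i: "i \<in> {1..N (Suc k)}" for i
  proof -
    have "Suc k \<le> d" using Suc.prems by simp
    note * = snoc_in_descendants[OF Suc.prems(1) i this]
    have [measurable]: "(\<lambda>x. subtree_sum b N x m (w @ [i])) \<in> borel_measurable (PiM A (\<lambda>_. borel))"
      by (rule Suc.IH[OF *(2)]) (use Suc.prems(2,3) *(3) in auto)
    have [measurable]: "(\<lambda>x. x (w @ [i])) \<in> measurable (PiM A (\<lambda>_. borel)) (borel :: real measure)"
      by (rule measurable_component_singleton) (use *(1) Suc.prems(3) in auto)
    show ?thesis by measurable
  qed
  then show ?case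
    unfolding subtree_sum.simps length_grem_leaves[OF Suc.prems(1)] by (rule borel_measurable_sum)
qed simp

text \<open>For real \<beta> the anti-concentration bound requires real factors W, since no rotating
  phase would bring an imaginary W into the real part.\<close>

lemma subtree_sum_in_Reals:
  assumes "\<And>j. b j \<in> \<real>"
  shows "subtree_sum b N x m w \<in> \<real>"
proof (induction m arbitrary: w)
  case (Suc m)
  have "exp z \<in> \<real>" if "z \<in> \<real>" for z :: complex
    using that by (auto elim!: Reals_cases simp: exp_of_real)
  then show ?case using Suc assms by (auto intro!: sum_in_Reals Reals_mult)
qed simp

lemma moment_rate_subset:
  assumes "moment_rate M r p \<W>" "\<And>n. \<V> n \<subseteq> \<W> n"
  shows "moment_rate M r p \<V>"
  unfolding moment_rate_def
proof (intro allI impI)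
  fix \<epsilon> :: real assume "\<epsilon> > 0"
  with assms(1) show "\<forall>\<^sub>F n in sequentially. \<forall>W\<in>\<V> n. W \<in> borel_measurable M \<and>
      integrable M (\<lambda>\<omega>. cmod (W \<omega>) powr r) \<and>
      (LINT \<omega>|M. cmod (W \<omega>) powr r) \<le> exp (real n * (r * (p + \<epsilon>)))"
    unfolding moment_rate_def using assms(2) by (auto elim!: eventually_mono allE[of _ \<epsilon>])
qed

lemma mean_rate_subset:
  assumes "mean_rate M p \<W>" "\<And>n. \<V> n \<subseteq> \<W> n"
  shows "mean_rate M p \<V>"
proof -
  obtain \<mu> where \<mu>: "\<forall>\<^sub>F n in sequentially. \<forall>W\<in>\<W> n. integrable M W \<and> integral\<^sup>L M W = \<mu> n"
    "\<forall>\<epsilon>>0. \<forall>\<^sub>F n in sequentially. exp (real n * (p - \<epsilon>)) \<le> cmod (\<mu> n)"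
    using assms(1) unfolding mean_rate_def by auto
  have "\<forall>\<^sub>F n in sequentially. \<forall>W\<in>\<V> n. integrable M W \<and> integral\<^sup>L M W = \<mu> n"
    using \<mu>(1) by eventually_elim (use assms(2) in auto)
  then show ?thesis using \<mu>(2) unfolding mean_rate_def by auto
qed

lemma lower_rate_subset:
  assumes "lower_rate M p \<W>" "\<And>n. \<V> n \<subseteq> \<W> n"
  shows "lower_rate M p \<V>"
  unfolding lower_rate_def
proof (intro allI impI)
  fix \<epsilon> \<eta> :: real assume "\<epsilon> > 0" "\<eta> > 0"
  with assms(1) have "\<forall>\<^sub>F n in sequentially. \<forall>W\<in>\<W> n. W \<in> borel_measurable M \<and>
      measure M {\<omega>\<in>space M. cmod (W \<omega>) \<le> exp (real n * (p - \<epsilon>))} \<le> \<eta>"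
    unfolding lower_rate_def by blast
  then show "\<forall>\<^sub>F n in sequentially. \<forall>W\<in>\<V> n. W \<in> borel_measurable M \<and>
      measure M {\<omega>\<in>space M. cmod (W \<omega>) \<le> exp (real n * (p - \<epsilon>))} \<le> \<eta>"
    by eventually_elim (use assms(2) in auto)
qed

section \<open>The model for Re \<beta> \<ge> 0 and the induction over its levels\<close>

locale grem = prob_space M for M :: "'w measure" +
  fixes d :: nat and a \<alpha> :: "nat \<Rightarrow> real" and N :: "nat \<Rightarrow> nat \<Rightarrow> nat"
    and \<xi> :: "nat \<Rightarrow> nat list \<Rightarrow> 'w \<Rightarrow> real" and \<beta> :: complex
  assumes d: "d \<ge> 1"
    and a: "\<And>j. j \<in> {1..d} \<Longrightarrow> a j > 0"
    and \<alpha>: "\<And>j. j \<in> {1..d} \<Longrightarrow> \<alpha> j > 1"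
    and N: "\<And>j. j \<in> {1..d} \<Longrightarrow> (\<lambda>n. real (N n j) / \<alpha> j ^ n) \<longlonglongrightarrow> 1"
    and \<sigma>: "strict_mono_on {1..d} (\<lambda>j. grem_sigma (a j) (\<alpha> j))"
    and indep: "\<And>n. indep_vars (\<lambda>_. borel) (\<xi> n) (grem_vertices d (N n))"
    and normal: "\<And>n w. w \<in> grem_vertices d (N n) \<Longrightarrow> distributed M lborel (\<xi> n w) std_normal_density"
    and \<beta>: "Re \<beta> \<ge> 0"
begin

definition weight :: "nat \<Rightarrow> nat \<Rightarrow> complex" where
  "weight n j = \<beta> * of_real (sqrt (real n * a j))"

text \<open>Here m counts levels upwards from the leaves: the roots sit at level d - m, and m = 0
  gives the constant 1.\<close>

definition subtrees :: "nat \<Rightarrow> nat \<Rightarrow> ('w \<Rightarrow> complex) set" where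
  "subtrees m n = (\<lambda>w \<omega>. subtree_sum (weight n) (N n) (\<lambda>v. \<xi> n v \<omega>) m w) ` grem_leaves (d - m) (N n)"

lemma measurable_\<xi>: "w \<in> grem_vertices d (N n) \<Longrightarrow> \<xi> n w \<in> borel_measurable M"
  using distributed_std_normalD(1)[OF normal] .

lemma grem_partition_in_subtrees: "grem_partition d a N \<xi> n \<beta> \<in> subtrees d n"
proof -
  have nil: "[] \<in> grem_leaves 0 (N n)" by (simp add: grem_leaves_def)
  have "grem_partition d a N \<xi> n \<beta> \<omega> = subtree_sum (weight n) (N n) (\<lambda>v. \<xi> n v \<omega>) d []" for \<omega>
  proof -
    have "\<beta> * complex_of_real (sqrt (real n) * grem_energy d a (\<xi> n) e \<omega>) =
        (\<Sum>j=Suc 0..0 + d. weight n j * of_real (\<xi> n (take j e) \<omega>))" for e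
      unfolding grem_energy_def weight_def
      by (simp add: sum_distrib_left real_sqrt_mult mult_ac)
    then show ?thesis
      unfolding subtree_sum_eq[OF nil] grem_partition_def by simp
  qed
  then show ?thesis using nil unfolding subtrees_def by (intro image_eqI[of _ _ "[]"]) auto
qed

text \<open>Independence is used twice. The blocks \<open>K i\<close>, a child with all its
  descendants, are disjoint for different children and make the summands independent. Within one
  block the child is separated from its strict descendants \<open>D i\<close>, so its variable is
  independent of \<open>W i\<close>.\<close>

lemma subtrees_Suc:
  assumes m: "Suc m \<le> d"
  shows "subtrees (Suc m) n \<subseteq> branching M (\<beta> * of_real (sqrt (real n * a (d - m)))) (N n (d - m)) (subtrees m n)"
proof
  fix Z assume "Z \<in> subtrees (Suc m) n"
  then obtain w where w: "w \<in> grem_leaves (d - Suc m) (N n)"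
    and Z: "Z = (\<lambda>\<omega>. subtree_sum (weight n) (N n) (\<lambda>v. \<xi> n v \<omega>) (Suc m) w)"
    unfolding subtrees_def by auto
  define k where "k = d - Suc m"
  have k: "Suc k = d - m" "Suc k \<le> d" "Suc k + m \<le> d" using m by (auto simp: k_def)
  note w = w[folded k_def]
  let ?J = "{1..N n (Suc k)}"
  have child: "w @ [i] \<in> grem_leaves (Suc k) (N n)" "w @ [i] \<in> grem_vertices d (N n)" if "i \<in> ?J" for i
  proof -
    show "w @ [i] \<in> grem_leaves (Suc k) (N n)" using snoc_in_descendants(2)[OF w that k(2)] .
    then show "w @ [i] \<in> grem_vertices d (N n)" using k by (auto simp: grem_vertices_iff)
  qed
  define D where "D i = descendants d (N n) (w @ [i])" for i
  have DV: "D i \<subseteq> grem_vertices d (N n)" for i by (auto simp: D_def descendants_def)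
  define K where "K i = insert (w @ [i]) (D i)" for i
  define W where "W i \<omega> = subtree_sum (weight n) (N n) (\<lambda>v. \<xi> n v \<omega>) m (w @ [i])" for i \<omega>
  have W_eq: "W i \<omega> = subtree_sum (weight n) (N n) (restrict (\<lambda>v. \<xi> n v \<omega>) A) m (w @ [i])"
    if "i \<in> ?J" "D i \<subseteq> A" for i \<omega> A
    unfolding W_def
    by (rule subtree_sum_cong[OF child(1)[OF that(1)] k(3)]) (use that in \<open>auto simp: D_def\<close>)
  have Wm: "(\<lambda>x. subtree_sum (weight n) (N n) x m (w @ [i])) \<in> borel_measurable (PiM A (\<lambda>_. borel))"
    if "i \<in> ?J" "D i \<subseteq> A" for i A
    using measurable_subtree_sum[OF child(1)[OF that(1)] k(3) that(2)[unfolded D_def]] .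
  have pair: "indep_var borel (\<lambda>\<omega>. complex_of_real (\<xi> n (w @ [i]) \<omega>)) borel (W i)" if i: "i \<in> ?J" for i
  proof -
    have "indep_var (PiM {w @ [i]} (\<lambda>_. borel)) (\<lambda>\<omega>. restrict (\<lambda>v. \<xi> n v \<omega>) {w @ [i]})
        (PiM (D i) (\<lambda>_. borel)) (\<lambda>\<omega>. restrict (\<lambda>v. \<xi> n v \<omega>) (D i))"
      by (rule indep_var_restrict[OF indep]) (use child(2)[OF i] DV in \<open>auto simp: D_def descendants_def\<close>)
    then have "indep_var borel ((\<lambda>x. complex_of_real (x (w @ [i]))) \<circ> (\<lambda>\<omega>. restrict (\<lambda>v. \<xi> n v \<omega>) {w @ [i]}))
        borel ((\<lambda>x. subtree_sum (weight n) (N n) x m (w @ [i])) \<circ> (\<lambda>\<omega>. restrict (\<lambda>v. \<xi> n v \<omega>) (D i)))"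
      by (rule indep_var_compose) (use Wm[OF i order_refl] in measurable)
    moreover have "(\<lambda>x. complex_of_real (x (w @ [i]))) \<circ> (\<lambda>\<omega>. restrict (\<lambda>v. \<xi> n v \<omega>) {w @ [i]}) =
        (\<lambda>\<omega>. complex_of_real (\<xi> n (w @ [i]) \<omega>))" by auto
    moreover have "(\<lambda>x. subtree_sum (weight n) (N n) x m (w @ [i])) \<circ> (\<lambda>\<omega>. restrict (\<lambda>v. \<xi> n v \<omega>) (D i)) = W i"
      by (auto simp: W_eq[OF i order_refl])
    ultimately show ?thesis by simp
  qed
  have ind: "indep_vars (\<lambda>_. borel) (\<lambda>i \<omega>. exp (weight n (Suc k) * of_real (\<xi> n (w @ [i]) \<omega>)) * W i \<omega>) ?J"
  proof -
    have "indep_vars (\<lambda>i. PiM (K i) (\<lambda>_. borel)) (\<lambda>i \<omega>. restrict (\<lambda>v. \<xi> n v \<omega>) (K i)) ?J"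
    proof (rule indep_vars_restrict[OF indep])
      show "K i \<subseteq> grem_vertices d (N n)" if "i \<in> ?J" for i
        using DV child(2)[OF that] by (auto simp: K_def)
      show "disjoint_family_on K ?J"
        by (auto simp: disjoint_family_on_def K_def D_def descendants_def)
    qed
    then have "indep_vars (\<lambda>_. borel) (\<lambda>i \<omega>. (\<lambda>x. exp (weight n (Suc k) * of_real (x (w @ [i]))) *
        subtree_sum (weight n) (N n) x m (w @ [i])) (restrict (\<lambda>v. \<xi> n v \<omega>) (K i))) ?J"
    proof (rule indep_vars_compose2)
      fix i assume i: "i \<in> ?J"
      have [measurable]: "(\<lambda>x. x (w @ [i])) \<in> measurable (PiM (K i) (\<lambda>_. borel)) (borel :: real measure)"
        by (rule measurable_component_singleton) (simp add: K_def)
      have "D i \<subseteq> K i" by (auto simp: K_def)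
      note [measurable] = Wm[OF i this]
      show "(\<lambda>x. exp (weight n (Suc k) * of_real (x (w @ [i]))) * subtree_sum (weight n) (N n) x m (w @ [i]))
          \<in> borel_measurable (PiM (K i) (\<lambda>_. borel))" by measurable
    qed
    also have "?this \<longleftrightarrow> indep_vars (\<lambda>_. borel) (\<lambda>i \<omega>. exp (weight n (Suc k) * of_real (\<xi> n (w @ [i]) \<omega>)) * W i \<omega>) ?J"
    proof (rule indep_vars_cong[OF refl])
      fix i assume i: "i \<in> ?J"
      have "D i \<subseteq> K i" by (auto simp: K_def)
      from W_eq[OF i this] show "(\<lambda>\<omega>. (\<lambda>x. exp (weight n (Suc k) * of_real (x (w @ [i]))) *
        subtree_sum (weight n) (N n) x m (w @ [i])) (restrict (\<lambda>v. \<xi> n v \<omega>) (K i))) =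
        (\<lambda>\<omega>. exp (weight n (Suc k) * of_real (\<xi> n (w @ [i]) \<omega>)) * W i \<omega>)"
        by (auto simp: K_def)
    qed auto
    finally show ?thesis .
  qed
  have WS: "W i \<in> subtrees m n" if "i \<in> ?J" for i
    using child(1)[OF that] unfolding subtrees_def W_def k(1) by auto
  have Z': "Z = (\<lambda>\<omega>. \<Sum>i=1..N n (Suc k). exp (weight n (Suc k) * of_real (\<xi> n (w @ [i]) \<omega>)) * W i \<omega>)"
    unfolding Z W_def by (simp add: length_grem_leaves[OF w])
  show "Z \<in> branching M (\<beta> * of_real (sqrt (real n * a (d - m)))) (N n (d - m)) (subtrees m n)"
    unfolding branching_def mem_Collect_eq k(1)[symmetric] weight_def[symmetric]
    using WS normal[OF child(2)] pair ind Z'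
    by (intro exI[of _ "\<lambda>i. \<xi> n (w @ [i])"] exI[of _ W]) auto
qed

definition s :: "nat \<Rightarrow> real" where "s k = grem_sigma (a k) (\<alpha> k)"

definition p_rest :: "nat \<Rightarrow> real" where
  "p_rest m = (\<Sum>k=Suc (d - m)..d. grem_p (a k) (\<alpha> k) \<beta>)"

text \<open>The critical order of the uppermost level inside the subtrees. At m = 0 no level is
  left, and the largest order that is ever used, 2, is available.\<close>

definition moment_rest :: "nat \<Rightarrow> real" where
  "moment_rest m = (if m = 0 then 2 else critical_moment (s (Suc (d - m))) \<beta>)"

lemma s_facts:
  assumes "k \<in> {1..d}"
  shows "s k > 0" "ln (\<alpha> k) = a k * (s k)\<^sup>2 / 2"
  using grem_sigma_facts[OF a[OF assms] \<alpha>[OF assms]] by (auto simp: s_def)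

lemma s_less: "i \<in> {1..d} \<Longrightarrow> j \<in> {1..d} \<Longrightarrow> i < j \<Longrightarrow> s i < s j"
  using \<sigma> unfolding s_def strict_mono_on_def by blast

text \<open>The induction runs from the leaves to the root and carries three rates because each
  feeds the next level: moments for the upper bound and for keeping W bounded, the lower rate for
  the fluctuation case, the mean for phase E. The rate of the mean is claimed only if all levels of
  the subtree are in phase E, since otherwise the mean can be of smaller order than the sum.\<close>

lemma rates:
  assumes "m \<le> d"
  shows "moment_rate M (moment_rest m) (p_rest m) (subtrees m) \<and>
    lower_rate M (p_rest m) (subtrees m) \<and>
    ((\<forall>k\<in>{Suc (d - m)..d}. \<not> fluct_dominates (s k) \<beta>) \<longrightarrow> mean_rate M (p_rest m) (subtrees m))"
  using assms
proof (induction m)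
  case 0
  have S: "subtrees 0 n \<subseteq> {\<lambda>_. 1}" for n by (auto simp: subtrees_def)
  have p0: "p_rest 0 = 0" by (simp add: p_rest_def)
  have M0: "moment_rate M (moment_rest 0) (p_rest 0) (\<lambda>_. {\<lambda>_. 1})"
    by (auto simp: moment_rate_def moment_rest_def p0 prob_space)
  have L0: "lower_rate M (p_rest 0) (\<lambda>_. {\<lambda>_. 1})"
    unfolding lower_rate_def p0
  proof (intro allI impI)
    fix \<epsilon> \<eta> :: real assume "\<epsilon> > 0" "\<eta> > 0"
    show "\<forall>\<^sub>F n in sequentially. \<forall>W\<in>{\<lambda>_. 1}. W \<in> borel_measurable M \<and>
        prob {\<omega>\<in>space M. cmod (W \<omega>) \<le> exp (real n * (0 - \<epsilon>))} \<le> \<eta>"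
      using eventually_gt_at_top[of 0]
    proof eventually_elim
      case (elim n)
      then have "real n * \<epsilon> > 0" using \<open>\<epsilon> > 0\<close> by simp
      then show ?case using \<open>\<eta> > 0\<close> by simp
    qed
  qed
  have E0: "mean_rate M (p_rest 0) (\<lambda>_. {\<lambda>_. 1})"
    unfolding mean_rate_def p0 by (intro exI[of _ "\<lambda>_. 1"]) (auto simp: prob_space)
  show ?case
    using moment_rate_subset[where \<V> = "subtrees 0", OF M0 S] lower_rate_subset[where \<V> = "subtrees 0", OF L0 S] mean_rate_subset[where \<V> = "subtrees 0", OF E0 S] by blast
next
  case (Suc m)
  define k where "k = d - m"
  have k: "k \<in> {1..d}" "Suc (d - Suc m) = k" using Suc.prems by (auto simp: k_def)
  have IH: "moment_rate M (moment_rest m) (p_rest m) (subtrees m)" "lower_rate M (p_rest m) (subtrees m)"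
    "(\<forall>j\<in>{Suc k..d}. \<not> fluct_dominates (s j) \<beta>) \<Longrightarrow> mean_rate M (p_rest m) (subtrees m)"
    using Suc by (auto simp: k_def)
  have ak: "a k > 0" and \<alpha>k: "\<alpha> k > 1" and sk: "s k > 0" "ln (\<alpha> k) = a k * (s k)\<^sup>2 / 2"
    using a \<alpha> s_facts k by auto
  define r where "r = critical_moment (s k) \<beta>"
  have r: "0 < r" "r \<le> 2" using critical_moment_bounds[OF sk(1) \<beta>] by (auto simp: r_def)
  have r_eq: "moment_rest (Suc m) = r" by (simp only: moment_rest_def k(2) r_def) simp
  \<comment> \<open>Here the ordering of the \<sigma>s enters: the subtrees below are controlled for
    an order at least as large as r.\<close>
  have r_le: "r \<le> moment_rest m"
  proof (cases "m = 0")
    case False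
    then have "Suc (d - m) \<in> {1..d}" "k < Suc (d - m)" using Suc.prems by (auto simp: k_def)
    then have "s k < s (Suc (d - m))" by (rule s_less[OF k(1)])
    then have "critical_moment (s k) \<beta> \<le> critical_moment (s (Suc (d - m))) \<beta>"
      by (intro critical_moment_mono[OF _ sk(1) \<beta>]) simp
    then show ?thesis using False unfolding moment_rest_def r_def by simp
  qed (use r in \<open>simp add: moment_rest_def\<close>)
  have W: "moment_rate M r (p_rest m) (subtrees m)" by (rule moment_rate_mono[OF IH(1) r(1) r_le])
  define q where "q = grem_p (a k) (\<alpha> k) \<beta>"
  define e where "e = ln (\<alpha> k) + a k * ((Re \<beta>)\<^sup>2 - (Im \<beta>)\<^sup>2) / 2"
  have p_eq: "p_rest (Suc m) = q + p_rest m"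
  proof -
    have "{Suc (d - Suc m)..d} = insert k {Suc (d - m)..d}" using k by (auto simp: k_def)
    then show ?thesis unfolding p_rest_def q_def by (simp add: k_def)
  qed
  have q: "q = (if fluct_dominates (s k) \<beta> then fluct_exponent (a k) (s k) \<beta> else e)"
    unfolding q_def e_def s_def by (rule grem_p_fluct_or_mean[OF ak \<alpha>k \<beta>])
  have e_eq: "e = a k * (s k)\<^sup>2 / 2 + a k * ((Re \<beta>)\<^sup>2 - (Im \<beta>)\<^sup>2) / 2" by (simp add: e_def sk(2))
  have fluct: "ln (\<alpha> k) + (r * Re \<beta>)\<^sup>2 * a k / 2 = r * fluct_exponent (a k) (s k) \<beta>"
    unfolding r_def sk(2) using critical_moment_fluct[OF sk(1) \<beta>] .
  \<comment> \<open>The exponent q dominates that of the fluctuations always and that of the mean if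
    r > 1, which is precisely what \<open>moment_rate_branching\<close> asks for.\<close>
  have ge: "fluct_exponent (a k) (s k) \<beta> \<le> q" "r > 1 \<Longrightarrow> e \<le> q"
    using not_fluct_dominates(2)[OF _ sk(1) \<beta> ak] fluct_dominates_mean_le[OF _ sk(1) \<beta> ak]
    unfolding q e_eq r_def by (auto split: if_splits intro: less_imp_le)
  define B where "B n = branching M (\<beta> * of_real (sqrt (real n * a k))) (N n k) (subtrees m n)" for n
  have sub: "subtrees (Suc m) n \<subseteq> B n" for n
    unfolding B_def k_def using Suc.prems by (intro subtrees_Suc)
  note Nk = N[OF k(1)]
  have M1: "moment_rate M r (q + p_rest m) B"
    unfolding B_def
  proof (rule moment_rate_branching[OF Nk \<alpha>k _ W r])
    show "ln (\<alpha> k) + (r * Re \<beta>)\<^sup>2 * a k / 2 \<le> r * q"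
      unfolding fluct using ge(1) r by (intro mult_left_mono) auto
  qed (use ge ak in \<open>auto simp: e_def\<close>)
  have L1: "lower_rate M (q + p_rest m) B \<and>
    ((\<forall>j\<in>{k..d}. \<not> fluct_dominates (s j) \<beta>) \<longrightarrow> mean_rate M (q + p_rest m) B)"
  proof (cases "fluct_dominates (s k) \<beta>")
    case True
    have "lower_rate M (q + p_rest m) B"
      unfolding B_def
    proof (rule lower_rate_branching_fluct[OF Nk \<alpha>k ak sk(2) \<beta> _ W r(1) IH(2)])
      show "Im \<beta> \<noteq> 0 \<or> 0 < Re \<beta> \<and> (\<forall>n. \<forall>W\<in>subtrees m n. \<forall>\<omega>. Im (W \<omega>) = 0)"
      proof (cases "Im \<beta> = 0")
        case im: True
        have "Re \<beta> \<noteq> 0"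
          using True im sk(1) by (auto simp: fluct_dominates_def)
        moreover have "weight n j \<in> \<real>" for n j
          unfolding weight_def using im by (intro Reals_mult) (auto simp: complex_is_Real_iff)
        then have "subtree_sum (weight n) (N n) x m w \<in> \<real>" for n x w
          by (intro subtree_sum_in_Reals)
        then have "\<forall>n. \<forall>W\<in>subtrees m n. \<forall>\<omega>. Im (W \<omega>) = 0"
          by (auto simp: subtrees_def complex_is_Real_iff)
        ultimately show ?thesis using \<beta> by auto
      qed simp
      show "\<exists>y\<ge>0. y < s k \<and> q - \<epsilon> \<le> a k * ((s k)\<^sup>2 - y\<^sup>2) / 4 + a k * Re \<beta> * y" if "\<epsilon> > 0" for \<epsilon>
        unfolding q using True fluct_exponent_approx[OF sk(1) \<beta> ak that] by simp
    qed
    then show ?thesis using True k(1) by auto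
  next
    case False
    have all: "\<forall>j\<in>{Suc k..d}. \<not> fluct_dominates (s j) \<beta>"
      using not_fluct_dominates_mono[OF False _ sk(1) \<beta>] s_less k(1) by auto
    have r1: "r > 1" using not_fluct_dominates(1)[OF False sk(1) \<beta> ak] by (simp add: r_def)
    have qe: "q = e" using False q by simp
    have mean: "mean_rate M (e + p_rest m) B"
      unfolding B_def e_def
      using mean_rate_branching[OF Nk \<alpha>k less_imp_le[OF ak] W IH(3)[OF all] r1 r(2)] .
    have "lower_rate M (e + p_rest m) B"
      unfolding B_def
    proof (rule lower_rate_branching_mean[OF Nk \<alpha>k less_imp_le[OF ak] W r1 r(2) mean[unfolded B_def]])
      show "ln (\<alpha> k) + (r * Re \<beta>)\<^sup>2 * a k / 2 < r * e"
        unfolding fluct using not_fluct_dominates(2)[OF False sk(1) \<beta> ak] r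
        by (intro mult_strict_left_mono) (auto simp: e_eq)
    qed
    then show ?thesis using mean qe by simp
  qed
  show ?case
    unfolding r_eq p_eq k(2)
    using moment_rate_subset[where \<V> = "subtrees (Suc m)", OF M1 sub] L1 lower_rate_subset[where \<V> = "subtrees (Suc m)", OF _ sub] mean_rate_subset[where \<V> = "subtrees (Suc m)", OF _ sub] by blast
qed

end

section \<open>Convergence in probability and in mean\<close>

lemma std_normal_interval_le:
  assumes "r \<ge> 0"
  shows "measure std_normal_distribution {c - r..c + r} \<le> 2 * r"
proof -
  have "emeasure std_normal_distribution {c - r..c + r} =
      (\<integral>\<^sup>+x. ennreal (std_normal_density x) * indicator {c - r..c + r} x \<partial>lborel)"
    by (subst emeasure_density) auto
  also have "\<dots> \<le> (\<integral>\<^sup>+x. indicator {c - r..c + r} x \<partial>lborel)"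
  proof (rule nn_integral_mono)
    fix x :: real
    have "1 / sqrt (2 * pi) \<le> 1" using pi_gt3 by (simp add: real_le_rsqrt)
    then have "std_normal_density x \<le> 1 * 1"
      unfolding std_normal_density_def by (intro mult_mono) auto
    then have "ennreal (std_normal_density x) \<le> 1" by simp
    then show "ennreal (std_normal_density x) * indicator {c - r..c + r} x \<le> indicator {c - r..c + r} x"
      by (auto simp: indicator_def)
  qed
  also have "\<dots> = ennreal (2 * r)" using assms by simp
  finally show ?thesis using assms by (simp add: measure_def enn2real_leI)
qed

lemma std_normal_abs_ge_le:
  assumes R: "R > 0"
  shows "measure std_normal_distribution {x. R \<le> \<bar>x\<bar>} \<le> 1 / R\<^sup>2"
proof -
  have eq: "{x. R \<le> \<bar>x\<bar>} = {x \<in> space std_normal_distribution. R\<^sup>2 \<le> x\<^sup>2}"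
    using R by (auto simp: abs_le_square_iff[symmetric])
  have "measure std_normal_distribution {x \<in> space std_normal_distribution. R\<^sup>2 \<le> x\<^sup>2} \<le>
      (LINT x|std_normal_distribution. x\<^sup>2) / R\<^sup>2"
    using R integrable_std_normal_distribution_moment[of 2]
    by (intro integral_Markov_inequality_measure[where A = "{}"]) auto
  also have "(LINT x|std_normal_distribution. x\<^sup>2) = 1"
    using std_normal_distribution_even_moments(1)[of 1] by simp
  finally show ?thesis by (simp add: eq)
qed

text \<open>The set lies within 3 * \<eta> / T of the zeros of the sine. Cutting at |x| = R costs 1
  / R^2 = sqrt \<eta>; inside, at most 2 * K + 1 \<le> 2 * T * R + 15 zeros matter, each with
  measure at most 6 * \<eta> / T. With R = \<eta> powr (-1/4) the sum is at most sqrt \<eta> + 12 *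
  R * \<eta> + 90 * \<eta> / T, which explains 13 and 90.\<close>

lemma std_normal_sin_small:
  assumes T: "T0 > 0" "T \<ge> T0" and \<theta>: "\<bar>\<theta>\<bar> \<le> pi" and \<eta>: "0 < \<eta>" "\<eta> \<le> 1"
  shows "measure std_normal_distribution {x. \<bar>sin (T * x + \<theta>)\<bar> \<le> \<eta>} \<le> (13 + 90 / T0) * sqrt \<eta>"
proof -
  interpret N: prob_space std_normal_distribution by (rule prob_space_normal_density) simp
  define R where "R = \<eta> powr (-1/4)"
  have R: "R \<ge> 1" using \<eta> by (simp add: R_def powr_minus_divide powr_le1)
  \<comment> \<open>The zero nearest to a point with |x| < R has an index k with |k| * pi \<le> T *
    R + 3 * pi / 2, and 3 * pi / 2 < 6.\<close>
  define K where "K = \<lceil>T * R + 6\<rceil>"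
  have K: "T * R + 6 \<le> of_int K" "of_int K \<le> T * R + 7" by (auto simp: K_def) linarith
  define \<delta> where "\<delta> = 3 * \<eta> / T"
  have \<delta>: "\<delta> \<ge> 0" using T \<eta> by (simp add: \<delta>_def)
  define I where "I k = {(of_int k * pi - \<theta>) / T - \<delta>..(of_int k * pi - \<theta>) / T + \<delta>}" for k :: int
  have cover: "{x. \<bar>sin (T * x + \<theta>)\<bar> \<le> \<eta>} \<subseteq> {x. R \<le> \<bar>x\<bar>} \<union> (\<Union>k\<in>{-K..K}. I k)"
  proof
    fix x assume "x \<in> {x. \<bar>sin (T * x + \<theta>)\<bar> \<le> \<eta>}"
    then have x: "\<bar>sin (T * x + \<theta>)\<bar> \<le> \<eta>" by simp
    show "x \<in> {x. R \<le> \<bar>x\<bar>} \<union> (\<Union>k\<in>{-K..K}. I k)"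
    proof (cases "R \<le> \<bar>x\<bar>")
      case False
      define y where "y = T * x + \<theta>"
      define k where "k = round (y / pi)"
      define v where "v = y - of_int k * pi"
      have "\<bar>of_int k - y / pi\<bar> \<le> 1 / 2" unfolding k_def by (rule of_int_round_abs_le)
      then have "\<bar>of_int k - y / pi\<bar> * pi \<le> 1 / 2 * pi" by (intro mult_right_mono) auto
      also have "\<bar>of_int k - y / pi\<bar> * pi = \<bar>(of_int k - y / pi) * pi\<bar>" by (simp add: abs_mult)
      also have "(of_int k - y / pi) * pi = - v" by (simp add: v_def field_simps)
      finally have v: "\<bar>v\<bar> \<le> pi / 2" by simp
      have "\<bar>sin v\<bar> = \<bar>sin y\<bar>"
        unfolding v_def sin_diff by (simp add: abs_mult mult.commute[of _ pi] sin_int_times_real cos_int_times_real)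
      moreover have "\<bar>v\<bar> / 3 \<le> \<bar>sin v\<bar>" using v pi_half_less_two by (intro abs_sin_ge_third) linarith
      ultimately have v3: "\<bar>v\<bar> \<le> 3 * \<eta>" using x by (simp add: y_def)
      have "x - (of_int k * pi - \<theta>) / T = v / T" using T by (simp add: v_def y_def field_simps)
      then have "\<bar>x - (of_int k * pi - \<theta>) / T\<bar> \<le> \<delta>"
        using v3 T by (simp add: \<delta>_def abs_divide divide_right_mono)
      then have xI: "x \<in> I k" by (auto simp: I_def abs_le_iff)
      have "\<bar>y\<bar> \<le> T * R + pi"
      proof -
        have "\<bar>y\<bar> \<le> \<bar>T * x\<bar> + \<bar>\<theta>\<bar>" unfolding y_def by simp
        moreover have "\<bar>T * x\<bar> \<le> T * R"
          using False T unfolding abs_mult by (intro mult_mono) auto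
        ultimately show ?thesis using \<theta> by linarith
      qed
      then have "\<bar>of_int k * pi\<bar> \<le> T * R + pi + pi / 2" using v by (simp add: v_def abs_if split: if_splits)
      also have "\<dots> \<le> of_int K" using K pi_less_4 by linarith
      finally have "\<bar>of_int k\<bar> * pi \<le> of_int K" by (simp add: abs_mult)
      moreover have "\<bar>of_int k :: real\<bar> * 1 \<le> \<bar>of_int k\<bar> * pi" using pi_gt3 by (intro mult_left_mono) auto
      ultimately have "\<bar>of_int k :: real\<bar> \<le> of_int K" by simp
      then have "\<bar>k\<bar> \<le> K" by (simp only: of_int_abs[symmetric] of_int_le_iff)
      then have "k \<in> {-K..K}" by (simp add: abs_le_iff)
      then show ?thesis using xI by blast
    qed simp
  qed
  have "N.prob {x. \<bar>sin (T * x + \<theta>)\<bar> \<le> \<eta>} \<le> N.prob ({x. R \<le> \<bar>x\<bar>} \<union> (\<Union>k\<in>{-K..K}. I k))"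
    by (rule N.finite_measure_mono[OF cover]) (auto simp: I_def)
  also have "\<dots> \<le> N.prob {x. R \<le> \<bar>x\<bar>} + N.prob (\<Union>k\<in>{-K..K}. I k)"
    by (rule measure_Un_le) (auto simp: I_def)
  also have "N.prob (\<Union>k\<in>{-K..K}. I k) \<le> (\<Sum>k\<in>{-K..K}. N.prob (I k))"
    by (rule N.finite_measure_subadditive_finite) (auto simp: I_def)
  also have "\<dots> \<le> (\<Sum>k\<in>{-K..K}. 2 * \<delta>)"
    unfolding I_def by (intro sum_mono std_normal_interval_le \<delta>)
  also have "\<dots> = (2 * of_int K + 1) * (2 * \<delta>)"
  proof -
    have "K \<ge> 0" using K(1) T R by (metis add_nonneg_nonneg dual_order.trans less_eq_real_def mult_nonneg_nonneg
          of_int_0_le_iff zero_le_numeral zero_le_one)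
    then show ?thesis by simp
  qed
  also have "\<dots> \<le> (2 * (T * R + 7) + 1) * (2 * \<delta>)" using K \<delta> by (intro mult_right_mono) auto
  also have "\<dots> = 12 * (R * \<eta>) + 90 / T * \<eta>" using T by (simp add: \<delta>_def field_simps)
  also have "N.prob {x. R \<le> \<bar>x\<bar>} \<le> 1 / R\<^sup>2" using R by (intro std_normal_abs_ge_le) auto
  also have "1 / R\<^sup>2 = sqrt \<eta>"
  proof -
    have "R\<^sup>2 = \<eta> powr (-1/2)" using \<eta> by (simp add: R_def power2_eq_square flip: powr_add)
    then show ?thesis using \<eta> by (simp add: powr_minus_divide powr_half_sqrt)
  qed
  also have "R * \<eta> \<le> sqrt \<eta>"
  proof -
    have "R * \<eta> = \<eta> powr (-1/4) * \<eta> powr 1" using \<eta> by (simp add: R_def)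
    also have "\<dots> = \<eta> powr (-1/4 + 1)" by (rule powr_add[symmetric])
    also have "\<dots> = \<eta> powr (3/4)" by simp
    also have "\<dots> \<le> \<eta> powr (1/2)" using \<eta> by (intro powr_mono') auto
    finally show ?thesis using \<eta> by (simp add: powr_half_sqrt)
  qed
  also have "90 / T * \<eta> \<le> 90 / T0 * sqrt \<eta>"
  proof (intro mult_mono)
    show "90 / T \<le> 90 / T0" using T by (intro divide_left_mono) auto
    show "\<eta> \<le> sqrt \<eta>" using \<eta> by (metis mult_left_le power2_eq_square real_le_rsqrt less_imp_le)
  qed (use T \<eta> in auto)
  finally show ?thesis by (simp add: algebra_simps)
qed

text \<open>Dyadic layers: if (1/2)^(m + 1) < s \<le> (1/2)^m, the m-th term alone suffices. At s =
  0 both sides are infinite, because \<open>inverse 0 = \<infinity>\<close> in the extended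
  nonnegative reals and every layer contains 0. In this form the bound can be integrated term by
  term.\<close>

lemma inverse_quarter_power_le_dyadic_sum:
  fixes s :: real
  assumes "0 \<le> s" "s \<le> 1"
  shows "inverse (ennreal (s powr (1/4))) \<le> (\<Sum>m. ennreal (2 powr ((real m + 1) / 4)) * indicator {s. s \<le> (1/2) ^ m} s)"
proof (cases "s = 0")
  case True
  have "(\<Sum>m. ennreal (2 powr ((real m + 1) / 4)) * indicator {s. s \<le> (1/2) ^ m} s) \<ge> (\<Sum>m::nat. 1)"
    using True by (intro suminf_le) (auto simp: ge_one_powr_ge_zero)
  moreover have "(\<Sum>m::nat. 1::ennreal) = \<infinity>"
    by (simp add: suminf_eq_SUP ennreal_SUP_of_nat_eq_top)
  ultimately show ?thesis by (simp add: top_unique)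
next
  case False
  then have s: "s > 0" using assms by simp
  have "(\<lambda>m. (1/2 :: real) ^ m) \<longlonglongrightarrow> 0" by (rule LIMSEQ_power_zero) simp
  then have "\<forall>\<^sub>F m in sequentially. (1/2 :: real) ^ m < s" using s by (rule order_tendstoD)
  then obtain m0 where m0: "(1/2 :: real) ^ m0 < s" by (auto simp: eventually_sequentially)
  define m1 where "m1 = (LEAST m. (1/2 :: real) ^ m < s)"
  have m1: "(1/2 :: real) ^ m1 < s" unfolding m1_def using m0 by (rule LeastI)
  have "m1 \<noteq> 0" using m1 assms by (auto intro: ccontr)
  then obtain m where m: "m1 = Suc m" by (cases m1) auto
  have le: "s \<le> (1/2) ^ m"
    using not_less_Least[of m "\<lambda>m. (1/2 :: real) ^ m < s"] m unfolding m1_def[symmetric] by auto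
  have "((1/2) ^ Suc m) powr (1/4) \<le> s powr (1/4)" using m1 m by (intro powr_mono2) auto
  then have "inverse (s powr (1/4)) \<le> inverse (((1/2) ^ Suc m) powr (1/4))"
    using s by (intro le_imp_inverse_le) auto
  also have "\<dots> = 2 powr ((real m + 1) / 4)"
  proof -
    have "(2 :: real) powr (- real (Suc m)) = inverse (2 powr real (Suc m))" by (rule powr_minus)
    also have "\<dots> = (1/2) ^ Suc m" by (subst powr_realpow) (simp_all add: power_one_over inverse_eq_divide)
    finally have "((1/2 :: real) ^ Suc m) = 2 powr (- (real m + 1))" by (simp add: add.commute)
    then have Y: "((1/2 :: real) ^ Suc m) powr (- (1/4)) = 2 powr ((- (real m + 1)) * (- (1/4)))"
      by (simp only: powr_powr)
    have "inverse (((1/2 :: real) ^ Suc m) powr (1/4)) = ((1/2) ^ Suc m) powr (- (1/4))"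
      by (rule powr_minus[symmetric])
    also note Y
    also have "(- (real m + 1)) * (- (1/4)) = (real m + 1) / 4" by (simp add: field_simps)
    finally show ?thesis .
  qed
  finally have 1: "inverse (ennreal (s powr (1/4))) \<le> ennreal (2 powr ((real m + 1) / 4))"
    using s by (simp add: inverse_ennreal)
  also have "\<dots> = (\<Sum>j\<in>{m}. ennreal (2 powr ((real j + 1) / 4)) * indicator {s. s \<le> (1/2) ^ j} s)"
    using le by simp
  also have "\<dots> \<le> (\<Sum>j. ennreal (2 powr ((real j + 1) / 4)) * indicator {s. s \<le> (1/2) ^ j} s)"
    by (rule sum_le_suminf) auto
  finally show ?thesis .
qed

text \<open>The m-th layer contributes 2^((m + 1) / 4) times a measure of order 2^(- m / 2), a
  geometric series of ratio 2^(-1/4); the exponent 1/4 only has to stay below the 1/2 of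
  \<open>std_normal_sin_small\<close>. The constant is uniform over frequencies bounded away from 0
  and over directions u. Negative frequencies follow by conjugation.\<close>

lemma nn_integral_inverse_sin:
  assumes T0: "T0 > 0"
  shows "\<exists>C. \<forall>T u. T0 \<le> \<bar>T\<bar> \<longrightarrow> cmod u = 1 \<longrightarrow>
    (\<integral>\<^sup>+x. inverse (ennreal (\<bar>Im (cis (T * x) * u)\<bar> powr (1/4))) \<partial>std_normal_distribution) \<le> ennreal C"
proof -
  interpret N: prob_space std_normal_distribution by (rule prob_space_normal_density) simp
  define A where "A = 13 + 90 / T0"
  have A: "A > 0" using T0 by (simp add: A_def add_pos_pos)
  define c where "c m = 2 powr ((real m + 1) / 4) * (A * sqrt ((1/2) ^ m))" for m
  have c_eq: "c m = A * 2 powr (1/4) * (2 powr (-1/4)) ^ m" for m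
  proof -
    have "sqrt ((1/2) ^ m) = 2 powr (- real m / 2)"
      by (simp add: powr_half_sqrt[symmetric] powr_realpow[symmetric] powr_powr powr_divide powr_minus_divide
          power_divide real_sqrt_divide)
    then have "c m = A * (2 powr ((real m + 1) / 4) * 2 powr (- real m / 2))" by (simp add: c_def)
    also have "\<dots> = A * 2 powr ((real m + 1) / 4 + - real m / 2)" by (simp only: powr_add)
    also have "(real m + 1) / 4 + - real m / 2 = 1/4 + real m * (-1/4)" by (simp add: field_simps)
    also have "2 powr (1/4 + real m * (-1/4)) = 2 powr (1/4) * 2 powr (real m * (-1/4))" by (rule powr_add)
    also have "2 powr (real m * (-1/4)) = (2 powr (-1/4)) ^ m"
      by (simp add: powr_powr powr_realpow[symmetric] mult.commute)
    finally show ?thesis by simp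
  qed
  have sc: "summable c"
  proof -
    have "2 powr (-1/4 :: real) < 1" by (rule powr_less_one) auto
    then show ?thesis unfolding c_eq[abs_def] by (intro summable_mult summable_geometric) auto
  qed
  have c0: "c m \<ge> 0" for m using A by (simp add: c_def)
  have pos: "(\<integral>\<^sup>+x. inverse (ennreal (\<bar>Im (cis (T * x) * u)\<bar> powr (1/4))) \<partial>std_normal_distribution) \<le> ennreal (suminf c)"
    if T: "T0 \<le> T" and u: "cmod u = 1" for T u
  proof -
    define \<theta> where "\<theta> = Arg u"
    have u_eq: "u = cis \<theta>" using u rcis_cmod_Arg[of u] by (simp add: \<theta>_def rcis_def)
    have \<theta>: "\<bar>\<theta>\<bar> \<le> pi" using Arg_bounded[of u] by (auto simp: \<theta>_def)
    have Im_eq: "Im (cis (T * x) * u) = sin (T * x + \<theta>)" for x by (simp add: u_eq cis_mult)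
    have "(\<integral>\<^sup>+x. inverse (ennreal (\<bar>sin (T * x + \<theta>)\<bar> powr (1/4))) \<partial>std_normal_distribution) \<le>
      (\<integral>\<^sup>+x. (\<Sum>m. ennreal (2 powr ((real m + 1) / 4)) * indicator {s. s \<le> (1/2) ^ m} \<bar>sin (T * x + \<theta>)\<bar>) \<partial>std_normal_distribution)"
      by (intro nn_integral_mono inverse_quarter_power_le_dyadic_sum) auto
    also have "\<dots> = (\<integral>\<^sup>+x. (\<Sum>m. ennreal (2 powr ((real m + 1) / 4)) * indicator {x. \<bar>sin (T * x + \<theta>)\<bar> \<le> (1/2) ^ m} x) \<partial>std_normal_distribution)"
      by (intro nn_integral_cong suminf_cong) (auto simp: indicator_def)
    also have "\<dots> = (\<Sum>m. \<integral>\<^sup>+x. ennreal (2 powr ((real m + 1) / 4)) * indicator {x. \<bar>sin (T * x + \<theta>)\<bar> \<le> (1/2) ^ m} x \<partial>std_normal_distribution)"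
      by (rule nn_integral_suminf) measurable
    also have "\<dots> = (\<Sum>m. ennreal (2 powr ((real m + 1) / 4)) * emeasure std_normal_distribution {x. \<bar>sin (T * x + \<theta>)\<bar> \<le> (1/2) ^ m})"
      by (intro suminf_cong nn_integral_cmult_indicator) simp
    also have "\<dots> \<le> (\<Sum>m. ennreal (c m))"
    proof (rule suminf_le)
      fix m
      have "N.prob {x. \<bar>sin (T * x + \<theta>)\<bar> \<le> (1/2) ^ m} \<le> A * sqrt ((1/2) ^ m)"
        unfolding A_def by (rule std_normal_sin_small[OF T0 T \<theta>]) (auto simp: power_le_one)
      then have "ennreal (2 powr ((real m + 1) / 4)) * ennreal (N.prob {x. \<bar>sin (T * x + \<theta>)\<bar> \<le> (1/2) ^ m})
          \<le> ennreal (2 powr ((real m + 1) / 4)) * ennreal (A * sqrt ((1/2) ^ m))"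
        by (intro mult_left_mono ennreal_leI) auto
      then show "ennreal (2 powr ((real m + 1) / 4)) * emeasure std_normal_distribution {x. \<bar>sin (T * x + \<theta>)\<bar> \<le> (1/2) ^ m}
          \<le> ennreal (c m)"
        by (simp add: N.emeasure_eq_measure c_def ennreal_mult')
    qed auto
    also have "\<dots> = ennreal (suminf c)" by (rule suminf_ennreal2[OF c0 sc])
    finally show ?thesis unfolding Im_eq .
  qed
  show ?thesis
  proof (intro exI[of _ "suminf c"] allI impI)
    fix T :: real and u :: complex assume T: "T0 \<le> \<bar>T\<bar>" and u: "cmod u = 1"
    show "(\<integral>\<^sup>+x. inverse (ennreal (\<bar>Im (cis (T * x) * u)\<bar> powr (1/4))) \<partial>std_normal_distribution) \<le> ennreal (suminf c)"
    proof (cases "T \<ge> 0")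
      case True
      then show ?thesis using T u by (intro pos) auto
    next
      case False
      have "\<bar>Im (cis (T * x) * u)\<bar> = \<bar>Im (cis (- T * x) * cnj u)\<bar>" for x
      proof -
        have "cis (- T * x) * cnj u = cnj (cis (T * x) * u)" by (simp add: cis_cnj)
        then show ?thesis by simp
      qed
      then show ?thesis using pos[of "- T" "cnj u"] T u False by simp
    qed
  qed
qed

section \<open>Uniform integrability and convergence in L^q\<close>

lemma tendsto_0_ennrealI:
  fixes f :: "nat \<Rightarrow> ennreal"
  assumes "\<And>e. e > 0 \<Longrightarrow> \<forall>\<^sub>F n in sequentially. f n \<le> ennreal e"
  shows "f \<longlonglongrightarrow> 0"
proof (rule order_tendstoI)
  fix x :: ennreal assume "0 < x"
  then obtain y where y: "0 < y" "y < x" using dense by blast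
  then have "y \<noteq> \<top>" by (auto simp: less_top[symmetric] dest: less_trans[OF _ _])
  then obtain e where e: "y = ennreal e" "e \<ge> 0" by (cases y) auto
  then have "e > 0" using y by (simp add: ennreal_less_zero_iff)
  from assms[OF this] show "\<forall>\<^sub>F n in sequentially. f n < x"
    by eventually_elim (use y e in auto)
qed auto

lemma powr_le_exp:
  fixes q \<kappa> :: real
  assumes "q \<ge> 1" "\<kappa> > 0"
  shows "\<exists>A\<ge>0. \<forall>x\<ge>0. x powr q \<le> A * exp (\<kappa> * x)"
proof -
  define k where "k = nat \<lceil>q\<rceil>"
  have k: "q \<le> real k" by (simp add: k_def) linarith
  have "x powr q \<le> (1 + fact k / \<kappa> ^ k) * exp (\<kappa> * x)" if x: "x \<ge> 0" for x
  proof -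
    have "x powr q \<le> 1 + x ^ k"
    proof (cases "x \<le> 1")
      case True
      then have "x powr q \<le> 1" using x assms by (intro powr_le1) auto
      then show ?thesis using x by (smt (verit) zero_le_power)
    next
      case False
      then have "x powr q \<le> x powr real k" using k by (intro powr_mono) auto
      then show ?thesis using False by (simp add: powr_realpow)
    qed
    also have "\<dots> \<le> exp (\<kappa> * x) + fact k / \<kappa> ^ k * exp (\<kappa> * x)"
    proof (intro add_mono)
      show "1 \<le> exp (\<kappa> * x)" using assms x by simp
      have "(\<kappa> * x) ^ k / fact k \<le> (\<Sum>n\<le>k. (\<kappa> * x) ^ n / fact n)"
        using assms x by (intro member_le_sum) auto
      also have "\<dots> \<le> exp (\<kappa> * x)"
      proof -
        have "(\<Sum>n\<in>{..k}. (\<kappa> * x) ^ n /\<^sub>R fact n) \<le> (\<Sum>n. (\<kappa> * x) ^ n /\<^sub>R fact n)"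
          using assms x by (intro sum_le_suminf summable_exp_generic) auto
        then show ?thesis by (simp add: exp_def divide_inverse mult.commute scaleR_conv_of_real)
      qed
      finally show "x ^ k \<le> fact k / \<kappa> ^ k * exp (\<kappa> * x)"
        using assms by (simp add: power_mult_distrib field_simps)
    qed
    finally show ?thesis by (simp add: algebra_simps)
  qed
  moreover have "1 + fact k / \<kappa> ^ k \<ge> 0" using assms by simp
  ultimately show ?thesis by blast
qed

text \<open>Bounded exponential moments make the powers of the error uniformly integrable.\<close>

lemma (in prob_space) tendsto_in_LqI:
  assumes prob: "tendsto_in_probability M X (\<lambda>_. p)" and \<kappa>: "\<kappa> > 0" and q: "q \<ge> 1"
    and exp: "\<forall>\<^sub>F n in sequentially. (\<integral>\<^sup>+\<omega>. ennreal (exp (\<kappa> * \<bar>X n \<omega>\<bar>)) \<partial>M) \<le> ennreal C"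
  shows "tendsto_in_Lq M q X (\<lambda>_. p)"
proof -
  have X[measurable]: "X n \<in> borel_measurable M" for n
    using prob by (simp add: tendsto_in_probability_def)
  obtain A where A: "A \<ge> 0" "\<And>x. x \<ge> 0 \<Longrightarrow> x powr q \<le> A * exp (\<kappa> / 2 * x)"
    using powr_le_exp[of q "\<kappa> / 2"] \<kappa> q by auto
  have "(\<lambda>n. \<integral>\<^sup>+\<omega>. ennreal (\<bar>X n \<omega> - p\<bar> powr q) \<partial>M) \<longlonglongrightarrow> 0"
  proof (rule tendsto_0_ennrealI)
    fix e :: real assume e: "e > 0"
    define C' where "C' = max C 0"
    have C': "C' \<ge> 0" "C \<le> C'" by (auto simp: C'_def)
    define B where "B = A * exp (\<kappa> * \<bar>p\<bar>) * C'"
    define \<epsilon> where "\<epsilon> = (e / 3) powr (1 / q)"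
    have \<epsilon>: "\<epsilon> > 0" "\<epsilon> powr q = e / 3" using e q by (auto simp: \<epsilon>_def powr_powr)
    have "((\<lambda>K. B * exp (- (\<kappa> / 2 * K))) \<longlongrightarrow> B * 0) at_top"
      using \<kappa> by (intro tendsto_intros) real_asymp
    then have "\<forall>\<^sub>F K in at_top. B * exp (- (\<kappa> / 2 * K)) < e / 3"
      by (rule order_tendstoD) (use e in simp)
    then have "\<forall>\<^sub>F K in at_top. K > 0 \<and> B * exp (- (\<kappa> / 2 * K)) < e / 3"
      using eventually_gt_at_top[of 0] by eventually_elim auto
    then obtain K where K: "K > 0" "B * exp (- (\<kappa> / 2 * K)) < e / 3"
      by (auto simp: eventually_at_top_linorder)
    define S where "S n = {\<omega>\<in>space M. \<bar>X n \<omega> - p\<bar> > \<epsilon>}" for n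
    have S[measurable]: "S n \<in> sets M" for n unfolding S_def by measurable
    have "(\<lambda>n. prob (S n)) \<longlonglongrightarrow> 0"
      using prob \<epsilon>(1) unfolding tendsto_in_probability_def S_def by blast
    then have "(\<lambda>n. K powr q * prob (S n)) \<longlonglongrightarrow> K powr q * 0" by (intro tendsto_intros)
    then have "\<forall>\<^sub>F n in sequentially. K powr q * prob (S n) < e / 3"
      by (rule order_tendstoD) (use e in simp)
    with exp show "\<forall>\<^sub>F n in sequentially. (\<integral>\<^sup>+\<omega>. ennreal (\<bar>X n \<omega> - p\<bar> powr q) \<partial>M) \<le> ennreal e"
    proof eventually_elim
      case (elim n)
      have pt: "ennreal (\<bar>X n \<omega> - p\<bar> powr q) \<le> ennreal (e / 3) + ennreal (K powr q) * indicator (S n) \<omega> +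
          ennreal (A * exp (\<kappa> * \<bar>p\<bar>) * exp (- (\<kappa> / 2 * K))) * ennreal (exp (\<kappa> * \<bar>X n \<omega>\<bar>))"
        if \<omega>: "\<omega> \<in> space M" for \<omega>
      proof -
        define D where "D = \<bar>X n \<omega> - p\<bar>"
        \<comment> \<open>Small errors contribute at most e / 3. Moderate ones are bounded by K powr
          q on an event of small probability. For large ones half of \<kappa> pays for the power,
          and the other half yields the decay exp (- \<kappa> * K / 2).\<close>
        consider "D \<le> \<epsilon>" | "D > \<epsilon>" "D \<le> K" | "D > K" by linarith
        then have "D powr q \<le> e / 3 + K powr q * indicator (S n) \<omega> +
          A * exp (\<kappa> * \<bar>p\<bar>) * exp (- (\<kappa> / 2 * K)) * exp (\<kappa> * \<bar>X n \<omega>\<bar>)"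
        proof cases
          case 1
          then have "D powr q \<le> \<epsilon> powr q" using q by (intro powr_mono2) (auto simp: D_def)
          then show ?thesis using \<epsilon> A(1) by (intro order_trans[OF _ add_increasing2[OF _ add_increasing2]]) auto
        next
          case 2
          then have "D powr q \<le> K powr q" using q by (intro powr_mono2) (auto simp: D_def)
          moreover have "\<omega> \<in> S n" using 2 \<omega> by (simp add: S_def D_def)
          moreover have "0 \<le> A * exp (\<kappa> * \<bar>p\<bar>) * exp (- (\<kappa> / 2 * K)) * exp (\<kappa> * \<bar>X n \<omega>\<bar>)" using A(1) by simp
          ultimately show ?thesis using e by simp
        next
          case 3
          have "D powr q \<le> A * exp (\<kappa> / 2 * D)" by (rule A(2)) (simp add: D_def)
          also have "\<dots> \<le> A * exp (\<kappa> * \<bar>p\<bar> + - (\<kappa> / 2 * K) + \<kappa> * \<bar>X n \<omega>\<bar>)"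
          proof (intro mult_left_mono A(1))
            have "\<kappa> / 2 * D = \<kappa> * D - \<kappa> / 2 * D" by simp
            also have "\<dots> \<le> \<kappa> * (\<bar>X n \<omega>\<bar> + \<bar>p\<bar>) - \<kappa> / 2 * K"
              using 3 \<kappa> by (intro diff_mono mult_left_mono) (auto simp: D_def)
            finally show "exp (\<kappa> / 2 * D) \<le> exp (\<kappa> * \<bar>p\<bar> + - (\<kappa> / 2 * K) + \<kappa> * \<bar>X n \<omega>\<bar>)"
              by (simp add: algebra_simps)
          qed
          also have "\<dots> = A * exp (\<kappa> * \<bar>p\<bar>) * exp (- (\<kappa> / 2 * K)) * exp (\<kappa> * \<bar>X n \<omega>\<bar>)"
            by (simp only: exp_add mult.assoc)
          finally show ?thesis using e by (simp add: add_increasing indicator_def)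
        qed
        then show ?thesis using A(1) e
          by (cases "\<omega> \<in> S n") (simp_all add: D_def[symmetric] ennreal_plus[symmetric] ennreal_mult[symmetric] ennreal_leI
              del: ennreal_plus)
      qed
      have "(\<integral>\<^sup>+\<omega>. ennreal (\<bar>X n \<omega> - p\<bar> powr q) \<partial>M) \<le>
        (\<integral>\<^sup>+\<omega>. ennreal (e / 3) + ennreal (K powr q) * indicator (S n) \<omega> +
          ennreal (A * exp (\<kappa> * \<bar>p\<bar>) * exp (- (\<kappa> / 2 * K))) * ennreal (exp (\<kappa> * \<bar>X n \<omega>\<bar>)) \<partial>M)"
        by (rule nn_integral_mono) (rule pt)
      also have "\<dots> = ennreal (e / 3) + ennreal (K powr q) * emeasure M (S n) +
          ennreal (A * exp (\<kappa> * \<bar>p\<bar>) * exp (- (\<kappa> / 2 * K))) * (\<integral>\<^sup>+\<omega>. ennreal (exp (\<kappa> * \<bar>X n \<omega>\<bar>)) \<partial>M)"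
        by (simp add: nn_integral_add nn_integral_cmult nn_integral_cmult_indicator emeasure_space_1)
      also have "\<dots> \<le> ennreal (e / 3) + ennreal (e / 3) + ennreal (e / 3)"
      proof (intro add_mono order_refl)
        show "ennreal (K powr q) * emeasure M (S n) \<le> ennreal (e / 3)"
          using elim(2) by (simp add: emeasure_eq_measure ennreal_mult[symmetric] ennreal_leI)
        have "ennreal (A * exp (\<kappa> * \<bar>p\<bar>) * exp (- (\<kappa> / 2 * K))) * (\<integral>\<^sup>+\<omega>. ennreal (exp (\<kappa> * \<bar>X n \<omega>\<bar>)) \<partial>M)
          \<le> ennreal (A * exp (\<kappa> * \<bar>p\<bar>) * exp (- (\<kappa> / 2 * K))) * ennreal C'"
          using elim(1) by (intro mult_left_mono order_trans[OF elim(1)] ennreal_leI C') auto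
        also have "\<dots> = ennreal (B * exp (- (\<kappa> / 2 * K)))"
          using A(1) C'(1) by (simp add: ennreal_mult[symmetric] B_def mult_ac)
        also have "\<dots> \<le> ennreal (e / 3)" using K by (intro ennreal_leI) simp
        finally show "ennreal (A * exp (\<kappa> * \<bar>p\<bar>) * exp (- (\<kappa> / 2 * K))) *
            (\<integral>\<^sup>+\<omega>. ennreal (exp (\<kappa> * \<bar>X n \<omega>\<bar>)) \<partial>M) \<le> ennreal (e / 3)" .
      qed
      also have "\<dots> = ennreal e" using e by (simp add: ennreal_plus[symmetric] del: ennreal_plus)
      finally show ?case .
    qed
  qed
  then show ?thesis using X by (simp add: tendsto_in_Lq_def)
qed

text \<open>The largest term dominates. Exponential moments of a sum are thereby reduced to those of
  its single terms, at the price of the factor \<open>card I\<close> in the exponent.\<close>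

lemma exp_sum_le_sum_exp:
  fixes y :: "'i \<Rightarrow> real"
  assumes I: "finite I" "I \<noteq> {}"
  shows "exp (\<Sum>i\<in>I. y i) \<le> (\<Sum>i\<in>I. exp (real (card I) * y i))"
proof -
  have "Max (y ` I) \<in> y ` I" using I by (intro Max_in) auto
  then obtain k where k: "k \<in> I" "Max (y ` I) = y k" by blast
  have "(\<Sum>i\<in>I. y i) \<le> real (card I) * y k"
    using I k(2) by (intro sum_bounded_above) (metis Max_ge finite_imageI imageI)
  then have "exp (\<Sum>i\<in>I. y i) \<le> exp (real (card I) * y k)" by simp
  also have "\<dots> \<le> (\<Sum>i\<in>I. exp (real (card I) * y i))"
    using I k(1) by (intro member_le_sum) auto
  finally show ?thesis .
qed

lemma exp_abs_le: "exp \<bar>x\<bar> \<le> exp x + exp (- x)" for x :: real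
  by (cases "x \<ge> 0") auto

section \<open>Convergence in probability\<close>

context grem
begin

lemma take_leaf_in_vertices:
  assumes "e \<in> grem_leaves d (N n)" "j \<in> {1..d}"
  shows "take j e \<in> grem_vertices d (N n)"
  using take_grem_leaves[OF assms(1), of j] assms(2) by (auto simp: grem_vertices_iff)

lemma measurable_grem_partition [measurable]: "grem_partition d a N \<xi> n \<beta> \<in> borel_measurable M"
proof -
  have "(\<lambda>\<omega>. grem_energy d a (\<xi> n) e \<omega>) \<in> borel_measurable M" if "e \<in> grem_leaves d (N n)" for e
    unfolding grem_energy_def
    by (intro borel_measurable_sum borel_measurable_times measurable_\<xi> take_leaf_in_vertices that) auto
  then show ?thesis
    unfolding grem_partition_def[abs_def] by (intro borel_measurable_sum) measurable
qed

lemma measurable_grem_log_partition [measurable]: "grem_log_partition d a N \<xi> \<beta> n \<in> borel_measurable M"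
  unfolding grem_log_partition_def[abs_def] by measurable

lemma moment_rest_pos: "moment_rest d > 0"
  using critical_moment_bounds(1)[OF s_facts(1) \<beta>, of 1] d by (auto simp: moment_rest_def)

lemma log_partition_tendsto_in_probability:
  "tendsto_in_probability M (grem_log_partition d a N \<xi> \<beta>) (\<lambda>_. p_rest d)"
  unfolding tendsto_in_probability_def
proof (intro conjI allI impI measurable_grem_log_partition)
  fix \<epsilon> :: real assume \<epsilon>: "\<epsilon> > 0"
  define S where "S n = {\<omega>\<in>space M. \<bar>grem_log_partition d a N \<xi> \<beta> n \<omega> - p_rest d\<bar> > \<epsilon>}" for n
  have R: "moment_rate M (moment_rest d) (p_rest d) (subtrees d)" "lower_rate M (p_rest d) (subtrees d)"
    using rates[of d] by auto
  have "(\<lambda>n. prob (S n)) \<longlonglongrightarrow> 0"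
  proof (rule order_tendstoI)
    fix \<eta> :: real assume "0 < \<eta>"
    then have \<eta>: "\<eta> / 3 > 0" by simp
    have "\<forall>\<^sub>F n in sequentially. \<forall>W\<in>subtrees d n. W \<in> borel_measurable M \<and>
        prob {\<omega>\<in>space M. cmod (W \<omega>) \<le> exp (real n * (p_rest d - \<epsilon>))} \<le> \<eta> / 3"
      using R(2) \<epsilon> \<eta> unfolding lower_rate_def by blast
    with moment_rate_upper[OF R(1) moment_rest_pos \<epsilon> \<eta>] eventually_gt_at_top[of 0]
    show "\<forall>\<^sub>F n in sequentially. prob (S n) < \<eta>"
    proof eventually_elim
      case (elim n)
      define Z where "Z = grem_partition d a N \<xi> n \<beta>"
      have Z: "Z \<in> subtrees d n" unfolding Z_def by (rule grem_partition_in_subtrees)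
      have [measurable]: "Z \<in> borel_measurable M" unfolding Z_def by measurable
      have sub: "S n \<subseteq> {\<omega>\<in>space M. cmod (Z \<omega>) \<le> exp (real n * (p_rest d - \<epsilon>))} \<union>
          {\<omega>\<in>space M. exp (real n * (p_rest d + \<epsilon>)) \<le> cmod (Z \<omega>)}"
      proof
        fix \<omega> assume "\<omega> \<in> S n"
        then have \<omega>: "\<omega> \<in> space M" "\<bar>ln (cmod (Z \<omega>)) / real n - p_rest d\<bar> > \<epsilon>"
          by (auto simp: S_def grem_log_partition_def Z_def)
        \<comment> \<open>The convention ln 0 = 0 does no harm: a vanishing partition function falls
          into the lower event.\<close>
        show "\<omega> \<in> {\<omega>\<in>space M. cmod (Z \<omega>) \<le> exp (real n * (p_rest d - \<epsilon>))} \<union>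
          {\<omega>\<in>space M. exp (real n * (p_rest d + \<epsilon>)) \<le> cmod (Z \<omega>)}"
        proof (cases "Z \<omega> = 0")
          case False
          consider "ln (cmod (Z \<omega>)) / real n \<le> p_rest d - \<epsilon>" | "p_rest d + \<epsilon> \<le> ln (cmod (Z \<omega>)) / real n"
            using \<omega>(2) by linarith
          then show ?thesis
          proof cases
            case 1
            then have "ln (cmod (Z \<omega>)) \<le> real n * (p_rest d - \<epsilon>)" using elim(2) by (simp add: field_simps)
            then have "exp (ln (cmod (Z \<omega>))) \<le> exp (real n * (p_rest d - \<epsilon>))" by (simp only: exp_le_cancel_iff)
            then show ?thesis using False \<omega>(1) by simp
          next
            case 2
            then have "real n * (p_rest d + \<epsilon>) \<le> ln (cmod (Z \<omega>))" using elim(2) by (simp add: field_simps)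
            then have "exp (real n * (p_rest d + \<epsilon>)) \<le> exp (ln (cmod (Z \<omega>)))" by (simp only: exp_le_cancel_iff)
            then show ?thesis using False \<omega>(1) by simp
          qed
        qed (use \<omega> in simp)
      qed
      have "prob (S n) \<le> prob ({\<omega>\<in>space M. cmod (Z \<omega>) \<le> exp (real n * (p_rest d - \<epsilon>))} \<union>
          {\<omega>\<in>space M. exp (real n * (p_rest d + \<epsilon>)) \<le> cmod (Z \<omega>)})"
        by (rule finite_measure_mono[OF sub]) measurable
      also have "\<dots> \<le> prob {\<omega>\<in>space M. cmod (Z \<omega>) \<le> exp (real n * (p_rest d - \<epsilon>))} +
          prob {\<omega>\<in>space M. exp (real n * (p_rest d + \<epsilon>)) \<le> cmod (Z \<omega>)}"
        by (rule measure_Un_le) measurable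
      also have "\<dots> \<le> \<eta> / 3 + \<eta> / 3"
        using elim(1)[rule_format, OF Z] elim(3)[rule_format, OF Z] by (intro add_mono) auto
      also have "\<dots> < \<eta>" using \<open>0 < \<eta>\<close> by simp
      finally show ?case .
    qed
  qed (auto intro!: always_eventually intro: less_le_trans[OF _ measure_nonneg])
  then show "(\<lambda>n. prob {\<omega>\<in>space M. \<bar>grem_log_partition d a N \<xi> \<beta> n \<omega> - p_rest d\<bar> > \<epsilon>}) \<longlonglongrightarrow> 0"
    by (simp add: S_def)
qed simp

section \<open>A negative moment from the randomness of a single leaf\<close>

definition first_leaf :: "nat list" where "first_leaf = replicate d 1"

lemma eventually_first_leaf: "\<forall>\<^sub>F n in sequentially. first_leaf \<in> grem_leaves d (N n)"
proof -
  have "\<forall>\<^sub>F n in sequentially. 1 \<le> N n j" if j: "j \<in> {1..d}" for j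
  proof -
    have "\<forall>\<^sub>F n in sequentially. 0 < real (N n j) / \<alpha> j ^ n"
      using N[OF j] by (rule order_tendstoD) simp
    then show ?thesis
      by eventually_elim (use \<alpha>[OF j] in \<open>auto simp: zero_less_divide_iff Suc_le_eq\<close>)
  qed
  then have "\<forall>\<^sub>F n in sequentially. \<forall>j\<in>{1..d}. 1 \<le> N n j"
    by (intro eventually_ball_finite) auto
  then show ?thesis
    by eventually_elim (auto simp: first_leaf_def grem_leaves_def)
qed

text \<open>Conditionally on the disorder off \<open>first_leaf\<close>, the partition function is
  \<open>w * (exp (b * x) + v)\<close> with \<open>x\<close> standard normal. Its modulus is at least the distance of
  \<open>w * exp (b * x)\<close> from the line spanned by \<open>w * v\<close>, which depends on \<open>v\<close> only through the
  direction \<open>u\<close>.\<close>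

lemma first_leaf_lower_bound:
  "\<exists>C\<ge>0. \<forall>\<^sub>F n in sequentially. \<exists>S. S \<in> borel_measurable M \<and>
    (\<forall>\<omega>. 0 \<le> S \<omega> \<and> S \<omega> \<le> 1 \<and>
      exp (Re \<beta> * (sqrt (real n) * grem_energy d a (\<xi> n) first_leaf \<omega>)) * S \<omega>
        \<le> cmod (grem_partition d a N \<xi> n \<beta> \<omega>)) \<and>
    (\<integral>\<^sup>+\<omega>. inverse (ennreal (S \<omega> powr (1/4))) \<partial>M) \<le> ennreal C"
proof (cases "Im \<beta> = 0")
  case True
  have "\<forall>\<^sub>F n in sequentially. \<exists>S. S \<in> borel_measurable M \<and>
    (\<forall>\<omega>. 0 \<le> S \<omega> \<and> S \<omega> \<le> 1 \<and>
      exp (Re \<beta> * (sqrt (real n) * grem_energy d a (\<xi> n) first_leaf \<omega>)) * S \<omega>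
        \<le> cmod (grem_partition d a N \<xi> n \<beta> \<omega>)) \<and>
    (\<integral>\<^sup>+\<omega>. inverse (ennreal (S \<omega> powr (1/4))) \<partial>M) \<le> ennreal 1"
    using eventually_first_leaf
  proof eventually_elim
    case (elim n)
    \<comment> \<open>For real \<beta> all terms of the partition function are positive, so one leaf
      bounds it from below and S = 1 works.\<close>
    have "exp (Re \<beta> * (sqrt (real n) * grem_energy d a (\<xi> n) first_leaf \<omega>))
        \<le> cmod (grem_partition d a N \<xi> n \<beta> \<omega>)" for \<omega>
    proof -
      have \<beta>': "\<beta> = of_real (Re \<beta>)" using True by (simp add: complex_eq_iff)
      have "exp (\<beta> * complex_of_real (sqrt (real n) * grem_energy d a (\<xi> n) e \<omega>)) =
          of_real (exp (Re \<beta> * (sqrt (real n) * grem_energy d a (\<xi> n) e \<omega>)))" for e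
        by (subst \<beta>') (simp flip: exp_of_real)
      then have "grem_partition d a N \<xi> n \<beta> \<omega> =
          of_real (\<Sum>e\<in>grem_leaves d (N n). exp (Re \<beta> * (sqrt (real n) * grem_energy d a (\<xi> n) e \<omega>)))"
        unfolding grem_partition_def by simp
      then have "cmod (grem_partition d a N \<xi> n \<beta> \<omega>) =
          (\<Sum>e\<in>grem_leaves d (N n). exp (Re \<beta> * (sqrt (real n) * grem_energy d a (\<xi> n) e \<omega>)))"
        by (simp only: norm_of_real) (simp add: sum_nonneg)
      then show ?thesis
        using elim by (simp only:) (intro member_le_sum finite_grem_leaves, auto)
    qed
    then show ?case by (intro exI[of _ "\<lambda>_. 1"]) (auto simp: emeasure_space_1)
  qed
  then show ?thesis by (intro exI[of _ 1]) auto
next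
  case False
  have ad: "a d > 0" using a d by auto
  \<comment> \<open>A lower bound, for all n \<ge> 1, of the frequency |Im \<beta>| * sqrt (n * a d)
    with which the leaf variable rotates its term; it makes C independent of n.\<close>
  define T0 where "T0 = \<bar>Im \<beta>\<bar> * sqrt (a d)"
  have T0: "T0 > 0" using False ad by (simp add: T0_def)
  obtain C where C: "\<And>T u. T0 \<le> \<bar>T\<bar> \<Longrightarrow> cmod u = 1 \<Longrightarrow>
    (\<integral>\<^sup>+x. inverse (ennreal (\<bar>Im (cis (T * x) * u)\<bar> powr (1/4))) \<partial>std_normal_distribution) \<le> ennreal C"
    using nn_integral_inverse_sin[OF T0] by auto
  have "\<forall>\<^sub>F n in sequentially. \<exists>S. S \<in> borel_measurable M \<and>
    (\<forall>\<omega>. 0 \<le> S \<omega> \<and> S \<omega> \<le> 1 \<and>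
      exp (Re \<beta> * (sqrt (real n) * grem_energy d a (\<xi> n) first_leaf \<omega>)) * S \<omega>
        \<le> cmod (grem_partition d a N \<xi> n \<beta> \<omega>)) \<and>
    (\<integral>\<^sup>+\<omega>. inverse (ennreal (S \<omega> powr (1/4))) \<partial>M) \<le> ennreal (max C 0)"
    using eventually_first_leaf eventually_gt_at_top[of 0]
  proof eventually_elim
    case (elim n)
    define e0 where "e0 = first_leaf"
    have e0: "e0 \<in> grem_leaves d (N n)" using elim by (simp add: e0_def)
    have len: "length e0 = d" by (simp add: e0_def first_leaf_def)
    have e0V: "e0 \<in> grem_vertices d (N n)" using e0 d by (auto simp: grem_vertices_iff)
    define V where "V = grem_vertices d (N n) - {e0}"
    \<comment> \<open>w collects the ancestors of the leaf, levels 1 to d - 1, and R collects the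
      other leaves. Both depend only on the disorder off the leaf, because no other leaf has
      \<open>e0\<close> on its path.\<close>
    define w where "w x = exp (\<beta> * of_real (sqrt (real n) * (\<Sum>j=1..<d. sqrt (a j) * x (take j e0))))"
      for x :: "nat list \<Rightarrow> real"
    define R where "R x = (\<Sum>e\<in>grem_leaves d (N n) - {e0}.
        exp (\<beta> * of_real (sqrt (real n) * (\<Sum>j=1..d. sqrt (a j) * x (take j e)))))"
      for x :: "nat list \<Rightarrow> real"
    define v where "v x = R x / w x" for x
    \<comment> \<open>A unit factor that rotates v onto the real axis, so that after rotation the
      summand v is invisible in the imaginary part. For v = 0 any unit factor would do.\<close>
    define u where "u x = (if v x = 0 then 1 else of_real (cmod (v x)) / v x)" for x
    have u1: "cmod (u x) = 1" for x by (simp add: u_def norm_divide)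
    have uv: "Im (v x * u x) = 0" for x
    proof -
      have "v x * u x = of_real (cmod (v x))" by (simp add: u_def)
      then show ?thesis by (simp only: Im_complex_of_real)
    qed
    define conf where "conf \<omega> = restrict (\<lambda>v. \<xi> n v \<omega>) V" for \<omega>
    have takeV: "take j e \<in> V" if "e \<in> grem_leaves d (N n)" "j \<in> {1..d}" "e \<noteq> e0 \<or> j < d" for e j
    proof -
      have "take j e \<noteq> e0"
      proof
        assume *: "take j e = e0"
        have l: "length e = d" using that(1) by (rule length_grem_leaves)
        have "length (take j e) = d" unfolding * by (rule len)
        then have "j = d" using l that(2) by simp
        then show False using * that(3) l by simp
      qed
      then show ?thesis using take_leaf_in_vertices[OF that(1,2)] by (simp add: V_def)
    qed
    have comp: "(\<lambda>x. x (take j e)) \<in> measurable (PiM V (\<lambda>_. borel)) (borel :: real measure)"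
      if "e \<in> grem_leaves d (N n)" "j \<in> {1..d}" "e \<noteq> e0 \<or> j < d" for e j
      by (rule measurable_component_singleton[OF takeV[OF that]])
    have wm[measurable]: "w \<in> borel_measurable (PiM V (\<lambda>_. borel))"
    proof -
      have [measurable]: "(\<lambda>x. \<Sum>j=1..<d. sqrt (a j) * x (take j e0)) \<in> borel_measurable (PiM V (\<lambda>_. borel))"
        by (intro borel_measurable_sum borel_measurable_times comp e0) auto
      show ?thesis unfolding w_def[abs_def] by measurable
    qed
    have Rm[measurable]: "R \<in> borel_measurable (PiM V (\<lambda>_. borel))"
      unfolding R_def[abs_def]
    proof (rule borel_measurable_sum)
      fix e assume e: "e \<in> grem_leaves d (N n) - {e0}"
      have [measurable]: "(\<lambda>x. \<Sum>j=1..d. sqrt (a j) * x (take j e)) \<in> borel_measurable (PiM V (\<lambda>_. borel))"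
        by (intro borel_measurable_sum borel_measurable_times comp) (use e in auto)
      show "(\<lambda>x. exp (\<beta> * of_real (sqrt (real n) * (\<Sum>j=1..d. sqrt (a j) * x (take j e)))))
          \<in> borel_measurable (PiM V (\<lambda>_. borel))" by measurable
    qed
    have um[measurable]: "u \<in> borel_measurable (PiM V (\<lambda>_. borel))"
      unfolding u_def[abs_def] v_def[abs_def] by measurable
    define T where "T = Im \<beta> * sqrt (real n * a d)"
    have TT: "T0 \<le> \<bar>T\<bar>"
    proof -
      have "sqrt (a d) \<le> sqrt (real n * a d)" using elim(2) ad by simp
      then have "sqrt (a d) \<le> \<bar>sqrt (real n * a d)\<bar>" by (rule order_trans[OF _ abs_ge_self])
      then show ?thesis unfolding T_def T0_def abs_mult by (rule mult_left_mono) simp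
    qed
    define U where "U \<omega> = u (conf \<omega>)" for \<omega>
    define S where "S \<omega> = \<bar>Im (cis (T * \<xi> n e0 \<omega>) * U \<omega>)\<bar>" for \<omega>
    have ind: "indep_var borel (\<lambda>\<omega>. complex_of_real (\<xi> n e0 \<omega>)) borel U"
    proof -
      have "indep_var (PiM {e0} (\<lambda>_. borel)) (\<lambda>\<omega>. restrict (\<lambda>v. \<xi> n v \<omega>) {e0})
          (PiM V (\<lambda>_. borel)) conf"
        unfolding conf_def by (rule indep_var_restrict[OF indep]) (use e0V in \<open>auto simp: V_def\<close>)
      then have "indep_var borel ((\<lambda>x. complex_of_real (x e0)) \<circ> (\<lambda>\<omega>. restrict (\<lambda>v. \<xi> n v \<omega>) {e0})) borel (u \<circ> conf)"
        by (rule indep_var_compose) measurable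
      then show ?thesis by (simp add: comp_def U_def[abs_def])
    qed
    note [measurable] = measurable_\<xi>[OF e0V] indep_var_rv2[OF ind]
    have Sm: "S \<in> borel_measurable M" unfolding S_def[abs_def] cis_conv_exp by measurable
    have S01: "0 \<le> S \<omega>" "S \<omega> \<le> 1" for \<omega>
    proof -
      show "0 \<le> S \<omega>" by (simp add: S_def)
      have "S \<omega> \<le> cmod (cis (T * \<xi> n e0 \<omega>) * U \<omega>)" unfolding S_def by (rule abs_Im_le_cmod)
      then show "S \<omega> \<le> 1" by (simp add: norm_mult U_def u1)
    qed
    have low: "exp (Re \<beta> * (sqrt (real n) * grem_energy d a (\<xi> n) e0 \<omega>)) * S \<omega> \<le> cmod (grem_partition d a N \<xi> n \<beta> \<omega>)" for \<omega>
    proof -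
      define x where "x = \<xi> n e0 \<omega>"
      define b where "b = \<beta> * of_real (sqrt (real n * a d))"
      have energy: "grem_energy d a (\<xi> n) e0 \<omega> = (\<Sum>j=1..<d. sqrt (a j) * conf \<omega> (take j e0)) + sqrt (a d) * x"
      proof -
        have "{1..d} = insert d {1..<d}" using d by auto
        then have "grem_energy d a (\<xi> n) e0 \<omega> = sqrt (a d) * x + (\<Sum>j=1..<d. sqrt (a j) * \<xi> n (take j e0) \<omega>)"
          unfolding grem_energy_def x_def using len by simp
        also have "(\<Sum>j=1..<d. sqrt (a j) * \<xi> n (take j e0) \<omega>) = (\<Sum>j=1..<d. sqrt (a j) * conf \<omega> (take j e0))"
          by (rule sum.cong) (use takeV[OF e0] in \<open>auto simp: conf_def\<close>)
        finally show ?thesis by simp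
      qed
      have first: "exp (\<beta> * of_real (sqrt (real n) * grem_energy d a (\<xi> n) e0 \<omega>)) = w (conf \<omega>) * exp (b * of_real x)"
        unfolding energy w_def b_def mult_exp_exp
        by (rule arg_cong[where f = exp]) (simp add: real_sqrt_mult algebra_simps)
      have rest: "(\<Sum>e\<in>grem_leaves d (N n) - {e0}. exp (\<beta> * of_real (sqrt (real n) * grem_energy d a (\<xi> n) e \<omega>))) = R (conf \<omega>)"
        unfolding R_def
      proof (rule sum.cong[OF refl])
        fix e assume e: "e \<in> grem_leaves d (N n) - {e0}"
        have "grem_energy d a (\<xi> n) e \<omega> = (\<Sum>j=1..d. sqrt (a j) * conf \<omega> (take j e))"
          unfolding grem_energy_def by (rule sum.cong) (use takeV[of e] e in \<open>auto simp: conf_def\<close>)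
        then show "exp (\<beta> * of_real (sqrt (real n) * grem_energy d a (\<xi> n) e \<omega>)) =
            exp (\<beta> * of_real (sqrt (real n) * (\<Sum>j=1..d. sqrt (a j) * conf \<omega> (take j e))))" by simp
      qed
      have "grem_partition d a N \<xi> n \<beta> \<omega> = w (conf \<omega>) * exp (b * of_real x) + R (conf \<omega>)"
        unfolding grem_partition_def first[symmetric] rest[symmetric]
        using e0 by (rule sum.remove[OF finite_grem_leaves])
      also have "\<dots> = w (conf \<omega>) * (exp (b * of_real x) + v (conf \<omega>))"
        by (simp add: v_def w_def field_simps)
      finally have Z: "cmod (grem_partition d a N \<xi> n \<beta> \<omega>) = cmod (w (conf \<omega>)) * cmod (exp (b * of_real x) + v (conf \<omega>))"
        by (simp add: norm_mult)
      have "exp (Re b * x) * S \<omega> = \<bar>Im (exp (b * of_real x) * U \<omega>)\<bar>"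
      proof -
        have "exp (b * of_real x) = of_real (exp (Re b * x)) * cis (Im b * x)"
          by (simp add: exp_eq_polar exp_of_real)
        moreover have "Im b = T" by (simp add: b_def T_def)
        ultimately have "Im (exp (b * of_real x) * U \<omega>) = exp (Re b * x) * Im (cis (T * x) * U \<omega>)"
          by (simp add: mult.assoc del: times_complex.sel(2)) (simp add: algebra_simps)
        then show ?thesis by (simp add: S_def x_def abs_mult del: times_complex.sel)
      qed
      also have "Im (exp (b * of_real x) * U \<omega>) = Im ((exp (b * of_real x) + v (conf \<omega>)) * U \<omega>)"
        using uv[of "conf \<omega>"] unfolding U_def distrib_right plus_complex.sel(2) by simp
      also have "\<bar>Im ((exp (b * of_real x) + v (conf \<omega>)) * U \<omega>)\<bar> \<le> cmod (exp (b * of_real x) + v (conf \<omega>))"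
        using abs_Im_le_cmod[of "(exp (b * of_real x) + v (conf \<omega>)) * U \<omega>"] unfolding norm_mult by (simp add: U_def u1)
      finally have "cmod (w (conf \<omega>)) * (exp (Re b * x) * S \<omega>) \<le> cmod (grem_partition d a N \<xi> n \<beta> \<omega>)"
        unfolding Z by (intro mult_left_mono) auto
      moreover have "cmod (w (conf \<omega>)) * exp (Re b * x) = exp (Re \<beta> * (sqrt (real n) * grem_energy d a (\<xi> n) e0 \<omega>))"
        using arg_cong[OF first, of cmod] by (simp add: norm_mult)
      ultimately show ?thesis by (simp add: mult.assoc[symmetric])
    qed
    have "(\<integral>\<^sup>+\<omega>. inverse (ennreal (S \<omega> powr (1/4))) \<partial>M) \<le> ennreal (max C 0)"
    proof -
      let ?X = "\<lambda>\<omega>. complex_of_real (\<xi> n e0 \<omega>)"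
      interpret DX: prob_space "distr M borel ?X" by (rule prob_space_distr) simp
      interpret DU: prob_space "distr M borel U" by (rule prob_space_distr) simp
      interpret P: pair_prob_space "distr M borel ?X" "distr M borel U" ..
      define f where "f = (\<lambda>(z, u). inverse (ennreal (\<bar>Im (cis (T * Re z) * u)\<bar> powr (1/4))))"
      have fm[measurable]: "f \<in> borel_measurable (borel \<Otimes>\<^sub>M borel)"
        unfolding f_def cis_conv_exp by measurable
      have fm2[measurable]: "f \<in> borel_measurable (distr M borel ?X \<Otimes>\<^sub>M distr M borel U)"
        by (subst measurable_cong_sets[OF sets_pair_measure_cong refl, of _ borel _ borel]) auto
      have eq: "distr M borel ?X \<Otimes>\<^sub>M distr M borel U = distr M (borel \<Otimes>\<^sub>M borel) (\<lambda>\<omega>. (?X \<omega>, U \<omega>))"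
        using ind unfolding indep_var_distribution_eq by simp
      \<comment> \<open>With the direction frozen, \<open>nn_integral_inverse_sin\<close> gives the
        same constant for every unit y, so that integrating over the law of U costs nothing.\<close>
      have inner: "(\<integral>\<^sup>+z. f (z, y) \<partial>distr M borel ?X) \<le> ennreal C" if "cmod y = 1" for y
      proof -
        have [measurable]: "(\<lambda>z. f (z, y)) \<in> borel_measurable borel" by measurable
        have [measurable]: "(\<lambda>x. f (complex_of_real x, y)) \<in> borel_measurable borel" by measurable
        have "(\<integral>\<^sup>+z. f (z, y) \<partial>distr M borel ?X) = (\<integral>\<^sup>+\<omega>. f (?X \<omega>, y) \<partial>M)"
          by (rule nn_integral_distr) measurable
        also have "\<dots> = (\<integral>\<^sup>+x. f (of_real x, y) \<partial>distr M borel (\<xi> n e0))"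
          by (rule nn_integral_distr[symmetric]) measurable
        also have "\<dots> = (\<integral>\<^sup>+x. f (of_real x, y) \<partial>std_normal_distribution)"
          unfolding distributed_std_normalD(2)[OF normal[OF e0V]] ..
        also have "\<dots> \<le> ennreal C" using C[OF TT that] by (simp add: f_def del: times_complex.sel)
        finally show ?thesis .
      qed
      have "(\<integral>\<^sup>+\<omega>. inverse (ennreal (S \<omega> powr (1/4))) \<partial>M) = (\<integral>\<^sup>+\<omega>. f (?X \<omega>, U \<omega>) \<partial>M)"
        by (simp add: f_def S_def del: times_complex.sel)
      also have "\<dots> = (\<integral>\<^sup>+z. f z \<partial>distr M (borel \<Otimes>\<^sub>M borel) (\<lambda>\<omega>. (?X \<omega>, U \<omega>)))"
        by (rule nn_integral_distr[symmetric]) measurable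
      also have "\<dots> = nn_integral (distr M borel ?X \<Otimes>\<^sub>M distr M borel U) f" unfolding eq ..
      also have "\<dots> = (\<integral>\<^sup>+y. \<integral>\<^sup>+z. f (z, y) \<partial>distr M borel ?X \<partial>distr M borel U)"
        by (rule P.nn_integral_snd[symmetric]) measurable
      also have "\<dots> = (\<integral>\<^sup>+\<omega>. \<integral>\<^sup>+z. f (z, U \<omega>) \<partial>distr M borel ?X \<partial>M)"
        by (rule nn_integral_distr) measurable
      also have "\<dots> \<le> (\<integral>\<^sup>+\<omega>. ennreal C \<partial>M)"
        by (intro nn_integral_mono inner) (simp add: U_def u1)
      also have "\<dots> \<le> ennreal (max C 0)" by (simp add: emeasure_space_1 ennreal_leI)
      finally show ?thesis .
    qed
    then show ?case using Sm S01 low unfolding e0_def by blast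
  qed
  then show ?thesis by (intro exI[of _ "max C 0"]) auto
qed

end

section \<open>Exponential moments of ln |Z| / n\<close>

context grem
begin

lemma nn_integral_exp_normal:
  assumes X: "distributed M lborel X std_normal_density"
  shows "(\<integral>\<^sup>+\<omega>. ennreal (exp (c * X \<omega>)) \<partial>M) = ennreal (exp (c\<^sup>2 / 2))"
proof -
  have "integrable M (\<lambda>\<omega>. exp (c * X \<omega>))" "expectation (\<lambda>\<omega>. exp (c * X \<omega>)) = exp (c\<^sup>2 / 2)"
    using distributed_std_normal_integral[OF X, of "\<lambda>x. exp (c * x)"] integral_std_normal_exp_real[of c]
    by auto
  then show ?thesis by (subst nn_integral_eq_integral) auto
qed

text \<open>Let X be the normalised logarithm and E the energy of the leaf. For X \<ge> 0 and Z
  \<noteq> 0 the left side is |Z| powr (\<kappa> / n). For X < 0 the bound from the leaf and sqrt n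
  \<le> n give |X| \<le> Re \<beta> * |E| - ln S, and the product of the two exponentials is split
  by A * B \<le> A^2 + B^2. The squares give the factor 2 and \<open>exp_sum_le_sum_exp\<close> the
  factor d in g, while \<kappa> \<le> 1/8 bounds B^2 by S powr (-1/4). For S = 0 the last summand is
  infinite.\<close>

lemma log_partition_exp_le:
  assumes n: "n > 0" and \<kappa>: "0 < \<kappa>" "\<kappa> \<le> 1/8"
    and S: "0 \<le> S" "S \<le> 1"
      "exp (Re \<beta> * (sqrt (real n) * grem_energy d a (\<xi> n) first_leaf \<omega>)) * S \<le> cmod (grem_partition d a N \<xi> n \<beta> \<omega>)"
    and g: "\<And>j. g j = real d * (2 * \<kappa> * Re \<beta> * sqrt (a j))"
  shows "ennreal (exp (\<kappa> * \<bar>grem_log_partition d a N \<xi> \<beta> n \<omega>\<bar>)) \<le>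
    1 + ennreal (cmod (grem_partition d a N \<xi> n \<beta> \<omega>) powr (\<kappa> / real n)) +
    (\<Sum>j=1..d. ennreal (exp (g j * \<xi> n (take j first_leaf) \<omega>)) + ennreal (exp (- g j * \<xi> n (take j first_leaf) \<omega>))) +
    inverse (ennreal (S powr (1/4)))"
proof -
  define Z where "Z = cmod (grem_partition d a N \<xi> n \<beta> \<omega>)"
  define X where "X = grem_log_partition d a N \<xi> \<beta> n \<omega>"
  define E where "E = grem_energy d a (\<xi> n) first_leaf \<omega>"
  define x where "x j = \<xi> n (take j first_leaf) \<omega>" for j
  have X: "X = ln Z / real n" by (simp add: X_def Z_def grem_log_partition_def)
  have Z0: "Z \<ge> 0" by (simp add: Z_def)
  define Q where "Q = (\<Sum>j=1..d. ennreal (exp (g j * x j)) + ennreal (exp (- g j * x j)))"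
  have "ennreal (exp (\<kappa> * \<bar>X\<bar>)) \<le> 1 + ennreal (Z powr (\<kappa> / real n)) + Q + inverse (ennreal (S powr (1/4)))"
  proof (cases "X \<ge> 0")
    case True
    show ?thesis
    proof (cases "Z = 0")
      case True
      then have "X = 0" by (simp add: X)
      then show ?thesis by (simp add: add.assoc)
    next
      case False
      then have "exp (\<kappa> * \<bar>X\<bar>) = Z powr (\<kappa> / real n)"
        unfolding abs_of_nonneg[OF True] by (simp add: X powr_def)
      then have "ennreal (exp (\<kappa> * \<bar>X\<bar>)) \<le> 1 + ennreal (Z powr (\<kappa> / real n))" by simp
      also have "\<dots> \<le> 1 + ennreal (Z powr (\<kappa> / real n)) + (Q + inverse (ennreal (S powr (1/4))))" by simp
      finally show ?thesis by (simp only: add.assoc)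
    qed
  next
    case neg: False
    show ?thesis
    proof (cases "S = 0")
      case True
      then show ?thesis by simp
    next
      case False
      then have Spos: "S > 0" using S by simp
      have low: "exp (Re \<beta> * (sqrt (real n) * E)) * S \<le> Z" using S(3) by (simp add: E_def Z_def)
      moreover have "0 < exp (Re \<beta> * (sqrt (real n) * E)) * S" using Spos by simp
      ultimately have "ln (exp (Re \<beta> * (sqrt (real n) * E)) * S) \<le> ln Z" by (subst ln_le_cancel_iff) auto
      then have "Re \<beta> * (sqrt (real n) * E) + ln S \<le> ln Z" using Spos by (simp add: ln_mult)
      then have "- ln Z \<le> - (Re \<beta> * (sqrt (real n) * E)) + (- ln S)" by simp
      also have "\<dots> \<le> real n * (Re \<beta> * \<bar>E\<bar>) + real n * (- ln S)"
      proof (rule add_mono)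
        have n1: "real n \<ge> 1" using n by simp
        have "sqrt (real n) \<le> real n"
          by (rule real_le_lsqrt) (use n1 in \<open>auto simp: power2_eq_square intro: mult_left_le\<close>)
        have "- (Re \<beta> * (sqrt (real n) * E)) \<le> \<bar>Re \<beta> * (sqrt (real n) * E)\<bar>" by simp
        also have "\<dots> = sqrt (real n) * (Re \<beta> * \<bar>E\<bar>)" using \<beta> by (simp add: abs_mult)
        also have "\<dots> \<le> real n * (Re \<beta> * \<bar>E\<bar>)"
          using \<open>sqrt (real n) \<le> real n\<close> \<beta> by (intro mult_right_mono) auto
        finally show "- (Re \<beta> * (sqrt (real n) * E)) \<le> real n * (Re \<beta> * \<bar>E\<bar>)" .
        have "- ln S \<ge> 0" using Spos S by simp
        then have "1 * (- ln S) \<le> real n * (- ln S)" using n1 by (intro mult_right_mono) auto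
        then show "- ln S \<le> real n * (- ln S)" by simp
      qed
      finally have "- ln Z / real n \<le> Re \<beta> * \<bar>E\<bar> + - ln S"
        using n by (simp add: field_simps)
      then have absX: "\<bar>X\<bar> \<le> Re \<beta> * \<bar>E\<bar> + - ln S" using neg unfolding X by simp
      define A where "A = exp (\<kappa> * (Re \<beta> * \<bar>E\<bar>))"
      define B where "B = exp (\<kappa> * (- ln S))"
      have "exp (\<kappa> * \<bar>X\<bar>) \<le> exp (\<kappa> * (Re \<beta> * \<bar>E\<bar> + - ln S))"
        using absX \<kappa> by simp
      also have "\<dots> = A * B" by (simp only: A_def B_def distrib_left exp_add)
      also have "\<dots> \<le> A\<^sup>2 + B\<^sup>2"
      proof -
        have "2 * A * B \<le> A\<^sup>2 + B\<^sup>2" by (rule sum_squares_bound)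
        moreover have "0 \<le> A * B" by (simp add: A_def B_def)
        ultimately show ?thesis by simp
      qed
      also have "A\<^sup>2 \<le> (\<Sum>j=1..d. exp (g j * x j) + exp (- g j * x j))"
      proof -
        have "A\<^sup>2 = exp (2 * \<kappa> * Re \<beta> * \<bar>E\<bar>)"
          unfolding A_def exp_double[symmetric] by (simp add: mult_ac)
        also have "\<dots> \<le> exp (\<Sum>j=1..d. 2 * \<kappa> * Re \<beta> * sqrt (a j) * \<bar>x j\<bar>)"
        proof -
          have "\<bar>E\<bar> \<le> (\<Sum>j=1..d. \<bar>sqrt (a j) * x j\<bar>)"
            unfolding E_def grem_energy_def x_def by (rule sum_abs)
          also have "\<dots> = (\<Sum>j=1..d. sqrt (a j) * \<bar>x j\<bar>)"
            by (rule sum.cong) (use a in \<open>auto simp: abs_mult less_imp_le\<close>)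
          finally have "2 * \<kappa> * Re \<beta> * \<bar>E\<bar> \<le> 2 * \<kappa> * Re \<beta> * (\<Sum>j=1..d. sqrt (a j) * \<bar>x j\<bar>)"
            using \<kappa> \<beta> by (intro mult_left_mono) auto
          then show ?thesis by (simp add: sum_distrib_left mult.assoc)
        qed
        also have "\<dots> \<le> (\<Sum>j=1..d. exp (real (card {1..d}) * (2 * \<kappa> * Re \<beta> * sqrt (a j) * \<bar>x j\<bar>)))"
          using d by (intro exp_sum_le_sum_exp) auto
        also have "\<dots> \<le> (\<Sum>j=1..d. exp (g j * x j) + exp (- g j * x j))"
        proof (rule sum_mono)
          fix j assume j: "j \<in> {1..d}"
          have "g j \<ge> 0" using \<kappa> \<beta> a[OF j] by (simp add: g)
          then have "real (card {1..d}) * (2 * \<kappa> * Re \<beta> * sqrt (a j) * \<bar>x j\<bar>) = \<bar>g j * x j\<bar>"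
            by (simp add: abs_mult) (simp add: g)
          then show "exp (real (card {1..d}) * (2 * \<kappa> * Re \<beta> * sqrt (a j) * \<bar>x j\<bar>)) \<le> exp (g j * x j) + exp (- g j * x j)"
            using exp_abs_le[of "g j * x j"] by simp
        qed
        finally show ?thesis .
      qed
      also have "B\<^sup>2 \<le> inverse (S powr (1/4))"
      proof -
        have "- ln S \<ge> 0" using Spos S by simp
        then have "2 * \<kappa> * (- ln S) \<le> 1/4 * (- ln S)" using \<kappa> by (intro mult_right_mono) auto
        then have "exp (2 * (\<kappa> * (- ln S))) \<le> exp (- (1/4 * ln S))" by (simp add: mult_ac)
        also have "\<dots> = inverse (S powr (1/4))" using Spos by (simp add: powr_def exp_minus)
        finally show ?thesis unfolding B_def exp_double[symmetric] .
      qed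
      finally have "exp (\<kappa> * \<bar>X\<bar>) \<le> (\<Sum>j=1..d. exp (g j * x j) + exp (- g j * x j)) + inverse (S powr (1/4))"
        by simp
      then have "ennreal (exp (\<kappa> * \<bar>X\<bar>)) \<le> ennreal ((\<Sum>j=1..d. exp (g j * x j) + exp (- g j * x j)) + inverse (S powr (1/4)))"
        by (rule ennreal_leI)
      also have "\<dots> = Q + inverse (ennreal (S powr (1/4)))"
      proof -
        have "Q = ennreal (\<Sum>j=1..d. exp (g j * x j) + exp (- g j * x j))"
          unfolding Q_def by (subst sum_ennreal[symmetric]) (auto simp: ennreal_plus intro: add_nonneg_nonneg)
        moreover have "inverse (ennreal (S powr (1/4))) = ennreal (inverse (S powr (1/4)))"
          using Spos by (simp add: inverse_ennreal)
        ultimately show ?thesis by (simp add: ennreal_plus sum_nonneg add_nonneg_nonneg)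
      qed
      also have "\<dots> \<le> (1 + ennreal (Z powr (\<kappa> / real n))) + (Q + inverse (ennreal (S powr (1/4))))" by simp
      finally show ?thesis by (simp only: add.assoc)
    qed
  qed
  then show ?thesis by (simp only: X_def Z_def Q_def x_def)
qed

text \<open>All summands in \<open>log_partition_exp_le\<close> have bounded means. For the power of
  |Z| this is interpolation from order R down to \<kappa> / n: the factor n in the exponential rate
  cancels and exp (\<kappa> * (p + 1)) remains.\<close>

lemma log_partition_exp_moment:
  "\<exists>\<kappa>>0. \<exists>C. \<forall>\<^sub>F n in sequentially.
    (\<integral>\<^sup>+\<omega>. ennreal (exp (\<kappa> * \<bar>grem_log_partition d a N \<xi> \<beta> n \<omega>\<bar>)) \<partial>M) \<le> ennreal C"
proof -
  define R where "R = moment_rest d"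
  have R: "R > 0" using moment_rest_pos by (simp add: R_def)
  \<comment> \<open>The 1/8 serves the lower tail; R keeps the order \<kappa> / n within the moments
    that are available.\<close>
  define \<kappa> where "\<kappa> = min (1/8) R"
  have \<kappa>: "0 < \<kappa>" "\<kappa> \<le> 1/8" "\<kappa> \<le> R" using R by (auto simp: \<kappa>_def)
  define p where "p = p_rest d"
  define g where "g j = real d * (2 * \<kappa> * Re \<beta> * sqrt (a j))" for j
  obtain C where C: "C \<ge> 0" and low: "\<forall>\<^sub>F n in sequentially. \<exists>S. S \<in> borel_measurable M \<and>
    (\<forall>\<omega>. 0 \<le> S \<omega> \<and> S \<omega> \<le> 1 \<and>
      exp (Re \<beta> * (sqrt (real n) * grem_energy d a (\<xi> n) first_leaf \<omega>)) * S \<omega>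
        \<le> cmod (grem_partition d a N \<xi> n \<beta> \<omega>)) \<and>
    (\<integral>\<^sup>+\<omega>. inverse (ennreal (S \<omega> powr (1/4))) \<partial>M) \<le> ennreal C"
    using first_leaf_lower_bound by auto
  define G where "G = (\<Sum>j=1..d. 2 * exp ((g j)\<^sup>2 / 2))"
  have "moment_rate M R p (subtrees d)" using rates[of d] by (simp add: R_def p_def)
  then have "\<forall>\<^sub>F n in sequentially. \<forall>W\<in>subtrees d n. W \<in> borel_measurable M \<and>
     integrable M (\<lambda>\<omega>. cmod (W \<omega>) powr R) \<and>
     expectation (\<lambda>\<omega>. cmod (W \<omega>) powr R) \<le> exp (real n * (R * (p + 1)))"
    unfolding moment_rate_def by (simp only: zero_less_one)
  then have "\<forall>\<^sub>F n in sequentially.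
    (\<integral>\<^sup>+\<omega>. ennreal (exp (\<kappa> * \<bar>grem_log_partition d a N \<xi> \<beta> n \<omega>\<bar>)) \<partial>M)
      \<le> ennreal (1 + exp (\<kappa> * (p + 1)) + G + C)"
    using low eventually_first_leaf eventually_gt_at_top[of 0]
  proof eventually_elim
    case (elim n)
    define Z where "Z = grem_partition d a N \<xi> n \<beta>"
    have Z: "integrable M (\<lambda>\<omega>. cmod (Z \<omega>) powr R)"
        "expectation (\<lambda>\<omega>. cmod (Z \<omega>) powr R) \<le> exp (real n * (R * (p + 1)))"
      using elim(1)[rule_format, OF grem_partition_in_subtrees] by (auto simp: Z_def)
    have [measurable]: "Z \<in> borel_measurable M" unfolding Z_def by measurable
    obtain S where [measurable]: "S \<in> borel_measurable M"
      and S: "\<And>\<omega>. 0 \<le> S \<omega>" "\<And>\<omega>. S \<omega> \<le> 1"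
        "\<And>\<omega>. exp (Re \<beta> * (sqrt (real n) * grem_energy d a (\<xi> n) first_leaf \<omega>)) * S \<omega>
          \<le> cmod (grem_partition d a N \<xi> n \<beta> \<omega>)"
      and SC: "(\<integral>\<^sup>+\<omega>. inverse (ennreal (S \<omega> powr (1/4))) \<partial>M) \<le> ennreal C"
      using elim(2) by (elim exE conjE) blast
    define x where "x j = \<xi> n (take j first_leaf)" for j
    have xn: "distributed M lborel (x j) std_normal_density" if "j \<in> {1..d}" for j
      unfolding x_def by (rule normal[OF take_leaf_in_vertices[OF elim(3) that]])
    have xm[measurable]: "x j \<in> borel_measurable M" if "j \<in> {1..d}" for j
      using distributed_std_normalD(1)[OF xn[OF that]] .
    have ZI: "(\<integral>\<^sup>+\<omega>. ennreal (cmod (Z \<omega>) powr (\<kappa> / real n)) \<partial>M) \<le> ennreal (exp (\<kappa> * (p + 1)))"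
    proof -
      have r: "0 < \<kappa> / real n" "\<kappa> / real n \<le> R"
      proof -
        have "\<kappa> / real n \<le> \<kappa> / 1" using elim(4) \<kappa> by (intro divide_left_mono) auto
        then show "\<kappa> / real n \<le> R" using \<kappa> by simp
      qed (use elim(4) \<kappa> in simp)
      have nm: "(\<lambda>\<omega>. cmod (Z \<omega>)) \<in> borel_measurable M" by measurable
      note E = expectation_powr_le[OF nm norm_ge_zero r Z exp_gt_zero]
      have "exp (real n * (R * (p + 1))) powr (\<kappa> / real n / R) = exp (\<kappa> * (p + 1))"
        using R elim(4) by (simp add: exp_powr_real)
      then show ?thesis using E by (subst nn_integral_eq_integral) (auto intro!: ennreal_leI)
    qed
    have QI: "(\<integral>\<^sup>+\<omega>. (\<Sum>j=1..d. ennreal (exp (g j * x j \<omega>)) + ennreal (exp (- g j * x j \<omega>))) \<partial>M) = ennreal G"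
    proof -
      have "(\<integral>\<^sup>+\<omega>. (\<Sum>j=1..d. ennreal (exp (g j * x j \<omega>)) + ennreal (exp (- g j * x j \<omega>))) \<partial>M) =
          (\<Sum>j=1..d. \<integral>\<^sup>+\<omega>. ennreal (exp (g j * x j \<omega>)) + ennreal (exp (- g j * x j \<omega>)) \<partial>M)"
        by (rule nn_integral_sum) (use xm in measurable)
      also have "\<dots> = (\<Sum>j=1..d. ennreal (2 * exp ((g j)\<^sup>2 / 2)))"
      proof (rule sum.cong[OF refl])
        fix j assume j: "j \<in> {1..d}"
        note [measurable] = xm[OF j]
        have "(\<integral>\<^sup>+\<omega>. ennreal (exp (g j * x j \<omega>)) + ennreal (exp (- g j * x j \<omega>)) \<partial>M) =
            (\<integral>\<^sup>+\<omega>. ennreal (exp (g j * x j \<omega>)) \<partial>M) + (\<integral>\<^sup>+\<omega>. ennreal (exp (- g j * x j \<omega>)) \<partial>M)"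
          by (rule nn_integral_add) measurable
        also have "\<dots> = ennreal (exp ((g j)\<^sup>2 / 2)) + ennreal (exp ((- g j)\<^sup>2 / 2))"
          by (simp only: nn_integral_exp_normal[OF xn[OF j]])
        also have "\<dots> = ennreal (2 * exp ((g j)\<^sup>2 / 2))" by (simp flip: ennreal_plus)
        finally show "(\<integral>\<^sup>+\<omega>. ennreal (exp (g j * x j \<omega>)) + ennreal (exp (- g j * x j \<omega>)) \<partial>M) = \<dots>" .
      qed
      also have "\<dots> = ennreal G" unfolding G_def by (rule sum_ennreal) auto
      finally show ?thesis .
    qed
    have Qm: "(\<lambda>\<omega>. \<Sum>j=1..d. ennreal (exp (g j * x j \<omega>)) + ennreal (exp (- g j * x j \<omega>))) \<in> borel_measurable M"
      by (rule borel_measurable_sum) (use xm in measurable)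
    have "(\<integral>\<^sup>+\<omega>. ennreal (exp (\<kappa> * \<bar>grem_log_partition d a N \<xi> \<beta> n \<omega>\<bar>)) \<partial>M) \<le>
      (\<integral>\<^sup>+\<omega>. 1 + ennreal (cmod (Z \<omega>) powr (\<kappa> / real n)) +
        (\<Sum>j=1..d. ennreal (exp (g j * x j \<omega>)) + ennreal (exp (- g j * x j \<omega>))) +
        inverse (ennreal (S \<omega> powr (1/4))) \<partial>M)"
      unfolding Z_def x_def
      by (rule nn_integral_mono) (rule log_partition_exp_le[OF elim(4) \<kappa>(1,2) S g_def])
    also have "\<dots> = (\<integral>\<^sup>+\<omega>. 1 + ennreal (cmod (Z \<omega>) powr (\<kappa> / real n)) \<partial>M) +
        (\<integral>\<^sup>+\<omega>. (\<Sum>j=1..d. ennreal (exp (g j * x j \<omega>)) + ennreal (exp (- g j * x j \<omega>))) \<partial>M) +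
        (\<integral>\<^sup>+\<omega>. inverse (ennreal (S \<omega> powr (1/4))) \<partial>M)"
      using Qm by (subst nn_integral_add, measurable, subst nn_integral_add, measurable)
    also have "(\<integral>\<^sup>+\<omega>. 1 + ennreal (cmod (Z \<omega>) powr (\<kappa> / real n)) \<partial>M) =
        1 + (\<integral>\<^sup>+\<omega>. ennreal (cmod (Z \<omega>) powr (\<kappa> / real n)) \<partial>M)"
      by (subst nn_integral_add) (measurable, simp add: emeasure_space_1)
    also have "1 + (\<integral>\<^sup>+\<omega>. ennreal (cmod (Z \<omega>) powr (\<kappa> / real n)) \<partial>M) +
        (\<integral>\<^sup>+\<omega>. (\<Sum>j=1..d. ennreal (exp (g j * x j \<omega>)) + ennreal (exp (- g j * x j \<omega>))) \<partial>M) +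
        (\<integral>\<^sup>+\<omega>. inverse (ennreal (S \<omega> powr (1/4))) \<partial>M) \<le>
        1 + ennreal (exp (\<kappa> * (p + 1))) + ennreal G + ennreal C"
      unfolding QI by (intro add_mono order_refl ZI SC)
    also have "\<dots> = ennreal (1 + exp (\<kappa> * (p + 1)) + G + C)"
    proof -
      have "G \<ge> 0" by (simp add: G_def sum_nonneg)
      then show ?thesis using C by (simp add: ennreal_plus add_nonneg_nonneg)
    qed
    finally show ?case .
  qed
  then show ?thesis using \<kappa>(1) by blast
qed

lemma log_partition_tendsto:
  "tendsto_in_probability M (grem_log_partition d a N \<xi> \<beta>) (\<lambda>_. \<Sum>k=1..d. grem_p (a k) (\<alpha> k) \<beta>)
   \<and> (\<forall>q\<ge>1. tendsto_in_Lq M q (grem_log_partition d a N \<xi> \<beta>) (\<lambda>_. \<Sum>k=1..d. grem_p (a k) (\<alpha> k) \<beta>))"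
proof -
  obtain \<kappa> C where "\<kappa> > 0" "\<forall>\<^sub>F n in sequentially.
      (\<integral>\<^sup>+\<omega>. ennreal (exp (\<kappa> * \<bar>grem_log_partition d a N \<xi> \<beta> n \<omega>\<bar>)) \<partial>M) \<le> ennreal C"
    using log_partition_exp_moment by blast
  then have "tendsto_in_Lq M q (grem_log_partition d a N \<xi> \<beta>) (\<lambda>_. p_rest d)" if "q \<ge> 1" for q
    using tendsto_in_LqI[OF log_partition_tendsto_in_probability _ that] by blast
  moreover have "p_rest d = (\<Sum>k=1..d. grem_p (a k) (\<alpha> k) \<beta>)" by (simp add: p_rest_def)
  ultimately show ?thesis using log_partition_tendsto_in_probability by simp
qed

end

section \<open>Symmetry under \<beta> \<mapsto> - \<beta> and the conclusion\<close>

lemma in_closure_uminus: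
  fixes S :: "'a :: real_normed_vector set"
  assumes S: "\<And>x. - x \<in> S \<longleftrightarrow> x \<in> S"
  shows "- x \<in> closure S \<longleftrightarrow> x \<in> closure S"
proof -
  have "- y \<in> closure S" if y: "y \<in> closure S" for y
    unfolding closure_approachable
  proof (intro allI impI)
    fix e :: real assume "e > 0"
    then obtain z where "z \<in> S" "dist z y < e" using y unfolding closure_approachable by blast
    then show "\<exists>z\<in>S. dist z (- y) < e" using S by (intro bexI[of _ "- z"]) (auto simp: dist_minus)
  qed
  from this[of x] this[of "- x"] show ?thesis by auto
qed

lemma grem_p_uminus: "grem_p a \<alpha> (- \<beta>) = grem_p a \<alpha> \<beta>"
proof -
  have "- \<beta> \<in> closure (phase_G s) \<longleftrightarrow> \<beta> \<in> closure (phase_G s)"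
    "- \<beta> \<in> closure (phase_F s) \<longleftrightarrow> \<beta> \<in> closure (phase_F s)" for s
    by (auto intro!: in_closure_uminus simp: phase_G_def phase_F_def)
  then show ?thesis by (simp add: grem_p_def Let_def)
qed

theorem theorem2p1:
  fixes M :: "'w measure"
    and d :: nat
    and a \<alpha> :: "nat \<Rightarrow> real"
    and N :: "nat \<Rightarrow> nat \<Rightarrow> nat"
    and \<xi> :: "nat \<Rightarrow> nat list \<Rightarrow> 'w \<Rightarrow> real"
    and \<beta> :: complex
  assumes "prob_space M"
    and "d \<ge> 1"
    and "\<And>j. j \<in> {1..d} \<Longrightarrow> a j > 0"
    and "\<And>j. j \<in> {1..d} \<Longrightarrow> \<alpha> j > 1"
    and "\<And>j. j \<in> {1..d} \<Longrightarrow> (\<lambda>n. real (N n j) / \<alpha> j ^ n) \<longlonglongrightarrow> 1"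
    and "strict_mono_on {1..d} (\<lambda>j. grem_sigma (a j) (\<alpha> j))"
    and "\<And>n. prob_space.indep_vars M (\<lambda>_. borel) (\<xi> n) (grem_vertices d (N n))"
    and "\<And>n w. w \<in> grem_vertices d (N n) \<Longrightarrow> distributed M lborel (\<xi> n w) std_normal_density"
  shows "tendsto_in_probability M (grem_log_partition d a N \<xi> \<beta>)
           (\<lambda>_. \<Sum>k=1..d. grem_p (a k) (\<alpha> k) \<beta>)
       \<and> (\<forall>q\<ge>1. tendsto_in_Lq M q (grem_log_partition d a N \<xi> \<beta>)
           (\<lambda>_. \<Sum>k=1..d. grem_p (a k) (\<alpha> k) \<beta>))"
proof (cases "Re \<beta> \<ge> 0")
  case True
  interpret grem M d a \<alpha> N \<xi> \<beta>
    by (intro grem.intro grem_axioms.intro assms True)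
  show ?thesis by (rule log_partition_tendsto)
next
  case False
  interpret prob_space M by fact
  define \<zeta> where "\<zeta> n w \<omega> = - \<xi> n w \<omega>" for n w \<omega>
  have "indep_vars (\<lambda>_. borel) (\<zeta> n) (grem_vertices d (N n))" for n
    unfolding \<zeta>_def[abs_def] by (rule indep_vars_compose2[OF assms(7)]) auto
  moreover have "distributed M lborel (\<zeta> n w) std_normal_density"
    if "w \<in> grem_vertices d (N n)" for n w
    using normal_density_affine[OF assms(8)[OF that], of "-1" 0] by (simp add: \<zeta>_def[abs_def])
  ultimately interpret grem M d a \<alpha> N \<zeta> "- \<beta>"
    using False by (intro grem.intro grem_axioms.intro assms) auto
  \<comment> \<open>\<beta> and the energy change sign together, so the partition function is the
    same function of \<omega>, not merely equal in law.\<close>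
  have "grem_energy d a (\<zeta> n) e \<omega> = - grem_energy d a (\<xi> n) e \<omega>" for n e \<omega>
    by (simp add: grem_energy_def \<zeta>_def sum_negf)
  then have "grem_log_partition d a N \<zeta> (- \<beta>) = grem_log_partition d a N \<xi> \<beta>"
    by (intro ext) (simp add: grem_log_partition_def grem_partition_def)
  then show ?thesis using log_partition_tendsto by (simp add: grem_p_uminus)
qed

end
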